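(* Let $n\ge2$, $m,m'\ge0$. In the decomposition $L_{m,m'}=\bigoplus_{j=0}^{\min(m,m')}T_{m-j,m'-j}$ of the representation of $U_q(\mathrm{gl}_n)$ on $\mathcal A_{m,m'}$ (the $j$-th summand being realized on $Q^j\mathcal H_{m-j,m'-j}$), the representations $T_{m-j,m'-j}$ of $U_q(\mathrm{gl}_n)$ are irreducible with highest weights $(m-j,0,\dots,0,-m'+j)$, respectively.
   Context: Let $q$ be a nonzero complex number that is not a root of unity (with a fixed square root $q^{1/2}$). Put $[a]=(q^a-q^{-a})/(q-q^{-1})$. $\mathcal A$ is the unital associative $\mathbb C$-algebra generated by $z_1,\dots,z_n,w_1,\dots,w_n$ with relations $z_iz_j=qz_jz_i$ and $w_iw_j=q^{-1}w_jw_i$ for $i<j$; $w_jz_i=qz_iw_j$ for $i\ne j$; $w_kz_k=z_kw_k+(1-q^2)\sum_{s<k}z_sw_s$. Both the monomials $z_1^{r_1}\cdots z_n^{r_n}w_1^{s_1}\cdots w_n^{s_n}$ and the monomials $w_1^{r_1}\cdots w_n^{r_n}z_1^{s_1}\cdots z_n^{s_n}$ form bases of $\mathcal A$. $\mathcal A_{m,m'}$ is the subspace of polynomials homogeneous of degree $m$ in the $z_i$ and of degree $m'$ in the $w_i$. Linear operators $\partial_i,\bar\partial_i$ on $\mathcal A$ are defined on these bases by $\partial_i(z_1^{r_1}\cdots z_n^{r_n}w_1^{s_1}\cdots w_n^{s_n})=q^{r_{i+1}+\cdots+r_n}[r_i]\,z_1^{r_1}\cdots z_i^{r_i-1}\cdots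 z_n^{r_n}w_1^{s_1}\cdots w_n^{s_n}$ and $\bar\partial_i(w_1^{r_1}\cdots w_n^{r_n}z_1^{s_1}\cdots z_n^{s_n})=q^{-(r_{i+1}+\cdots+r_n)}[r_i]\,w_1^{r_1}\cdots w_i^{r_i-1}\cdots w_n^{r_n}z_1^{s_1}\cdots z_n^{s_n}$ (both are $0$ if $r_i=0$). $\Delta_q=\sum_{i=1}^n\partial_i\bar\partial_i$ $(=\sum_{i=1}^n q^{2(i-1)}\bar\partial_i\partial_i)$, $\mathcal H_{m,m'}=\{p\in\mathcal A_{m,m'}:\Delta_qp=0\}$, and $Q=\sum_{i=1}^n z_iw_i$ (central). $U_q(\mathrm{gl}_n)$ is the algebra generated by pairwise commuting invertible $k_i^{\pm1/2}$ ($1\le i\le n$) and $e_j,f_j$ ($1\le j\le n-1$) with $k_i^{1/2}e_jk_i^{-1/2}=q^{a_{ij}/2}e_j$, $k_i^{1/2}f_jk_i^{-1/2}=q^{-a_{ij}/2}f_j$, where $a_{jj}=1$, $a_{j+1,j}=-1$, $a_{ij}=0$ otherwise; $[e_i,f_j]=\delta_{ij}(k_ik_{i+1}^{-1}-k_i^{-1}k_{i+1})/(q-q^{-1})$; $e_i^2e_{i\pm1}-(q+q^{-1})e_ie_{i\pm1}e_i+e_{i\pm1}e_i^2=0$ and the same for the $f$'s; $[e_i,e_j]=[f_i,f_j]=0$ for $|i-j|>1$. Its comultiplication is $k_i^{\pm 1/2}\mapsto k_i^{\pm 1/2}\otimes k_i^{\pm 1/2}$, $e_i\mapsto e_i\otimes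 k_i^{-1/2}k_{i+1}^{1/2}+k_i^{1/2}k_{i+1}^{-1/2}\otimes e_i$, $f_i\mapsto f_i\otimes k_i^{-1/2}k_{i+1}^{1/2}+k_i^{1/2}k_{i+1}^{-1/2}\otimes f_i$; the counit is $\varepsilon(k_i)=1$, $\varepsilon(e_i)=\varepsilon(f_i)=0$. It acts on $\mathcal A$ (representation $L$) by $X\triangleright 1=\varepsilon(X)1$, $k_i^{1/2}\triangleright z_j=q^{\delta_{ij}/2}z_j$, $e_i\triangleright z_j=\delta_{j,i+1}z_{j-1}$, $f_i\triangleright z_j=\delta_{j,i}z_{j+1}$, $k_i^{1/2}\triangleright w_j=q^{-\delta_{ij}/2}w_j$, $e_i\triangleright w_j=-\delta_{j,i}q^{-1}w_{j+1}$, $f_i\triangleright w_j=-\delta_{j,i+1}q\,w_{j-1}$, and $X\triangleright(p_1p_2)=\sum(X_{(1)}\triangleright p_1)(X_{(2)}\triangleright p_2)$. The subspaces $\mathcal A_{m,m'}$ and $\mathcal H_{m,m'}$ are invariant; $L_{m,m'}$ and $T_{m,m'}$ denote the corresponding restrictions of $L$. Multiplication by $Q$ commutes with the action, and $\mathcal A_{m,m'}=\bigoplus_{j=0}^{\min(m,m')}Q^j\mathcal H_{m-j,m'-j}$. A representation has highest weight $(\lambda_1,\dots,\lambda_n)$ if it is generated by a nonzero vector $v$ with $e_jv=0$ for all $j$ and $k_iv=q^{\lambda_i}v$ for all $i$. *)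

theory Defs
  imports Complex_Main "HOL-Library.Poly_Mapping"
begin

section \<open>Complex algebras given by generators and relations\<close>

text \<open>
  Words form a monoid (written additively) under concatenation, so that the convolution product
  of \<open>poly_mapping\<close> turns the finitely supported functions on words into the free
  associative unital algebra.
\<close>

datatype 'x fword = FWord (letters: "'x list")

instantiation fword :: (type) monoid_add
begin

definition zero_fword :: "'a fword" where
  "zero_fword = FWord []"

definition plus_fword :: "'a fword \<Rightarrow> 'a fword \<Rightarrow> 'a fword" where
  "plus_fword u v = FWord (letters u @ letters v)"

instance
  by standard (simp_all add: zero_fword_def plus_fword_def)

end

type_synonym 'x free_algebra = "'x fword \<Rightarrow>\<^sub>0 complex"

definition gen :: "'x \<Rightarrow> 'x free_algebra" where
  "gen x = Poly_Mapping.single (FWord [x]) 1"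

definition fscale :: "complex \<Rightarrow> 'x free_algebra \<Rightarrow> 'x free_algebra" where
  "fscale c p = Poly_Mapping.single 0 c * p"

definition free_algebra_on :: "'x set \<Rightarrow> 'x free_algebra set" where
  "free_algebra_on X = {p. \<forall>u \<in> Poly_Mapping.keys p. set (letters u) \<subseteq> X}"

text \<open>The two-sided ideal of \<open>free_algebra_on X\<close> generated by \<open>R\<close>.\<close>

inductive_set two_sided_ideal :: "'x set \<Rightarrow> 'x free_algebra set \<Rightarrow> 'x free_algebra set"
  for X :: "'x set" and R :: "'x free_algebra set"
where
  zero: "0 \<in> two_sided_ideal X R"
| incl: "r \<in> R \<Longrightarrow> r \<in> two_sided_ideal X R"
| add: "a \<in> two_sided_ideal X R \<Longrightarrow> b \<in> two_sided_ideal X R \<Longrightarrow> a + b \<in> two_sided_ideal X R"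
| left: "a \<in> two_sided_ideal X R \<Longrightarrow> p \<in> free_algebra_on X \<Longrightarrow> p * a \<in> two_sided_ideal X R"
| right: "a \<in> two_sided_ideal X R \<Longrightarrow> p \<in> free_algebra_on X \<Longrightarrow> a * p \<in> two_sided_ideal X R"

locale complex_algebra = vector_space scale
  for scale :: "complex \<Rightarrow> 'a::ring_1 \<Rightarrow> 'a" +
  assumes scale_mult_left: "scale c a * b = scale c (a * b)"
    and scale_mult_right: "a * scale c b = scale c (a * b)"

definition eval_free ::
  "(complex \<Rightarrow> 'a::ring_1 \<Rightarrow> 'a) \<Rightarrow> ('x \<Rightarrow> 'a) \<Rightarrow> 'x free_algebra \<Rightarrow> 'a" where
  "eval_free scale g p =
     (\<Sum>u \<in> Poly_Mapping.keys p. scale (Poly_Mapping.lookup p u) (prod_list (map g (letters u))))"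

text \<open>
  The algebra structure on the type \<open>'a\<close> is the quotient of the free algebra on \<open>X\<close> by the
  two-sided ideal generated by \<open>R\<close>, the generator \<open>x \<in> X\<close> being mapped to \<open>g x\<close>.
\<close>

definition presented_by ::
  "(complex \<Rightarrow> 'a::ring_1 \<Rightarrow> 'a) \<Rightarrow> ('x \<Rightarrow> 'a) \<Rightarrow> 'x set \<Rightarrow> 'x free_algebra set \<Rightarrow> bool" where
  "presented_by scale g X R \<longleftrightarrow>
     complex_algebra scale \<and>
     eval_free scale g ` free_algebra_on X = UNIV \<and>
     {p \<in> free_algebra_on X. eval_free scale g p = 0} = two_sided_ideal X R"


section \<open>Representations\<close>

definition representation ::
  "(complex \<Rightarrow> 'u::ring_1 \<Rightarrow> 'u) \<Rightarrow> (complex \<Rightarrow> 'a::ab_group_add \<Rightarrow> 'a) \<Rightarrow>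
   ('u \<Rightarrow> 'a \<Rightarrow> 'a) \<Rightarrow> bool" where
  "representation sU sA act \<longleftrightarrow>
     (\<forall>X. Vector_Spaces.linear sA sA (act X)) \<and>
     (\<forall>X Y p. act (X + Y) p = act X p + act Y p) \<and>
     (\<forall>c X p. act (sU c X) p = sA c (act X p)) \<and>
     (\<forall>X Y p. act (X * Y) p = act X (act Y p)) \<and>
     (\<forall>p. act 1 p = p)"

definition subrepresentation ::
  "(complex \<Rightarrow> 'a::ab_group_add \<Rightarrow> 'a) \<Rightarrow> ('u \<Rightarrow> 'a \<Rightarrow> 'a) \<Rightarrow> 'a set \<Rightarrow> bool" where
  "subrepresentation sA act V \<longleftrightarrow>
     module.subspace sA V \<and> (\<forall>X. \<forall>p\<in>V. act X p \<in> V)"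

definition irreducible_rep ::
  "(complex \<Rightarrow> 'a::ab_group_add \<Rightarrow> 'a) \<Rightarrow> ('u \<Rightarrow> 'a \<Rightarrow> 'a) \<Rightarrow> 'a set \<Rightarrow> bool" where
  "irreducible_rep sA act V \<longleftrightarrow>
     subrepresentation sA act V \<and> V \<noteq> {0} \<and>
     (\<forall>W. subrepresentation sA act W \<and> W \<subseteq> V \<longrightarrow> W = {0} \<or> W = V)"

definition rep_isomorphism ::
  "(complex \<Rightarrow> 'a::ab_group_add \<Rightarrow> 'a) \<Rightarrow> ('u \<Rightarrow> 'a \<Rightarrow> 'a) \<Rightarrow>
   ('a \<Rightarrow> 'a) \<Rightarrow> 'a set \<Rightarrow> 'a set \<Rightarrow> bool" where
  "rep_isomorphism sA act f V W \<longleftrightarrow>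
     subrepresentation sA act V \<and> subrepresentation sA act W \<and>
     (\<forall>p\<in>V. \<forall>p'\<in>V. f (p + p') = f p + f p') \<and>
     (\<forall>c. \<forall>p\<in>V. f (sA c p) = sA c (f p)) \<and>
     bij_betw f V W \<and>
     (\<forall>X. \<forall>p\<in>V. f (act X p) = act X (f p))"

text \<open>\<open>W\<close> is the internal direct sum of the subspaces \<open>V j\<close>, \<open>j \<in> J\<close>, for finite \<open>J\<close>.\<close>

definition internal_direct_sum ::
  "(complex \<Rightarrow> 'a::ab_group_add \<Rightarrow> 'a) \<Rightarrow> 'j set \<Rightarrow> ('j \<Rightarrow> 'a set) \<Rightarrow> 'a set \<Rightarrow> bool" where
  "internal_direct_sum sA J V W \<longleftrightarrow>
     finite J \<and> (\<forall>j\<in>J. module.subspace sA (V j)) \<and>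
     W = {\<Sum>j\<in>J. v j | v. \<forall>j\<in>J. v j \<in> V j} \<and>
     (\<forall>v. (\<forall>j\<in>J. v j \<in> V j) \<and> (\<Sum>j\<in>J. v j) = 0 \<longrightarrow> (\<forall>j\<in>J. v j = 0))"


section \<open>The algebra generated by \<open>z\<^sub>i\<close> and \<open>w\<^sub>i\<close>\<close>

datatype zw_gen = Zgen nat | Wgen nat

definition zw_gens :: "nat \<Rightarrow> zw_gen set" where
  "zw_gens n = Zgen ` {1..n} \<union> Wgen ` {1..n}"

definition zw_rels :: "complex \<Rightarrow> nat \<Rightarrow> zw_gen free_algebra set" where
  "zw_rels q n =
     {gen (Zgen i) * gen (Zgen j) - fscale q (gen (Zgen j) * gen (Zgen i)) | i j.
        1 \<le> i \<and> i < j \<and> j \<le> n} \<union>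
     {gen (Wgen i) * gen (Wgen j) - fscale (inverse q) (gen (Wgen j) * gen (Wgen i)) | i j.
        1 \<le> i \<and> i < j \<and> j \<le> n} \<union>
     {gen (Wgen j) * gen (Zgen i) - fscale q (gen (Zgen i) * gen (Wgen j)) | i j.
        i \<in> {1..n} \<and> j \<in> {1..n} \<and> i \<noteq> j} \<union>
     {gen (Wgen k) * gen (Zgen k) -
        (gen (Zgen k) * gen (Wgen k) +
         fscale (1 - q\<^sup>2) (\<Sum>s\<in>{1..<k}. gen (Zgen s) * gen (Wgen s))) | k. k \<in> {1..n}}"

definition zw_algebra ::
  "complex \<Rightarrow> nat \<Rightarrow> (complex \<Rightarrow> 'a::ring_1 \<Rightarrow> 'a) \<Rightarrow> (zw_gen \<Rightarrow> 'a) \<Rightarrow> bool" where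
  "zw_algebra q n sA gA \<longleftrightarrow> presented_by sA gA (zw_gens n) (zw_rels q n)"

definition z_monomial :: "(zw_gen \<Rightarrow> 'a::ring_1) \<Rightarrow> nat \<Rightarrow> (nat \<Rightarrow> nat) \<Rightarrow> 'a" where
  "z_monomial gA n r = prod_list (map (\<lambda>i. gA (Zgen i) ^ r i) [1..<Suc n])"

definition w_monomial :: "(zw_gen \<Rightarrow> 'a::ring_1) \<Rightarrow> nat \<Rightarrow> (nat \<Rightarrow> nat) \<Rightarrow> 'a" where
  "w_monomial gA n r = prod_list (map (\<lambda>i. gA (Wgen i) ^ r i) [1..<Suc n])"

definition bihomogeneous ::
  "nat \<Rightarrow> (complex \<Rightarrow> 'a::ring_1 \<Rightarrow> 'a) \<Rightarrow> (zw_gen \<Rightarrow> 'a) \<Rightarrow> nat \<Rightarrow> nat \<Rightarrow> 'a set" where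
  "bihomogeneous n sA gA m m' =
     module.span sA {z_monomial gA n r * w_monomial gA n s | r s.
       (\<Sum>i\<in>{1..n}. r i) = m \<and> (\<Sum>i\<in>{1..n}. s i) = m'}"

definition qint :: "complex \<Rightarrow> nat \<Rightarrow> complex" where
  "qint q a = (q ^ a - inverse q ^ a) / (q - inverse q)"

text \<open>
  The monomials \<open>z\<^sup>r w\<^sup>s\<close> form a basis of the algebra, and so do the monomials \<open>w\<^sup>r z\<^sup>s\<close>; hence
  the next two predicates determine the operators \<open>D i\<close> for \<open>1 \<le> i \<le> n\<close>.
  For \<open>r i = 0\<close> the right-hand sides vanish since \<open>qint q 0 = 0\<close>.
\<close>

definition z_derivatives ::
  "complex \<Rightarrow> nat \<Rightarrow> (complex \<Rightarrow> 'a::ring_1 \<Rightarrow> 'a) \<Rightarrow> (zw_gen \<Rightarrow> 'a) \<Rightarrow> (nat \<Rightarrow> 'a \<Rightarrow> 'a) \<Rightarrow> bool" where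
  "z_derivatives q n sA gA D \<longleftrightarrow>
     (\<forall>i\<in>{1..n}. Vector_Spaces.linear sA sA (D i) \<and>
       (\<forall>r s. D i (z_monomial gA n r * w_monomial gA n s) =
          sA (q ^ (\<Sum>k\<in>{i<..n}. r k) * qint q (r i))
            (z_monomial gA n (r(i := r i - 1)) * w_monomial gA n s)))"

definition w_derivatives ::
  "complex \<Rightarrow> nat \<Rightarrow> (complex \<Rightarrow> 'a::ring_1 \<Rightarrow> 'a) \<Rightarrow> (zw_gen \<Rightarrow> 'a) \<Rightarrow> (nat \<Rightarrow> 'a \<Rightarrow> 'a) \<Rightarrow> bool" where
  "w_derivatives q n sA gA D \<longleftrightarrow>
     (\<forall>i\<in>{1..n}. Vector_Spaces.linear sA sA (D i) \<and>
       (\<forall>r s. D i (w_monomial gA n r * z_monomial gA n s) =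
          sA (inverse q ^ (\<Sum>k\<in>{i<..n}. r k) * qint q (r i))
            (w_monomial gA n (r(i := r i - 1)) * z_monomial gA n s)))"

definition q_laplacian ::
  "nat \<Rightarrow> (nat \<Rightarrow> 'a::ring_1 \<Rightarrow> 'a) \<Rightarrow> (nat \<Rightarrow> 'a \<Rightarrow> 'a) \<Rightarrow> 'a \<Rightarrow> 'a" where
  "q_laplacian n D Dbar p = (\<Sum>i\<in>{1..n}. D i (Dbar i p))"

definition q_harmonic ::
  "nat \<Rightarrow> (complex \<Rightarrow> 'a::ring_1 \<Rightarrow> 'a) \<Rightarrow> (zw_gen \<Rightarrow> 'a) \<Rightarrow>
   (nat \<Rightarrow> 'a \<Rightarrow> 'a) \<Rightarrow> (nat \<Rightarrow> 'a \<Rightarrow> 'a) \<Rightarrow> nat \<Rightarrow> nat \<Rightarrow> 'a set" where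
  "q_harmonic n sA gA D Dbar m m' =
     {p \<in> bihomogeneous n sA gA m m'. q_laplacian n D Dbar p = 0}"

definition Q_element :: "nat \<Rightarrow> (zw_gen \<Rightarrow> 'a::ring_1) \<Rightarrow> 'a" where
  "Q_element n gA = (\<Sum>i\<in>{1..n}. gA (Zgen i) * gA (Wgen i))"


section \<open>The quantized enveloping algebra of \<open>gl\<^sub>n\<close>\<close>

text \<open>\<open>Khalf i\<close> and \<open>Khalf_inv i\<close> stand for \<open>k\<^sub>i\<close> to the powers \<open>1/2\<close> and \<open>-1/2\<close>.\<close>

datatype uq_gen = Khalf nat | Khalf_inv nat | Egen nat | Fgen nat

definition uq_gens :: "nat \<Rightarrow> uq_gen set" where
  "uq_gens n = Khalf ` {1..n} \<union> Khalf_inv ` {1..n} \<union> Egen ` {1..<n} \<union> Fgen ` {1..<n}"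

definition gl_weight :: "nat \<Rightarrow> nat \<Rightarrow> int" where
  "gl_weight i j = (if i = j then 1 else if i = j + 1 then -1 else 0)"

definition serre :: "complex \<Rightarrow> 'x free_algebra \<Rightarrow> 'x free_algebra \<Rightarrow> 'x free_algebra" where
  "serre q a b = a\<^sup>2 * b - fscale (q + inverse q) (a * b * a) + b * a\<^sup>2"

text \<open>Here \<open>qh\<close> is the chosen square root of \<open>q\<close>.\<close>

definition uq_rels :: "complex \<Rightarrow> complex \<Rightarrow> nat \<Rightarrow> uq_gen free_algebra set" where
  "uq_rels q qh n =
     {gen (Khalf i) * gen (Khalf_inv i) - 1 | i. i \<in> {1..n}} \<union>
     {gen (Khalf_inv i) * gen (Khalf i) - 1 | i. i \<in> {1..n}} \<union>
     {gen (Khalf i) * gen (Khalf j) - gen (Khalf j) * gen (Khalf i) | i j.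
        i \<in> {1..n} \<and> j \<in> {1..n}} \<union>
     {gen (Khalf i) * gen (Egen j) * gen (Khalf_inv i)
        - fscale (qh powi gl_weight i j) (gen (Egen j)) | i j. i \<in> {1..n} \<and> j \<in> {1..<n}} \<union>
     {gen (Khalf i) * gen (Fgen j) * gen (Khalf_inv i)
        - fscale (qh powi (- gl_weight i j)) (gen (Fgen j)) | i j. i \<in> {1..n} \<and> j \<in> {1..<n}} \<union>
     {gen (Egen i) * gen (Fgen j) - gen (Fgen j) * gen (Egen i)
        - (if i = j then fscale (1 / (q - inverse q))
             ((gen (Khalf i))\<^sup>2 * (gen (Khalf_inv (i + 1)))\<^sup>2
              - (gen (Khalf_inv i))\<^sup>2 * (gen (Khalf (i + 1)))\<^sup>2)
           else 0) | i j. i \<in> {1..<n} \<and> j \<in> {1..<n}} \<union>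
     {serre q (gen (Egen i)) (gen (Egen j)) | i j.
        i \<in> {1..<n} \<and> j \<in> {1..<n} \<and> (j = i + 1 \<or> i = j + 1)} \<union>
     {serre q (gen (Fgen i)) (gen (Fgen j)) | i j.
        i \<in> {1..<n} \<and> j \<in> {1..<n} \<and> (j = i + 1 \<or> i = j + 1)} \<union>
     {gen (Egen i) * gen (Egen j) - gen (Egen j) * gen (Egen i) | i j.
        i \<in> {1..<n} \<and> j \<in> {1..<n} \<and> (i + 1 < j \<or> j + 1 < i)} \<union>
     {gen (Fgen i) * gen (Fgen j) - gen (Fgen j) * gen (Fgen i) | i j.
        i \<in> {1..<n} \<and> j \<in> {1..<n} \<and> (i + 1 < j \<or> j + 1 < i)}"

definition uq_gl ::
  "complex \<Rightarrow> complex \<Rightarrow> nat \<Rightarrow> (complex \<Rightarrow> 'u::ring_1 \<Rightarrow> 'u) \<Rightarrow> (uq_gen \<Rightarrow> 'u) \<Rightarrow> bool" where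
  "uq_gl q qh n sU gU \<longleftrightarrow> presented_by sU gU (uq_gens n) (uq_rels q qh n)"

text \<open>
  The action of the quantized enveloping algebra on the algebra generated by the \<open>z\<^sub>i\<close> and \<open>w\<^sub>i\<close>.
  Counit and comultiplication are algebra homomorphisms, and \<open>act\<close> is multiplicative in its first
  argument; so \<open>X \<triangleright> 1 = \<epsilon>(X) 1\<close> and \<open>X \<triangleright> (p\<^sub>1 p\<^sub>2) = \<Sum> (X\<^sub>(\<^sub>1\<^sub>) \<triangleright> p\<^sub>1) (X\<^sub>(\<^sub>2\<^sub>) \<triangleright> p\<^sub>2)\<close> hold for all \<open>X\<close>
  as soon as they hold for the generators, where they are spelled out.
\<close>

definition uq_action ::
  "complex \<Rightarrow> complex \<Rightarrow> nat \<Rightarrow> (complex \<Rightarrow> 'u::ring_1 \<Rightarrow> 'u) \<Rightarrow> (uq_gen \<Rightarrow> 'u) \<Rightarrow>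
   (complex \<Rightarrow> 'a::ring_1 \<Rightarrow> 'a) \<Rightarrow> (zw_gen \<Rightarrow> 'a) \<Rightarrow> ('u \<Rightarrow> 'a \<Rightarrow> 'a) \<Rightarrow> bool" where
  "uq_action q qh n sU gU sA gA act \<longleftrightarrow>
     representation sU sA act \<and>
     (\<forall>i\<in>{1..n}.
        act (gU (Khalf i)) 1 = 1 \<and>
        act (gU (Khalf_inv i)) 1 = 1 \<and>
        (\<forall>p1 p2. act (gU (Khalf i)) (p1 * p2) =
           act (gU (Khalf i)) p1 * act (gU (Khalf i)) p2) \<and>
        (\<forall>p1 p2. act (gU (Khalf_inv i)) (p1 * p2) =
           act (gU (Khalf_inv i)) p1 * act (gU (Khalf_inv i)) p2) \<and>
        (\<forall>j\<in>{1..n}.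
           act (gU (Khalf i)) (gA (Zgen j)) = sA (if i = j then qh else 1) (gA (Zgen j)) \<and>
           act (gU (Khalf i)) (gA (Wgen j)) = sA (if i = j then inverse qh else 1) (gA (Wgen j)))) \<and>
     (\<forall>i\<in>{1..<n}.
        act (gU (Egen i)) 1 = 0 \<and>
        act (gU (Fgen i)) 1 = 0 \<and>
        (\<forall>p1 p2. act (gU (Egen i)) (p1 * p2) =
           act (gU (Egen i)) p1 * act (gU (Khalf_inv i) * gU (Khalf (i + 1))) p2 +
           act (gU (Khalf i) * gU (Khalf_inv (i + 1))) p1 * act (gU (Egen i)) p2) \<and>
        (\<forall>p1 p2. act (gU (Fgen i)) (p1 * p2) =
           act (gU (Fgen i)) p1 * act (gU (Khalf_inv i) * gU (Khalf (i + 1))) p2 +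
           act (gU (Khalf i) * gU (Khalf_inv (i + 1))) p1 * act (gU (Fgen i)) p2) \<and>
        (\<forall>j\<in>{1..n}.
           act (gU (Egen i)) (gA (Zgen j)) = (if j = i + 1 then gA (Zgen (j - 1)) else 0) \<and>
           act (gU (Fgen i)) (gA (Zgen j)) = (if j = i then gA (Zgen (j + 1)) else 0) \<and>
           act (gU (Egen i)) (gA (Wgen j)) =
             (if j = i then sA (- inverse q) (gA (Wgen (j + 1))) else 0) \<and>
           act (gU (Fgen i)) (gA (Wgen j)) =
             (if j = i + 1 then sA (- q) (gA (Wgen (j - 1))) else 0)))"

definition has_highest_weight ::
  "complex \<Rightarrow> nat \<Rightarrow> (complex \<Rightarrow> 'a::ring_1 \<Rightarrow> 'a) \<Rightarrow> (uq_gen \<Rightarrow> 'u::ring_1) \<Rightarrow>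
   ('u \<Rightarrow> 'a \<Rightarrow> 'a) \<Rightarrow> 'a set \<Rightarrow> (nat \<Rightarrow> int) \<Rightarrow> bool" where
  "has_highest_weight q n sA gU act V lam \<longleftrightarrow>
     (\<exists>v\<in>V. v \<noteq> 0 \<and>
        (\<forall>j\<in>{1..<n}. act (gU (Egen j)) v = 0) \<and>
        (\<forall>i\<in>{1..n}. act ((gU (Khalf i))\<^sup>2) v = sA (q powi lam i) v) \<and>
        V = range (\<lambda>X. act X v))"

end

theory Submission
  imports Defs
begin

text \<open>The single non-isotropic vector v replaces positivity: a submodule that contains v and
  is orthogonal to a submodule containing v is impossible.

  That \<open>q\<close> is not a root of unity enters through nonzero q-integers, which make the
  norms nonzero and the moves between neighbouring monomials invertible, and through one final
  scalar. The codimension-one claim reduces to the chain of monomials z_i w_i times a fixed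
  remainder: the \<open>F i\<close> give a two-term recurrence along the chain and \<open>Q\<close>
  closes it. The resulting scalar is, up to nonzero factors, q^(2(m+n-1+b)) - 1, where b is the
  exponent of w_n.

  The norms solve the recurrences that adjointness of \<open>E i\<close> and \<open>F i\<close>
  imposes on neighbouring monomials, and the scalar between the Laplacian and the adjoint of
  \<open>Q\<close>, which is q^(m'-m+2) on source bidegree (m,m'), is read off from a quotient of
  two such norms.\<close>

text \<open>
  Suitable multiples \<open>E\<^sub>i\<close> and \<open>F\<^sub>i\<close> of the generators \<open>e\<^sub>i\<close> and \<open>f\<^sub>i\<close> act by skew derivations.
  On \<open>\<A>\<^sub>m\<^sub>,\<^sub>m\<^sub>'\<close> there is a nondegenerate symmetric
  bilinear form with orthogonal basis \<open>z\<^sup>r w\<^sup>s\<close> for which \<open>E\<^sub>i\<close> and \<open>F\<^sub>i\<close> are mutually adjoint. Since the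
  \<open>q\<close>-Laplacian commutes with \<open>E\<^sub>i\<close> and \<open>F\<^sub>i\<close>, comparing values on the cyclic vector
  \<open>z\<^sub>1\<^sup>m w\<^sub>1\<^sup>m\<^sup>'\<close> shows that it is, up to a scalar, the adjoint of multiplication by \<open>Q\<close>. So the harmonic
  elements are the orthogonal complement of \<open>Q \<A>\<^sub>m\<^sub>-\<^sub>1\<^sub>,\<^sub>m\<^sub>'\<^sub>-\<^sub>1\<close>. A harmonic vector killed by all \<open>E\<^sub>i\<close> is
  orthogonal to the images of all \<open>F\<^sub>i\<close> and of \<open>Q\<close>, whose sum has codimension one; hence it is a
  multiple of \<open>v = z\<^sub>1\<^sup>m w\<^sub>n\<^sup>m\<^sup>'\<close>. So every nonzero submodule of the harmonic elements contains \<open>v\<close>, which is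
  not isotropic. Therefore no nonzero submodule meets its orthogonal complement, and orthogonal
  projection gives both irreducibility and the decomposition.
\<close>

section \<open>Symmetric forms with an orthogonal basis\<close>

text \<open>Linearity is asked for on \<open>W\<close> only: the coordinates below are picked by
  \<open>SOME\<close>, so the form is known to be linear only on the span of the family.\<close>

definition linear_functional_on ::
  "('k::field \<Rightarrow> 'v::ab_group_add \<Rightarrow> 'v) \<Rightarrow> 'v set \<Rightarrow> ('v \<Rightarrow> 'k) \<Rightarrow> bool" where
  "linear_functional_on sc W f \<longleftrightarrow>
     (\<forall>x\<in>W. \<forall>y\<in>W. f (x + y) = f x + f y) \<and> (\<forall>c. \<forall>x\<in>W. f (sc c x) = c * f x)"

text \<open>Induction on the number of functionals. On the kernel of \<open>\<phi> k\<close> the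
  others suffice; the defect of their combination vanishes on that kernel and is therefore a
  multiple of \<open>\<phi> k\<close>.\<close>

lemma (in vector_space) functional_combination:
  assumes "finite J" and "subspace W"
    and "linear_functional_on scale W \<psi>" and "\<And>j. j \<in> J \<Longrightarrow> linear_functional_on scale W (\<phi> j)"
    and "\<And>y. y \<in> W \<Longrightarrow> (\<And>j. j \<in> J \<Longrightarrow> \<phi> j y = 0) \<Longrightarrow> \<psi> y = 0"
  shows "\<exists>c. \<forall>y\<in>W. \<psi> y = (\<Sum>j\<in>J. c j * \<phi> j y)"
  using assms
proof (induction J arbitrary: W rule: finite_induct)
  case empty
  then show ?case by simp
next
  case (insert k J)
  define W' where "W' = {y\<in>W. \<phi> k y = 0}"
  have lk: "linear_functional_on scale W (\<phi> k)" using insert.prems by simp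
  have z: "\<phi> k 0 = 0"
    using lk insert.prems(1) subspace_0[of W] unfolding linear_functional_on_def
    by (metis mult_zero_left scale_zero_left)
  have sub: "subspace W'"
    using insert.prems(1) lk z unfolding W'_def subspace_def linear_functional_on_def by auto
  have res: "linear_functional_on scale W' f" if "linear_functional_on scale W f" for f
    using that unfolding W'_def linear_functional_on_def by auto
  have "\<exists>c. \<forall>y\<in>W'. \<psi> y = (\<Sum>j\<in>J. c j * \<phi> j y)"
  proof (rule insert.IH[OF sub])
    show "linear_functional_on scale W' \<psi>" by (rule res[OF insert.prems(2)])
    show "linear_functional_on scale W' (\<phi> j)" if "j \<in> J" for j
      using that by (intro res insert.prems(3)) simp
    show "\<psi> y = 0" if "y \<in> W'" "\<And>j. j \<in> J \<Longrightarrow> \<phi> j y = 0" for y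
      using that by (intro insert.prems(4)) (auto simp: W'_def)
  qed
  then obtain c where c: "\<And>y. y \<in> W' \<Longrightarrow> \<psi> y = (\<Sum>j\<in>J. c j * \<phi> j y)" by blast
  show ?case
  proof (cases "\<forall>y\<in>W. \<phi> k y = 0")
    case True
    then have "W' = W" by (auto simp: W'_def)
    with c insert.hyps True show ?thesis
      by (intro exI[of _ c]) (simp add: sum.insert)
  next
    case False
    then obtain y1 where y1: "y1 \<in> W" "\<phi> k y1 \<noteq> 0" by blast
    \<comment> \<open>The value at \<open>y1\<close> dictates \<open>d\<close>; adding a multiple of
      \<open>y1\<close> brings an arbitrary \<open>y\<close> into the kernel of
      \<open>\<phi> k\<close>.\<close>
    define d where "d = (\<psi> y1 - (\<Sum>j\<in>J. c j * \<phi> j y1)) / \<phi> k y1"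
    have "\<psi> y = d * \<phi> k y + (\<Sum>j\<in>J. c j * \<phi> j y)" if y: "y \<in> W" for y
    proof -
      define u where "u = - (\<phi> k y / \<phi> k y1)"
      have uy: "scale u y1 \<in> W" using insert.prems(1) y1 by (simp add: subspace_scale)
      have lin: "f (y + scale u y1) = f y + u * f y1" if "linear_functional_on scale W f" for f
        using that y y1 uy unfolding linear_functional_on_def by metis
      have "\<phi> k (y + scale u y1) = 0"
        using lin[OF lk] y1 by (simp add: u_def)
      then have "y + scale u y1 \<in> W'"
        using y uy insert.prems(1) by (simp add: W'_def subspace_add)
      then have "\<psi> y + u * \<psi> y1 = (\<Sum>j\<in>J. c j * (\<phi> j y + u * \<phi> j y1))"
        using c[of "y + scale u y1"] lin insert.prems by simp
      also have "\<dots> = (\<Sum>j\<in>J. c j * \<phi> j y) + u * (\<Sum>j\<in>J. c j * \<phi> j y1)"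
        by (simp add: algebra_simps sum.distrib sum_distrib_left)
      finally show ?thesis using y1(2) by (simp add: d_def u_def field_simps)
    qed
    then show ?thesis using insert.hyps
      by (intro exI[of _ "c(k := d)"]) (auto simp: sum.insert intro!: sum.cong)
  qed
qed

locale orthogonal_family = vector_space scale
  for scale :: "complex \<Rightarrow> 'a::ab_group_add \<Rightarrow> 'a" +
  fixes I :: "'i set" and b :: "'i \<Rightarrow> 'a" and N :: "'i \<Rightarrow> complex"
  assumes finite_I: "finite I"
    and indep: "\<And>c x. (\<Sum>x\<in>I. scale (c x) (b x)) = 0 \<Longrightarrow> x \<in> I \<Longrightarrow> c x = 0"
    and N_nonzero: "\<And>x. x \<in> I \<Longrightarrow> N x \<noteq> 0"
begin

definition coord :: "'a \<Rightarrow> 'i \<Rightarrow> complex" where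
  "coord p = (SOME c. p = (\<Sum>x\<in>I. scale (c x) (b x)))"

definition form :: "'a \<Rightarrow> 'a \<Rightarrow> complex" where
  "form p t = (\<Sum>x\<in>I. N x * coord p x * coord t x)"

lemma coord_unique:
  assumes "p = (\<Sum>x\<in>I. scale (c x) (b x))" and "x \<in> I"
  shows "coord p x = c x"
proof -
  have "p = (\<Sum>x\<in>I. scale (coord p x) (b x))"
    unfolding coord_def by (rule someI[where x = c]) (fact assms(1))
  then have "(\<Sum>x\<in>I. scale (coord p x - c x) (b x)) = 0"
    using assms(1) by (simp add: scale_left_diff_distrib sum_subtractf)
  from indep[OF this assms(2)] show ?thesis by simp
qed

lemma span_coord:
  assumes "p \<in> span (b ` I)"
  shows "p = (\<Sum>x\<in>I. scale (coord p x) (b x))"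
proof -
  have "\<exists>c. p = (\<Sum>x\<in>I. scale (c x) (b x))"
    using assms
  proof (induction rule: span_induct_alt)
    case base
    show ?case by (intro exI[of _ "\<lambda>_. 0"]) simp
  next
    case (step d v p)
    then obtain y c where "y \<in> I" "v = b y" "p = (\<Sum>x\<in>I. scale (c x) (b x))" by blast
    moreover have "scale d (b y) = (\<Sum>x\<in>I. scale (if x = y then d else 0) (b x))"
      using finite_I \<open>y \<in> I\<close> by (simp add: if_distrib[where f = "\<lambda>t. scale t _"] cong: if_cong)
    ultimately show ?case
      by (intro exI[of _ "\<lambda>x. (if x = y then d else 0) + c x"])
         (simp add: scale_left_distrib sum.distrib)
  qed
  then show ?thesis unfolding coord_def by (rule someI_ex)
qed

lemma coord_add:
  assumes "p \<in> span (b ` I)" "t \<in> span (b ` I)" "x \<in> I"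
  shows "coord (p + t) x = coord p x + coord t x"
  by (rule coord_unique)
     (use span_coord[OF assms(1)] span_coord[OF assms(2)] assms(3) in
       \<open>simp_all add: scale_left_distrib sum.distrib\<close>)

lemma coord_scale:
  assumes "p \<in> span (b ` I)" "x \<in> I"
  shows "coord (scale d p) x = d * coord p x"
proof (rule coord_unique[OF _ assms(2)])
  have "scale d p = scale d (\<Sum>x\<in>I. scale (coord p x) (b x))"
    using span_coord[OF assms(1)] by simp
  then show "scale d p = (\<Sum>x\<in>I. scale (d * coord p x) (b x))"
    by (simp add: scale_sum_right)
qed

lemma coord_basis:
  assumes "y \<in> I" "x \<in> I"
  shows "coord (b y) x = (if x = y then 1 else 0)"
  by (rule coord_unique)
     (use assms finite_I in \<open>simp_all add: if_distrib[where f = "\<lambda>t. scale t _"] cong: if_cong\<close>)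

lemma form_commute: "form p t = form t p"
  by (simp add: form_def mult_ac)

lemma form_linear_right: "linear_functional_on scale (span (b ` I)) (form p)"
  by (auto simp: linear_functional_on_def form_def coord_add coord_scale algebra_simps
      sum.distrib sum_distrib_left intro!: sum.cong)

lemma form_add_right:
  "t \<in> span (b ` I) \<Longrightarrow> t' \<in> span (b ` I) \<Longrightarrow> form p (t + t') = form p t + form p t'"
  using form_linear_right unfolding linear_functional_on_def by blast

lemma form_scale_right: "t \<in> span (b ` I) \<Longrightarrow> form p (scale c t) = c * form p t"
  using form_linear_right unfolding linear_functional_on_def by blast

lemma form_zero_right: "form p 0 = 0"
  using form_scale_right[of 0 p 0] by (simp add: span_zero)

lemma form_sum_right:
  assumes "\<And>k. k \<in> K \<Longrightarrow> t k \<in> span (b ` I)"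
  shows "form p (\<Sum>k\<in>K. t k) = (\<Sum>k\<in>K. form p (t k))"
proof (cases "finite K")
  case True
  then show ?thesis using assms
    by (induction rule: finite_induct) (simp_all add: form_zero_right form_add_right span_sum)
next
  case False
  then show ?thesis by (simp add: form_zero_right)
qed

lemma form_diff_right:
  "t \<in> span (b ` I) \<Longrightarrow> t' \<in> span (b ` I) \<Longrightarrow> form p (t - t') = form p t - form p t'"
  using form_add_right[of "t - t'" t' p] by (simp add: span_diff)

lemma form_basis_right: "x \<in> I \<Longrightarrow> form p (b x) = N x * coord p x"
  using finite_I by (simp add: form_def coord_basis if_distrib cong: if_cong sum.cong)

lemma form_basis:
  "x \<in> I \<Longrightarrow> y \<in> I \<Longrightarrow> form (b x) (b y) = (if x = y then N x else 0)"
  by (simp add: form_basis_right coord_basis)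

lemma form_nondegenerate:
  assumes "p \<in> span (b ` I)" "\<And>x. x \<in> I \<Longrightarrow> form p (b x) = 0"
  shows "p = 0"
proof -
  have "coord p x = 0" if "x \<in> I" for x
    using assms(2)[OF that] N_nonzero[OF that] that by (simp add: form_basis_right)
  then show ?thesis by (subst span_coord[OF assms(1)]) simp
qed

text \<open>The vector sought represents the functional \<open>form p\<close> on \<open>W\<close>.
  By nondegeneracy, the functionals \<open>form w\<close> for \<open>w\<close> in a finite basis of
  \<open>W\<close> have only 0 as a common zero in \<open>W\<close>, so \<open>form p\<close> is a
  combination of them, and the same combination of basis vectors is the projection.\<close>

lemma orthogonal_projection:
  assumes W: "subspace W" "W \<subseteq> span (b ` I)"
    and nondeg: "\<And>w. w \<in> W \<Longrightarrow> (\<And>t. t \<in> W \<Longrightarrow> form w t = 0) \<Longrightarrow> w = 0"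
  shows "\<exists>w\<in>W. \<forall>t\<in>W. form p t = form w t"
proof -
  obtain C where C: "C \<subseteq> W" "independent C" "W \<subseteq> span C"
    by (rule basis_exists[of W])
  have finC: "finite C"
    using independent_span_bound[OF _ C(2), of "b ` I"] finite_I C(1) W(2) by auto
  have lin: "linear_functional_on scale W (form w)" for w
    using form_linear_right[of w] W(2) by (auto simp: linear_functional_on_def subset_iff)
  have "\<exists>c. \<forall>t\<in>W. form p t = (\<Sum>w\<in>C. c w * form w t)"
  proof (rule functional_combination[OF finC W(1) lin lin])
    fix y assume y: "y \<in> W" "\<And>w. w \<in> C \<Longrightarrow> form w y = 0"
    have "subspace {t \<in> span (b ` I). form y t = 0}"
      by (auto simp: subspace_def span_zero span_add span_scale form_zero_right
          form_add_right form_scale_right)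
    moreover have "C \<subseteq> {t \<in> span (b ` I). form y t = 0}"
      using y(2) C(1) W(2) form_commute by auto
    ultimately have "form y t = 0" if "t \<in> span C" for t
      using that span_minimal by blast
    with nondeg[OF y(1)] C(3) have "y = 0" by blast
    then show "form p y = 0" by (simp add: form_zero_right)
  qed
  then obtain c where c: "\<And>t. t \<in> W \<Longrightarrow> form p t = (\<Sum>w\<in>C. c w * form w t)" by blast
  let ?w = "\<Sum>w\<in>C. scale (c w) w"
  have "?w \<in> W" using C(1) W(1) by (meson subspace_scale subspace_sum subsetD)
  moreover have "form p t = form ?w t" if "t \<in> W" for t
  proof -
    have C': "w \<in> span (b ` I)" if "w \<in> C" for w using that C(1) W(2) by blast
    have "form ?w t = (\<Sum>w\<in>C. c w * form t w)"
      by (subst form_commute) (simp add: form_sum_right form_scale_right span_scale C')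
    then show ?thesis using c[OF that] by (simp add: form_commute)
  qed
  ultimately show ?thesis by blast
qed

end

section \<open>Evaluation of relations\<close>

lemma eval_free_superset:
  assumes "complex_algebra scale" "finite S" "Poly_Mapping.keys p \<subseteq> S"
  shows "eval_free scale g p =
    (\<Sum>u\<in>S. scale (Poly_Mapping.lookup p u) (prod_list (map g (letters u))))"
proof -
  interpret complex_algebra scale by fact
  show ?thesis unfolding eval_free_def
    by (rule sum.mono_neutral_left) (use assms in_keys_iff in \<open>auto simp: in_keys_iff\<close>)
qed

lemma eval_free_add:
  assumes "complex_algebra scale"
  shows "eval_free scale g (p + p') = eval_free scale g p + eval_free scale g p'"
proof -
  interpret complex_algebra scale by fact
  let ?S = "Poly_Mapping.keys p \<union> Poly_Mapping.keys p'"
  show ?thesis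
    using eval_free_superset[OF assms, of ?S p g] eval_free_superset[OF assms, of ?S p' g]
      eval_free_superset[OF assms, of ?S "p + p'" g] Poly_Mapping.keys_add[of p p']
    by (simp add: lookup_add scale_left_distrib sum.distrib)
qed

lemma eval_free_zero: "eval_free scale g 0 = 0"
  by (simp add: eval_free_def)

lemma eval_free_diff:
  assumes "complex_algebra scale"
  shows "eval_free scale g (p - p') = eval_free scale g p - eval_free scale g p'"
  using eval_free_add[OF assms, of g "p - p'" p'] by simp

lemma eval_free_sum:
  assumes "complex_algebra scale"
  shows "eval_free scale g (\<Sum>k\<in>K. p k) = (\<Sum>k\<in>K. eval_free scale g (p k))"
  by (induction K rule: infinite_finite_induct)
     (simp_all add: eval_free_zero eval_free_add[OF assms])

lemma eval_free_single:
  assumes "complex_algebra scale"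
  shows "eval_free scale g (Poly_Mapping.single u c) = scale c (prod_list (map g (letters u)))"
proof -
  interpret complex_algebra scale by fact
  show ?thesis
    using eval_free_superset[OF assms, of "{u}" "Poly_Mapping.single u c" g] by simp
qed

lemma gen_mult_gen: "gen x * gen y = Poly_Mapping.single (FWord [x, y]) 1"
  by (simp add: gen_def mult_single plus_fword_def)

lemma fscale_single: "fscale c (Poly_Mapping.single u d) = Poly_Mapping.single u (c * d)"
  by (simp add: fscale_def mult_single)

lemma presented_by_relation:
  assumes "presented_by scale g X R" "r \<in> R"
  shows "eval_free scale g r = 0"
  using assms two_sided_ideal.incl[of r R X] unfolding presented_by_def by blast

section \<open>Quantum symmetric algebras\<close>

lemma qint_0 [simp]: "qint c 0 = 0"
  by (simp add: qint_def)

text \<open>This symmetry lets one development serve both families of variables: the z_i with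
  commutation constant \<open>inverse q\<close> and the w_i with constant \<open>q\<close>.\<close>

lemma qint_inverse: "qint (inverse c) a = qint c a"
proof -
  have "(inverse c ^ a - c ^ a) / (inverse c - c) = (- (c ^ a - inverse c ^ a)) / (- (c - inverse c))"
    by simp
  then show ?thesis unfolding qint_def by (metis inverse_inverse_eq minus_divide_divide)
qed

lemma qint_Suc:
  assumes "c \<noteq> 0" "c\<^sup>2 \<noteq> 1"
  shows "qint c (Suc a) = c ^ a + inverse c * qint c a"
    and "qint c (Suc a) = inverse c ^ a + c * qint c a"
proof -
  have "c - inverse c \<noteq> 0" using assms by (simp add: field_simps power2_eq_square)
  then show "qint c (Suc a) = c ^ a + inverse c * qint c a"
    and "qint c (Suc a) = inverse c ^ a + c * qint c a"
    unfolding qint_def using assms by (simp_all add: field_simps power2_eq_square)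
qed

lemma qint_nonzero:
  assumes "c \<noteq> 0" "\<And>k::nat. k > 0 \<Longrightarrow> c ^ k \<noteq> 1" "a > 0"
  shows "qint c a \<noteq> 0"
proof -
  have "c ^ a * (c ^ a - inverse c ^ a) = c ^ (2 * a) - 1"
    using assms(1) by (simp add: right_diff_distrib mult_2 power_add power_inverse)
  moreover have "c ^ (2 * a) \<noteq> 1" using assms(2)[of "2 * a"] assms(3) by simp
  moreover have "c - inverse c \<noteq> 0"
    using assms(1) assms(2)[of 2] by (simp add: field_simps power2_eq_square)
  ultimately show ?thesis unfolding qint_def by (metis diff_0 divide_eq_0_iff eq_iff_diff_eq_0 mult_zero_right)
qed

text \<open>For \<open>r i = 0\<close> truncated subtraction makes the result meaningless; in the
  formulas for the operators the coefficient then contains \<open>qint c 0 = 0\<close>.\<close>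

definition move :: "nat \<Rightarrow> nat \<Rightarrow> (nat \<Rightarrow> nat) \<Rightarrow> nat \<Rightarrow> nat" where
  "move i j r = r(i := r i - 1, j := Suc (r j))"

lemma sum_upd:
  fixes r :: "nat \<Rightarrow> nat"
  assumes "finite A"
  shows "sum (r(i := v)) A = (if i \<in> A then sum r (A - {i}) + v else sum r A)"
proof (cases "i \<in> A")
  case True
  then have "sum (r(i := v)) A = v + sum (r(i := v)) (A - {i})"
    using assms by (simp add: sum.remove)
  also have "sum (r(i := v)) (A - {i}) = sum r (A - {i})"
    by (rule sum.cong) auto
  finally show ?thesis using True by simp
next
  case False
  then show ?thesis by (auto intro!: sum.cong)
qed

lemma sum_Suc_upd:
  fixes r :: "nat \<Rightarrow> nat"
  assumes "finite A"
  shows "sum (r(i := Suc (r i))) A = (if i \<in> A then Suc (sum r A) else sum r A)"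
  by (subst sum_upd[OF assms]) (simp add: sum.remove[OF assms])

lemma sum_pred_upd:
  fixes r :: "nat \<Rightarrow> nat"
  assumes "finite A" "r i > 0"
  shows "sum (r(i := r i - 1)) A = (if i \<in> A then sum r A - 1 else sum r A)"
  by (subst sum_upd[OF assms(1)]) (use assms(2) in \<open>auto simp: sum.remove[OF assms(1), of i]\<close>)

lemma sum_move:
  fixes r :: "nat \<Rightarrow> nat"
  assumes "finite A" "r i > 0" "i \<noteq> j"
  shows "sum (move i j r) A =
    sum r A + (if j \<in> A then 1 else 0) - (if i \<in> A then 1 else 0)"
proof -
  have "sum (move i j r) A = sum ((r(i := r i - 1))(j := Suc ((r(i := r i - 1)) j))) A"
    using assms(3) by (simp add: move_def)
  also have "\<dots> = sum (r(i := r i - 1)) A + (if j \<in> A then 1 else 0)"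
    by (subst sum_Suc_upd[OF assms(1)]) simp
  also have "\<dots> = sum r A + (if j \<in> A then 1 else 0) - (if i \<in> A then 1 else 0)"
    using assms(2) by (subst sum_pred_upd[of A r i, OF assms(1,2)]) (auto simp: sum.remove[OF assms(1), of i])
  finally show ?thesis .
qed

text \<open>The base case knows \<open>r\<close> only on \<open>{1..n}\<close>, because a
  multi-index is a function on all naturals whose other values are irrelevant to the
  monomial.\<close>

lemma multi_index_induct [case_names zero Suc]:
  fixes r :: "nat \<Rightarrow> nat"
  assumes "\<And>r. (\<And>k. k \<in> {1..n} \<Longrightarrow> r k = 0) \<Longrightarrow> P r"
    and "\<And>r j. j \<in> {1..n} \<Longrightarrow> P r \<Longrightarrow> P (r(j := Suc (r j)))"
  shows "P r"
proof (induction "sum r {1..n}" arbitrary: r)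
  case 0
  then show ?case by (intro assms(1)) simp
next
  case (Suc d)
  then obtain j where j: "j \<in> {1..n}" "r j > 0"
    by (metis Suc_neq_Zero bot_nat_0.not_eq_extremum sum.neutral)
  let ?r = "r(j := r j - 1)"
  have "P ?r" using Suc.hyps(2) j by (intro Suc.hyps(1)) (subst sum_pred_upd; simp)
  from assms(2)[OF j(1) this] show ?case using j(2) by simp
qed

section \<open>Ordered monomials in q-commuting variables\<close>

locale q_symmetric = complex_algebra scale
  for scale :: "complex \<Rightarrow> 'a::ring_1 \<Rightarrow> 'a" +
  fixes c :: complex and n :: nat and x :: "nat \<Rightarrow> 'a"
  assumes c_nonzero: "c \<noteq> 0" and c_square: "c\<^sup>2 \<noteq> 1"
    and x_commute: "\<And>i j. 1 \<le> i \<Longrightarrow> i < j \<Longrightarrow> j \<le> n \<Longrightarrow> x j * x i = scale c (x i * x j)"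
begin

definition mon :: "(nat \<Rightarrow> nat) \<Rightarrow> 'a" where
  "mon r = prod_list (map (\<lambda>i. x i ^ r i) [1..<Suc n])"

lemma x_power_commute:
  assumes "1 \<le> i" "i < j" "j \<le> n"
  shows "x j * x i ^ a = scale (c ^ a) (x i ^ a * x j)"
    and "x j ^ a * x i = scale (c ^ a) (x i * x j ^ a)"
proof -
  show "x j * x i ^ a = scale (c ^ a) (x i ^ a * x j)"
  proof (induction a)
    case (Suc a)
    have "x j * x i ^ Suc a = scale c (x i * (x j * x i ^ a))"
      by (simp add: x_commute[OF assms] scale_mult_left mult.assoc flip: mult.assoc[of "x j"])
    then show ?case by (simp add: Suc scale_mult_right mult.assoc)
  qed simp
  show "x j ^ a * x i = scale (c ^ a) (x i * x j ^ a)"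
  proof (induction a)
    case (Suc a)
    have "x j ^ Suc a * x i = x j * (x j ^ a * x i)" by (simp add: mult.assoc)
    also have "\<dots> = scale (c ^ a) (x j * x i * x j ^ a)"
      by (simp add: Suc scale_mult_right mult.assoc)
    also have "\<dots> = scale (c ^ Suc a) (x i * x j ^ Suc a)"
      by (simp add: x_commute[OF assms] scale_mult_left mult.assoc mult.commute)
    finally show ?case .
  qed simp
qed

text \<open>Truncation to the first \<open>k\<close> variables makes the reordering rules accessible
  to induction on \<open>k\<close>; \<open>mon\<close> is the case \<open>k = n\<close>.\<close>

definition partial_mon :: "nat \<Rightarrow> (nat \<Rightarrow> nat) \<Rightarrow> 'a" where
  "partial_mon k r = prod_list (map (\<lambda>i. x i ^ r i) [1..<Suc k])"

lemma partial_mon_0 [simp]: "partial_mon 0 r = 1"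
  and partial_mon_Suc [simp]: "partial_mon (Suc k) r = partial_mon k r * x (Suc k) ^ r (Suc k)"
  by (simp_all add: partial_mon_def)

lemma partial_mon_cong: "(\<And>i. i \<in> {1..k} \<Longrightarrow> r i = r' i) \<Longrightarrow> partial_mon k r = partial_mon k r'"
  by (induction k) auto

lemma x_mult_smaller_mon:
  "k < j \<Longrightarrow> j \<le> n \<Longrightarrow> x j * partial_mon k r = scale (c ^ sum r {1..k}) (partial_mon k r * x j)"
proof (induction k)
  case (Suc k)
  have "x j * partial_mon (Suc k) r = x j * partial_mon k r * x (Suc k) ^ r (Suc k)"
    by (simp add: mult.assoc)
  also have "\<dots> = scale (c ^ sum r {1..Suc k})
      (partial_mon k r * x (Suc k) ^ r (Suc k) * x j)"
    using Suc by (simp add: scale_mult_left scale_mult_right x_power_commute mult.assoc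
        power_add mult.commute)
  finally show ?case by simp
qed simp

lemma x_mult_partial_mon:
  "j \<in> {1..k} \<Longrightarrow> k \<le> n \<Longrightarrow>
    x j * partial_mon k r = scale (c ^ sum r {1..<j}) (partial_mon k (r(j := Suc (r j))))"
proof (induction k)
  case (Suc k)
  have split: "x j * partial_mon (Suc k) r = x j * partial_mon k r * x (Suc k) ^ r (Suc k)"
    by (simp add: mult.assoc)
  show ?case
  proof (cases "j = Suc k")
    case True
    have "partial_mon k (r(j := Suc (r j))) = partial_mon k r"
      using True by (intro partial_mon_cong) auto
    then show ?thesis
      unfolding split using x_mult_smaller_mon[of k j r] Suc.prems True
      by (simp add: scale_mult_left mult.assoc atLeastLessThanSuc_atLeastAtMost power_commutes
          fun_upd_same del: fun_upd_apply)
  next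
    case False
    then show ?thesis
      unfolding split using Suc by (simp add: scale_mult_left)
  qed
qed simp

lemma partial_mon_mult_x:
  "j \<in> {1..k} \<Longrightarrow> k \<le> n \<Longrightarrow>
    partial_mon k r * x j = scale (c ^ sum r {j<..k}) (partial_mon k (r(j := Suc (r j))))"
proof (induction k)
  case (Suc k)
  have split: "partial_mon (Suc k) r * x j = partial_mon k r * (x (Suc k) ^ r (Suc k) * x j)"
    by (simp add: mult.assoc)
  show ?case
  proof (cases "j = Suc k")
    case True
    have "partial_mon k (r(j := Suc (r j))) = partial_mon k r"
      using True by (intro partial_mon_cong) auto
    then show ?thesis
      using True by (simp add: mult.assoc power_commutes fun_upd_same del: fun_upd_apply)
  next
    case False
    then have j: "j \<in> {1..k}" using Suc.prems by auto
    have "{j<..Suc k} = insert (Suc k) {j<..k}" using j by auto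
    then have S: "sum r {j<..Suc k} = r (Suc k) + sum r {j<..k}" by simp
    have "partial_mon k r * (x (Suc k) ^ r (Suc k) * x j) =
        scale (c ^ r (Suc k)) (partial_mon k r * x j * x (Suc k) ^ r (Suc k))"
      using j Suc.prems by (simp add: x_power_commute scale_mult_right mult.assoc)
    then show ?thesis
      unfolding split S using Suc j False
      by (simp add: scale_mult_left power_add mult.commute)
  qed
qed simp

lemma x_mult_mon:
  "j \<in> {1..n} \<Longrightarrow> x j * mon r = scale (c ^ sum r {1..<j}) (mon (r(j := Suc (r j))))"
  using x_mult_partial_mon[of j n] by (simp add: mon_def partial_mon_def)

lemma mon_mult_x:
  "j \<in> {1..n} \<Longrightarrow> mon r * x j = scale (c ^ sum r {j<..n}) (mon (r(j := Suc (r j))))"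
  using partial_mon_mult_x[of j n] by (simp add: mon_def partial_mon_def)

lemma mon_Suc:
  assumes "j \<in> {1..n}"
  shows "mon (r(j := Suc (r j))) = scale (inverse c ^ sum r {1..<j}) (x j * mon r)"
  using c_nonzero by (simp add: x_mult_mon[OF assms] flip: power_mult_distrib)

lemma mon_cong: "(\<And>k. k \<in> {1..n} \<Longrightarrow> r k = r' k) \<Longrightarrow> mon r = mon r'"
  unfolding mon_def by (intro arg_cong[where f = prod_list] map_cong) auto

lemma mon_zero: "(\<And>k. k \<in> {1..n} \<Longrightarrow> r k = 0) \<Longrightarrow> mon r = 1"
proof -
  have "partial_mon k (\<lambda>_. 0) = 1" for k by (induction k) auto
  then show "(\<And>k. k \<in> {1..n} \<Longrightarrow> r k = 0) \<Longrightarrow> mon r = 1"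
    using mon_cong[of r "\<lambda>_. 0"] by (simp add: mon_def partial_mon_def)
qed

end

section \<open>Skew derivations and their values on ordered monomials\<close>

lemma linear_simps:
  assumes "Vector_Spaces.linear s1 s2 f"
  shows "f (u + v) = f u + f v" "f (s1 c u) = s2 c (f u)" "f 0 = 0" "f (u - v) = f u - f v"
    "f (- u) = - f u" "f (\<Sum>k\<in>K. g k) = (\<Sum>k\<in>K. f (g k))"
proof -
  interpret Vector_Spaces.linear s1 s2 f by fact
  show "f (u + v) = f u + f v" "f (s1 c u) = s2 c (f u)" "f 0 = 0" "f (u - v) = f u - f v"
    "f (- u) = - f u" "f (\<Sum>k\<in>K. g k) = (\<Sum>k\<in>K. f (g k))"
    by (simp_all add: add scale diff neg sum)
qed

locale skew_derivation = q_symmetric +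
  fixes i :: nat and T \<kappa> :: "'a \<Rightarrow> 'a" and \<gamma> :: complex
  assumes i_range: "i \<in> {1..<n}"
    and T_linear: "Vector_Spaces.linear scale scale T"
    and T_one: "T 1 = 0"
    and T_mult: "\<And>p p'. T (p * p') = T p * p' + \<kappa> p * T p'"
    and \<kappa>_linear: "Vector_Spaces.linear scale scale \<kappa>"
    and \<kappa>_one: "\<kappa> 1 = 1"
    and \<kappa>_mult: "\<And>p p'. \<kappa> (p * p') = \<kappa> p * \<kappa> p'"
    and \<kappa>_x: "\<And>j. j \<in> {1..n} \<Longrightarrow>
      \<kappa> (x j) = scale (if j = i then inverse c else if j = Suc i then c else 1) (x j)"
begin

lemmas T_simps = linear_simps[OF T_linear]
lemmas \<kappa>_simps = linear_simps[OF \<kappa>_linear]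

lemma T_mon_Suc:
  assumes "j \<in> {1..n}"
  shows "T (mon (r(j := Suc (r j)))) = scale (inverse c ^ sum r {1..<j})
    (T (x j) * mon r +
     scale (if j = i then inverse c else if j = Suc i then c else 1) (x j * T (mon r)))"
  by (subst mon_Suc[OF assms]) (simp add: T_simps T_mult \<kappa>_x[OF assms] scale_mult_left)

lemma \<kappa>_mon: "\<kappa> (mon r) = scale (c powi (int (r (Suc i)) - int (r i))) (mon r)"
proof (induction r rule: multi_index_induct[where n = n])
  case (zero r)
  then have "mon r = 1" by (rule mon_zero)
  with zero show ?case using i_range by (simp add: \<kappa>_one)
next
  case (Suc r j)
  have "\<kappa> (mon (r(j := Suc (r j)))) = scale (inverse c ^ sum r {1..<j}) (\<kappa> (x j) * \<kappa> (mon r))"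
    by (subst mon_Suc[OF Suc(1)]) (simp add: \<kappa>_simps \<kappa>_mult)
  also have "\<dots> = scale ((if j = i then inverse c else if j = Suc i then c else 1) *
      c powi (int (r (Suc i)) - int (r i))) (scale (inverse c ^ sum r {1..<j}) (x j * mon r))"
    by (simp add: Suc(2) \<kappa>_x[OF Suc(1)] scale_mult_left scale_mult_right mult_ac)
  also have "(if j = i then inverse c else if j = Suc i then c else 1) *
      c powi (int (r (Suc i)) - int (r i)) =
      c powi (int ((r(j := Suc (r j))) (Suc i)) - int ((r(j := Suc (r j))) i))"
    using c_nonzero by (auto simp: power_int_diff power_int_add field_simps)
  finally show ?case by (simp only: mon_Suc[OF Suc(1)])
qed

end

locale lowering_derivation = skew_derivation +
  assumes T_x: "\<And>j. j \<in> {1..n} \<Longrightarrow> T (x j) = (if j = i then scale \<gamma> (x (Suc i)) else 0)"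
begin

text \<open>The Leibniz rule on x_i^a gives one term per factor. In the term number j < a, the twist
  and the reordering contribute c^(a-1-2j), and these powers add up to \<open>qint c a\<close>. The
  induction collects them one variable at a time, through \<open>qint_Suc(1)\<close>.\<close>

lemma T_mon: "T (mon r) = scale (\<gamma> * qint c (r i)) (mon (move i (Suc i) r))"
proof (induction r rule: multi_index_induct[where n = n])
  case (zero r)
  then have "mon r = 1" by (rule mon_zero)
  with zero show ?case using i_range by (simp add: T_one)
next
  case (Suc r j)
  let ?r = "r(j := Suc (r j))" and ?S = "sum r {1..<j}"
  have IH: "T (mon ?r) = scale (inverse c ^ ?S)
    ((if j = i then scale \<gamma> (x (Suc i) * mon r) else 0) +
     scale ((if j = i then inverse c else if j = Suc i then c else 1) * \<gamma> * qint c (r i) *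
       c ^ sum (move i (Suc i) r) {1..<j})
     (mon ((move i (Suc i) r)(j := Suc (move i (Suc i) r j)))))"
    by (simp only: T_mon_Suc[OF Suc(1)] Suc(2) T_x[OF Suc(1)] x_mult_mon[OF Suc(1)]
          scale_mult_right scale_scale) (simp add: scale_mult_left mult_ac)
  show ?case
  proof (cases "j = i")
    case False
    have m: "(move i (Suc i) r)(j := Suc (move i (Suc i) r j)) = move i (Suc i) ?r"
      using False by (auto simp: move_def fun_eq_iff)
    show ?thesis
    proof (cases "r i = 0")
      case True
      then show ?thesis using False IH by (simp del: fun_upd_apply) simp
    next
      case r: False
      then have S: "sum (move i (Suc i) r) {1..<j} = ?S - (if j = Suc i then 1 else 0)"
        using i_range False by (subst sum_move) auto
      have "j = Suc i \<Longrightarrow> ?S \<ge> r i" using i_range by (intro member_le_sum) auto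
      \<comment> \<open>For \<open>j = Suc i\<close> the factor \<open>c\<close> coming from
        \<open>\<kappa>\<close> compensates for the unit that \<open>move\<close> removes from the
        positions below \<open>j\<close>.\<close>
      then have "inverse c ^ ?S * ((if j = Suc i then c else 1) * c ^ (?S - (if j = Suc i then 1 else 0))) = 1"
        using r c_nonzero by (auto simp: power_diff field_simps)
      then show ?thesis
        unfolding IH m S using False by (simp add: mult_ac del: fun_upd_apply) simp
    qed
  next
    case True
    have m: "r i > 0 \<Longrightarrow> (move i (Suc i) r)(i := Suc (move i (Suc i) r i)) = move i (Suc i) ?r"
      and m': "r(Suc i := Suc (r (Suc i))) = move i (Suc i) ?r"
      using True by (auto simp: move_def fun_eq_iff)
    have S: "r i > 0 \<Longrightarrow> sum (move i (Suc i) r) {1..<i} = ?S"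
      using i_range True by (subst sum_move) auto
    have "{1..<Suc i} = insert i {1..<i}" using i_range by auto
    then have S': "sum r {1..<Suc i} = ?S + r i" using True by simp
    have xm: "x (Suc i) * mon r = scale (c ^ (?S + r i)) (mon (move i (Suc i) ?r))"
      using i_range by (subst x_mult_mon) (simp_all only: m' S', auto)
    have "T (mon ?r) = scale (inverse c ^ ?S * \<gamma> * (c ^ (?S + r i)
        + inverse c * qint c (r i) * c ^ ?S)) (mon (move i (Suc i) ?r))"
    proof (cases "r i = 0")
      case r: True
      show ?thesis unfolding IH xm using True r by (simp add: mult_ac)
    next
      case False
      then show ?thesis unfolding IH xm using True m S
        by (simp add: algebra_simps scale_right_distrib scale_left_distrib)
    qed
    also have "inverse c ^ ?S * \<gamma> * (c ^ (?S + r i) + inverse c * qint c (r i) * c ^ ?S) =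
        \<gamma> * qint c (?r i)"
      using True c_nonzero by (simp add: qint_Suc(1)[OF c_nonzero c_square] field_simps power_add)
    finally show ?thesis .
  qed
qed

text \<open>\<open>D\<close> and \<open>Y\<close> are kept abstract so that both kinds of derivative
  are covered; \<open>Y\<close> will be the span of the monomials in the other family of variables.
  The extra summand arises at \<open>k = Suc i\<close>, where \<open>T\<close> has increased the
  exponent and \<open>qint_Suc(2)\<close> splits the new q-integer.\<close>

lemma partial_derivative_T:
  assumes D_linear: "Vector_Spaces.linear scale scale (D k)" "Vector_Spaces.linear scale scale (D i)"
    and D_mon: "\<And>k r y. k \<in> {1..n} \<Longrightarrow> y \<in> Y \<Longrightarrow> D k (mon r * y) =
      scale (inverse c ^ sum r {k<..n} * qint c (r k)) (mon (r(k := r k - 1)) * y)"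
    and T_Y: "\<And>y. y \<in> Y \<Longrightarrow> T y \<in> Y"
    and k: "k \<in> {1..n}" and y: "y \<in> Y"
  shows "D k (T (mon r * y)) =
    scale (if k = i then inverse c else if k = Suc i then c else 1) (T (D k (mon r * y))) +
    (if k = Suc i then scale \<gamma> (D i (mon r * y)) else 0)"
proof -
  let ?f = "if k = i then inverse c else if k = Suc i then c else 1"
  let ?d = "\<lambda>k r. inverse c ^ sum r {k<..n} * qint c (r k)"
  let ?\<kappa> = "\<lambda>r :: nat \<Rightarrow> nat. c powi (int (r (Suc i)) - int (r i))"
  let ?r = "r(k := r k - 1)"
  let ?t = "\<lambda>r. \<gamma> * qint c (r i)"
  let ?m = "move (i) (Suc i) :: (nat \<Rightarrow> nat) \<Rightarrow> nat \<Rightarrow> nat"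
  have lhs: "D k (T (mon r * y)) =
      scale (?t r * ?d k (?m r)) (mon ((?m r)(k := ?m r k - 1)) * y) +
      scale (?\<kappa> r * ?d k r) (mon ?r * T y)"
    by (simp only: T_mult T_mon \<kappa>_mon scale_mult_left linear_simps[OF D_linear(1)]
        D_mon[OF k y] D_mon[OF k T_Y[OF y]] scale_scale)
  have rhs: "T (D k (mon r * y)) =
      scale (?d k r * ?t ?r) (mon (?m ?r) * y) + scale (?d k r * ?\<kappa> ?r) (mon ?r * T y)"
    by (simp only: T_mult T_mon \<kappa>_mon scale_mult_left T_simps
        D_mon[OF k y] scale_scale scale_right_distrib)
  have "?\<kappa> r * ?d k r = ?f * (?d k r * ?\<kappa> ?r)"
    using c_nonzero
    by (cases "r k") (auto simp: power_int_diff power_int_add field_simps)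
  moreover have "scale (?t r * ?d k (?m r)) (mon ((?m r)(k := ?m r k - 1)) * y) =
      scale (?f * (?d k r * ?t ?r)) (mon (?m ?r) * y) +
      (if k = Suc i then scale \<gamma> (D i (mon r * y)) else 0)"
  proof (cases "r i = 0")
    case True
    then show ?thesis using i_range y by (auto simp: D_mon)
  next
    case False
    then have S: "sum (?m r) {k<..n} = sum r {k<..n} + (if k = i then 1 else 0)"
      using i_range k by (subst sum_move) (auto simp: sum.remove[of _ i])
    consider "k = i" | "k = Suc i" | "k \<noteq> i" "k \<noteq> Suc i" by blast
    then show ?thesis
    proof cases
      case 1
      then have "(?m r)(k := ?m r k - 1) = ?m ?r" by (auto simp: move_def fun_eq_iff)
      then show ?thesis unfolding S using 1 by (simp add: move_def mult_ac)
    next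
      case 2
      have "{i<..n} = insert (Suc i) {Suc i<..n}" using i_range by auto
      then have S': "sum r {i<..n} = r (Suc i) + sum r {Suc i<..n}" by simp
      have m: "(?m r)(k := ?m r k - 1) = r(i := r i - 1)"
        "r (Suc i) > 0 \<Longrightarrow> ?m ?r = r(i := r i - 1)"
        using 2 by (auto simp: move_def fun_eq_iff)
      have "D i (mon r * y) = scale (?d i r) (mon (r(i := r i - 1)) * y)"
        using i_range y by (intro D_mon) auto
      moreover have "?m r k = Suc (r (Suc i))" using 2 by (simp add: move_def)
      \<comment> \<open>For \<open>r (Suc i) = 0\<close> the two monomials differ, but then the
        coefficient contains \<open>qint c 0\<close>.\<close>
      moreover have "scale (?f * (?d k r * ?t ?r)) (mon (?m ?r) * y) =
          scale (?f * (?d k r * ?t ?r)) (mon (r(i := r i - 1)) * y)"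
        using m(2) 2 by (cases "r (Suc i)") auto
      moreover have "?t r * (inverse c ^ sum r {Suc i<..n} * qint c (Suc (r (Suc i)))) =
          c * (?d (Suc i) r * ?t r) + \<gamma> * ?d i r"
        by (simp add: S' qint_Suc(2)[OF c_nonzero c_square] power_add algebra_simps)
      ultimately show ?thesis
        unfolding S m(1) using 2 i_range
        by (simp only: simp_thms if_True if_False add_0_right scale_left_distrib scale_scale
            n_not_Suc_n Suc_n_not_n fun_upd_apply)
    next
      case 3
      then have "(?m r)(k := ?m r k - 1) = ?m ?r" by (auto simp: move_def fun_eq_iff)
      then show ?thesis unfolding S using 3 by (simp add: move_def mult_ac)
    qed
  qed
  ultimately show ?thesis
    unfolding lhs rhs by (simp add: scale_right_distrib)
qed

end

locale raising_derivation = skew_derivation +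
  assumes T_x: "\<And>j. j \<in> {1..n} \<Longrightarrow> T (x j) = (if j = Suc i then scale \<gamma> (x i) else 0)"
begin

text \<open>Here a power of \<open>c\<close> survives. Reordering x_(i+1)^b after the Leibniz rule
  gives the sum of c^(2j) over j < b, which is c^(b-1) times \<open>qint c b\<close>, and the twist
  scales the x_i standing to the left by \<open>c\<close> to the power \<open>- r i\<close>.\<close>

lemma T_mon:
  "T (mon r) = scale (\<gamma> * c powi (int (r (Suc i)) - int (r i) - 1) * qint c (r (Suc i)))
    (mon (move (Suc i) i r))"
proof (induction r rule: multi_index_induct[where n = n])
  case (zero r)
  then have "mon r = 1" by (rule mon_zero)
  with zero show ?case using i_range by (simp add: T_one)
next
  case (Suc r j)
  let ?r = "r(j := Suc (r j))" and ?S = "sum r {1..<j}"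
  let ?e = "c powi (int (r (Suc i)) - int (r i) - 1)"
  have IH: "T (mon ?r) = scale (inverse c ^ ?S)
    ((if j = Suc i then scale \<gamma> (x i * mon r) else 0) +
     scale ((if j = i then inverse c else if j = Suc i then c else 1) * \<gamma> * ?e * qint c (r (Suc i)) *
       c ^ sum (move (Suc i) i r) {1..<j})
     (mon ((move (Suc i) i r)(j := Suc (move (Suc i) i r j)))))"
    by (simp only: T_mon_Suc[OF Suc(1)] Suc(2) T_x[OF Suc(1)] x_mult_mon[OF Suc(1)]
          scale_mult_right scale_scale) (simp add: scale_mult_left mult_ac)
  show ?case
  proof (cases "j = Suc i")
    case False
    have m: "(move (Suc i) i r)(j := Suc (move (Suc i) i r j)) = move (Suc i) i ?r"
      using False by (auto simp: move_def fun_eq_iff)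
    show ?thesis
    proof (cases "r (Suc i) = 0")
      case True
      then show ?thesis using False IH by (simp del: fun_upd_apply) simp
    next
      case r: False
      then have S: "sum (move (Suc i) i r) {1..<j} = ?S"
        using i_range False by (subst sum_move) auto
      have "inverse c ^ ?S * c ^ ?S = 1"
        using c_nonzero by (simp flip: power_mult_distrib)
      moreover have fe: "(if j = i then inverse c else 1) * ?e =
          c powi (int (?r (Suc i)) - int (?r i) - 1)"
        using False c_nonzero by (auto simp: power_int_diff power_int_add field_simps)
      ultimately have coeff: "inverse c ^ ?S * ((if j = i then inverse c else 1) *
          \<gamma> * ?e * Q * c ^ ?S) = \<gamma> * c powi (int (r (Suc i)) - int (?r i) - 1) * Q" for Q
      proof -
        assume *: "inverse c ^ ?S * c ^ ?S = 1"
          and **: "(if j = i then inverse c else 1) * ?e = c powi (int (?r (Suc i)) - int (?r i) - 1)"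
        have "inverse c ^ ?S * ((if j = i then inverse c else 1) * \<gamma> * ?e * Q * c ^ ?S) =
          (inverse c ^ ?S * c ^ ?S) * \<gamma> * ((if j = i then inverse c else 1) * ?e) * Q"
          by simp
        then show ?thesis unfolding * ** using False by simp
      qed
      have "?r (Suc i) = r (Suc i)" using False by simp
      then show ?thesis
        unfolding IH m S scale_scale using False
        by (simp only: coeff if_False add_0_left scale_scale)
    qed
  next
    case True
    have m: "r (Suc i) > 0 \<Longrightarrow>
        (move (Suc i) i r)(Suc i := Suc (move (Suc i) i r (Suc i))) = move (Suc i) i ?r"
      and m': "r(i := Suc (r i)) = move (Suc i) i ?r"
      using True by (auto simp: move_def fun_eq_iff)
    have S: "r (Suc i) > 0 \<Longrightarrow> sum (move (Suc i) i r) {1..<Suc i} = Suc ?S"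
      using i_range True by (subst sum_move) auto
    have "{1..<Suc i} = insert i {1..<i}" using i_range by auto
    then have S': "?S = sum r {1..<i} + r i" using True by simp
    have xm: "x i * mon r = scale (c ^ sum r {1..<i}) (mon (move (Suc i) i ?r))"
      using i_range by (subst x_mult_mon) (simp_all only: m', auto)
    have "T (mon ?r) = scale (inverse c ^ ?S * \<gamma> * (c ^ sum r {1..<i}
        + c * ?e * qint c (r (Suc i)) * c ^ Suc ?S)) (mon (move (Suc i) i ?r))"
    proof (cases "r (Suc i) = 0")
      case r: True
      show ?thesis unfolding IH xm using True r by (simp add: mult_ac)
    next
      case False
      then show ?thesis unfolding IH xm using True m S
        by (simp add: algebra_simps scale_right_distrib scale_left_distrib)
    qed
    also have "inverse c ^ ?S * \<gamma> * (c ^ sum r {1..<i} + c * ?e * qint c (r (Suc i)) * c ^ Suc ?S) =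
        \<gamma> * c powi (int (?r (Suc i)) - int (?r i) - 1) * qint c (?r (Suc i))"
      using True c_nonzero unfolding S'
      by (simp add: qint_Suc(2)[OF c_nonzero c_square] field_simps power_add power_int_diff power_int_add)
    finally show ?thesis .
  qed
qed

text \<open>Now it is the exponent of x_i that grows, so the extra summand sits at
  \<open>k = i\<close>, and \<open>qint_Suc(1)\<close> is the splitting that matches the surviving
  power of \<open>c\<close>.\<close>

lemma partial_derivative_T:
  assumes D_linear: "Vector_Spaces.linear scale scale (D k)" "Vector_Spaces.linear scale scale (D i)"
    and D_mon: "\<And>k r y. k \<in> {1..n} \<Longrightarrow> y \<in> Y \<Longrightarrow> D k (mon r * y) =
      scale (inverse c ^ sum r {k<..n} * qint c (r k)) (mon (r(k := r k - 1)) * y)"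
    and T_Y: "\<And>y. y \<in> Y \<Longrightarrow> T y \<in> Y"
    and k: "k \<in> {1..n}" and y: "y \<in> Y"
  shows "D k (T (mon r * y)) =
    scale (if k = i then inverse c else if k = Suc i then c else 1) (T (D k (mon r * y))) +
    (if k = i then scale \<gamma> (D (Suc i) (mon r * y)) else 0)"
proof -
  let ?f = "if k = i then inverse c else if k = Suc i then c else 1"
  let ?d = "\<lambda>k r. inverse c ^ sum r {k<..n} * qint c (r k)"
  let ?\<kappa> = "\<lambda>r :: nat \<Rightarrow> nat. c powi (int (r (Suc i)) - int (r i))"
  let ?r = "r(k := r k - 1)"
  let ?t = "\<lambda>r. \<gamma> * c powi (int (r (Suc i)) - int (r i) - 1) * qint c (r (Suc i))"
  let ?m = "move (Suc i) (i) :: (nat \<Rightarrow> nat) \<Rightarrow> nat \<Rightarrow> nat"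
  have lhs: "D k (T (mon r * y)) =
      scale (?t r * ?d k (?m r)) (mon ((?m r)(k := ?m r k - 1)) * y) +
      scale (?\<kappa> r * ?d k r) (mon ?r * T y)"
    by (simp only: T_mult T_mon \<kappa>_mon scale_mult_left linear_simps[OF D_linear(1)]
        D_mon[OF k y] D_mon[OF k T_Y[OF y]] scale_scale)
  have rhs: "T (D k (mon r * y)) =
      scale (?d k r * ?t ?r) (mon (?m ?r) * y) + scale (?d k r * ?\<kappa> ?r) (mon ?r * T y)"
    by (simp only: T_mult T_mon \<kappa>_mon scale_mult_left T_simps
        D_mon[OF k y] scale_scale scale_right_distrib)
  have "?\<kappa> r * ?d k r = ?f * (?d k r * ?\<kappa> ?r)"
    using c_nonzero
    by (cases "r k") (auto simp: power_int_diff power_int_add field_simps)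
  moreover have "scale (?t r * ?d k (?m r)) (mon ((?m r)(k := ?m r k - 1)) * y) =
      scale (?f * (?d k r * ?t ?r)) (mon (?m ?r) * y) +
      (if k = i then scale \<gamma> (D (Suc i) (mon r * y)) else 0)"
  proof (cases "r (Suc i) = 0")
    case True
    then show ?thesis using i_range y by (auto simp: D_mon)
  next
    case False
    have "k = i \<Longrightarrow> sum r {k<..n} > 0"
      using False i_range by (intro sum_pos2[of _ "Suc i"]) auto
    with False have S: "sum (?m r) {k<..n} = sum r {k<..n} - (if k = i then 1 else 0)"
      using i_range k by (subst sum_move) (auto simp: sum.remove[of _ i])
    consider "k = i" | "k = Suc i" | "k \<noteq> i" "k \<noteq> Suc i" by blast
    then show ?thesis
    proof cases
      case 1
      have "{i<..n} = insert (Suc i) {Suc i<..n}" using i_range by auto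
      then have S': "sum r {i<..n} = r (Suc i) + sum r {Suc i<..n}" by simp
      have m: "(?m r)(k := ?m r k - 1) = r(Suc i := r (Suc i) - 1)"
        "r i > 0 \<Longrightarrow> ?m ?r = r(Suc i := r (Suc i) - 1)"
        using 1 by (auto simp: move_def fun_eq_iff)
      have "D (Suc i) (mon r * y) = scale (?d (Suc i) r) (mon (r(Suc i := r (Suc i) - 1)) * y)"
        using i_range y by (intro D_mon) auto
      moreover have "?m r k = Suc (r i)" using 1 by (simp add: move_def)
      moreover have "scale (?f * (?d k r * ?t ?r)) (mon (?m ?r) * y) =
          scale (?f * (?d k r * ?t ?r)) (mon (r(Suc i := r (Suc i) - 1)) * y)"
        using m(2) 1 by (cases "r i") auto
      moreover have "?t r * (inverse c ^ (r (Suc i) + sum r {Suc i<..n} - 1) * qint c (Suc (r i))) =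
          ?f * (?d k r * ?t ?r) + \<gamma> * ?d (Suc i) r"
      proof -
        obtain b where b: "r (Suc i) = Suc b" using False by (cases "r (Suc i)") auto
        have "?t r * (inverse c ^ (r (Suc i) + sum r {Suc i<..n} - 1) * qint c (Suc (r i))) =
          \<gamma> * inverse c ^ sum r {Suc i<..n} * qint c (Suc b) * inverse c ^ r i * qint c (Suc (r i))"
          using c_nonzero by (simp add: b power_int_diff power_add field_simps)
        moreover have "?f * (?d k r * ?t ?r) = \<gamma> * inverse c ^ sum r {Suc i<..n} * qint c (Suc b) *
            (inverse c ^ r i * inverse c * qint c (r i))"
          using c_nonzero 1 by (cases "r i") (simp_all add: b S' power_int_diff power_add field_simps)
        ultimately show ?thesis
          using c_nonzero
          by (simp only: b qint_Suc(1)[OF c_nonzero c_square, of "r i"]) (simp add: field_simps)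
      qed
      ultimately show ?thesis
        unfolding S m(1) using 1 S'
        by (simp only: simp_thms if_True if_False add_0_right scale_left_distrib scale_scale
            n_not_Suc_n Suc_n_not_n fun_upd_apply)
    next
      case 2
      then have "(?m r)(k := ?m r k - 1) = ?m ?r" by (auto simp: move_def fun_eq_iff)
      then show ?thesis unfolding S using 2 c_nonzero False
        by (cases "r (Suc i)") (simp_all add: move_def power_int_diff power_int_add field_simps)
    next
      case 3
      then have "(?m r)(k := ?m r k - 1) = ?m ?r" by (auto simp: move_def fun_eq_iff)
      then show ?thesis unfolding S using 3 by (simp add: move_def mult_ac)
    qed
  qed
  ultimately show ?thesis
    unfolding lhs rhs by (simp add: scale_right_distrib)
qed

end

section \<open>Linear maps on the algebra and descent of linear relations\<close>

context complex_algebra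
begin

lemma mult_left_linear: "Vector_Spaces.linear scale scale (\<lambda>p. a * p)"
  by unfold_locales (simp_all add: distrib_left scale_mult_right)

lemma scaled_linear: "Vector_Spaces.linear scale scale f \<Longrightarrow>
    Vector_Spaces.linear scale scale (\<lambda>p. scale c (f p))"
  by unfold_locales (simp_all add: linear_simps scale_right_distrib mult.commute)

lemma composed_linear: "Vector_Spaces.linear scale scale f \<Longrightarrow>
    Vector_Spaces.linear scale scale g \<Longrightarrow> Vector_Spaces.linear scale scale (\<lambda>p. f (g p))"
  by unfold_locales (simp_all add: linear_simps)

lemma zero_linear: "Vector_Spaces.linear scale scale (\<lambda>p. 0)"
  by unfold_locales simp_all

lemma added_linear: "Vector_Spaces.linear scale scale f \<Longrightarrow> Vector_Spaces.linear scale scale g \<Longrightarrow>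
    Vector_Spaces.linear scale scale (\<lambda>p. f p + g p)"
  by unfold_locales (simp_all add: linear_simps scale_right_distrib)

lemma if_linear: "Vector_Spaces.linear scale scale f \<Longrightarrow>
    Vector_Spaces.linear scale scale (\<lambda>p. if P then f p else 0)"
  by (cases P) (simp_all add: zero_linear)

lemma linear_span_subset:
  assumes "Vector_Spaces.linear scale scale f" "subspace T" "\<And>x. x \<in> S \<Longrightarrow> f x \<in> T" "p \<in> span S"
  shows "f p \<in> T"
  using assms(4)
  by (induction rule: span_induct_alt)
     (use assms(1-3) in \<open>simp_all add: linear_simps[OF assms(1)] subspace_0 subspace_add subspace_scale\<close>)

lemma linear_eq_span:
  assumes "Vector_Spaces.linear scale scale f" "Vector_Spaces.linear scale scale g"
    and "\<And>x. x \<in> S \<Longrightarrow> f x = g x" "p \<in> span S"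
  shows "f p = g p"
  using assms(4)
  by (induction rule: span_induct_alt)
     (use assms(3) in \<open>simp_all add: linear_simps[OF assms(1)] linear_simps[OF assms(2)]\<close>)

text \<open>\<open>f\<close> turns a relation among the \<open>b'\<close> into a relation among the
  \<open>b\<close>: indices in the image of \<open>up\<close> survive with a nonzero factor and all
  others are killed. Derivatives will play the role of \<open>f\<close>.\<close>

lemma independent_descent:
  assumes f: "Vector_Spaces.linear scale scale f" and fin: "finite J"
    and up: "inj_on up I" "up ` I \<subseteq> J"
    and f_up: "\<And>x. x \<in> I \<Longrightarrow> f (b' (up x)) = scale (d x) (b x)" "\<And>x. x \<in> I \<Longrightarrow> d x \<noteq> 0"
    and f_other: "\<And>x. x \<in> J - up ` I \<Longrightarrow> f (b' x) = 0"
    and indep: "\<And>c x. (\<Sum>x\<in>I. scale (c x) (b x)) = 0 \<Longrightarrow> x \<in> I \<Longrightarrow> c x = 0"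
    and zero: "(\<Sum>x\<in>J. scale (c x) (b' x)) = 0" and x: "x \<in> I"
  shows "c (up x) = 0"
proof -
  have "0 = (\<Sum>x\<in>J. scale (c x) (f (b' x)))"
    using arg_cong[OF zero, of f] by (simp add: linear_simps[OF f])
  also have "\<dots> = (\<Sum>x\<in>up ` I. scale (c x) (f (b' x)))"
    by (rule sum.mono_neutral_right) (use fin up f_other in auto)
  also have "\<dots> = (\<Sum>x\<in>I. scale (c (up x) * d x) (b x))"
    using up(1) f_up(1) by (simp add: sum.reindex)
  finally have "c (up x) * d x = 0"
    using indep[of "\<lambda>x. c (up x) * d x"] x by simp
  with f_up(2)[OF x] show ?thesis by simp
qed

end

context q_symmetric
begin

lemma mon_decompose:
  assumes "sum r {1..n} = Suc m"
  obtains k r' d where "k \<in> {1..n}" "sum r' {1..n} = m" "mon r = scale d (x k * mon r')"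
proof -
  obtain k where k: "k \<in> {1..n}" "r k > 0"
    using assms by (metis Suc_neq_Zero bot_nat_0.not_eq_extremum sum.neutral)
  let ?r = "r(k := r k - 1)"
  have "sum ?r {1..n} = m" using assms k by (subst sum_pred_upd) auto
  moreover have "mon r = scale (inverse c ^ sum ?r {1..<k}) (x k * mon ?r)"
    using k(2) mon_Suc[OF k(1), of ?r] by simp
  ultimately show ?thesis using k(1) that by blast
qed

lemma mon_mult_closed:
  assumes "\<And>d. subspace (U d)"
    and "\<And>j d p. j \<in> {1..n} \<Longrightarrow> p \<in> U d \<Longrightarrow> x j * p \<in> U (Suc d)" and p: "p \<in> U d"
  shows "mon r * p \<in> U (d + sum r {1..n})"
proof (induction r rule: multi_index_induct[where n = n])
  case (zero r)
  then have "mon r = 1" by (rule mon_zero)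
  with zero p show ?case by simp
next
  case (Suc r j)
  have "sum (r(j := Suc (r j))) {1..n} = Suc (sum r {1..n})"
    using Suc(1) by (subst sum_Suc_upd) auto
  moreover have "mon (r(j := Suc (r j))) * p = scale (inverse c ^ sum r {1..<j}) (x j * (mon r * p))"
    by (simp only: mon_Suc[OF Suc(1)] scale_mult_left mult.assoc)
  ultimately show ?case
    using assms(2)[OF Suc] by (simp del: fun_upd_apply add: subspace_scale[OF assms(1)])
qed

end

section \<open>Straightening in the algebra generated by \<open>z\<^sub>i\<close> and \<open>w\<^sub>i\<close>\<close>

locale zw_relations = complex_algebra scale
  for scale :: "complex \<Rightarrow> 'a::ring_1 \<Rightarrow> 'a" +
  fixes q :: complex and n :: nat and gA :: "zw_gen \<Rightarrow> 'a"
  assumes q_nonzero: "q \<noteq> 0" and q_power: "\<And>k::nat. k > 0 \<Longrightarrow> q ^ k \<noteq> 1" and n_ge: "n \<ge> 2"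
    and z_z: "\<And>i j. 1 \<le> i \<Longrightarrow> i < j \<Longrightarrow> j \<le> n \<Longrightarrow>
      gA (Zgen i) * gA (Zgen j) = scale q (gA (Zgen j) * gA (Zgen i))"
    and w_w: "\<And>i j. 1 \<le> i \<Longrightarrow> i < j \<Longrightarrow> j \<le> n \<Longrightarrow>
      gA (Wgen i) * gA (Wgen j) = scale (inverse q) (gA (Wgen j) * gA (Wgen i))"
    and w_z: "\<And>i j. i \<in> {1..n} \<Longrightarrow> j \<in> {1..n} \<Longrightarrow> i \<noteq> j \<Longrightarrow>
      gA (Wgen j) * gA (Zgen i) = scale q (gA (Zgen i) * gA (Wgen j))"
    and w_z_same: "\<And>k. k \<in> {1..n} \<Longrightarrow> gA (Wgen k) * gA (Zgen k) = gA (Zgen k) * gA (Wgen k) +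
      scale (1 - q\<^sup>2) (\<Sum>s\<in>{1..<k}. gA (Zgen s) * gA (Wgen s))"
begin

abbreviation z :: "nat \<Rightarrow> 'a" where "z i \<equiv> gA (Zgen i)"
abbreviation w :: "nat \<Rightarrow> 'a" where "w i \<equiv> gA (Wgen i)"
abbreviation zm :: "(nat \<Rightarrow> nat) \<Rightarrow> 'a" where "zm \<equiv> z_monomial gA n"
abbreviation wm :: "(nat \<Rightarrow> nat) \<Rightarrow> 'a" where "wm \<equiv> w_monomial gA n"
abbreviation A :: "nat \<Rightarrow> nat \<Rightarrow> 'a set" where "A \<equiv> bihomogeneous n scale gA"
abbreviation Q :: 'a where "Q \<equiv> Q_element n gA"

text \<open>The same bidegree spanned by the opposite ordering, on which \<open>Dbar\<close> is
  prescribed; both spans turn out to agree in \<open>A'_eq\<close>.\<close>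

definition A' :: "nat \<Rightarrow> nat \<Rightarrow> 'a set" where
  "A' m m' = span {wm s * zm r | r s. sum r {1..n} = m \<and> sum s {1..n} = m'}"

lemma q_square: "q\<^sup>2 \<noteq> 1" "(inverse q)\<^sup>2 \<noteq> 1"
  using q_power[of 2] q_nonzero by (auto simp: power_inverse)

sublocale Z: q_symmetric scale "inverse q" n "\<lambda>i. gA (Zgen i)"
  by unfold_locales (use q_nonzero q_square z_z in auto)

sublocale W: q_symmetric scale q n "\<lambda>i. gA (Wgen i)"
  by unfold_locales (use q_nonzero q_square w_w in auto)

lemma Z_mon: "Z.mon = zm" and W_mon: "W.mon = wm"
  by (simp_all add: fun_eq_iff Z.mon_def W.mon_def z_monomial_def w_monomial_def)

lemmas zm_simps = Z.x_mult_mon[unfolded Z_mon] Z.mon_mult_x[unfolded Z_mon] Z.mon_zero[unfolded Z_mon]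
lemmas wm_simps = W.x_mult_mon[unfolded W_mon] W.mon_mult_x[unfolded W_mon] W.mon_zero[unfolded W_mon]

lemma subspace_A: "subspace (A m m')" "subspace (A' m m')"
  by (simp_all add: bihomogeneous_def A'_def)

lemma monomial_in_A:
  "sum r {1..n} = m \<Longrightarrow> sum s {1..n} = m' \<Longrightarrow> zm r * wm s \<in> A m m'"
  "sum r {1..n} = m \<Longrightarrow> sum s {1..n} = m' \<Longrightarrow> wm s * zm r \<in> A' m m'"
  unfolding bihomogeneous_def A'_def by (rule span_base, blast)+

lemma A_closed:
  assumes f: "Vector_Spaces.linear scale scale f" and T: "subspace T"
  shows "(\<And>r s. sum r {1..n} = m \<Longrightarrow> sum s {1..n} = m' \<Longrightarrow> f (zm r * wm s) \<in> T) \<Longrightarrow>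
      p \<in> A m m' \<Longrightarrow> f p \<in> T"
    and "(\<And>r s. sum r {1..n} = m \<Longrightarrow> sum s {1..n} = m' \<Longrightarrow> f (wm s * zm r) \<in> T) \<Longrightarrow>
      p \<in> A' m m' \<Longrightarrow> f p \<in> T"
  unfolding bihomogeneous_def A'_def by (rule linear_span_subset[OF f T]; blast)+

lemma A_linear_eq:
  assumes f: "Vector_Spaces.linear scale scale f" "Vector_Spaces.linear scale scale g"
  shows "(\<And>r s. sum r {1..n} = m \<Longrightarrow> sum s {1..n} = m' \<Longrightarrow> f (zm r * wm s) = g (zm r * wm s)) \<Longrightarrow>
      p \<in> A m m' \<Longrightarrow> f p = g p"
    and "(\<And>r s. sum r {1..n} = m \<Longrightarrow> sum s {1..n} = m' \<Longrightarrow> f (wm s * zm r) = g (wm s * zm r)) \<Longrightarrow>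
      p \<in> A' m m' \<Longrightarrow> f p = g p"
  unfolding bihomogeneous_def A'_def by (rule linear_eq_span[OF f]; blast)+

lemma z_mult_A:
  assumes "j \<in> {1..n}" "p \<in> A m m'"
  shows "z j * p \<in> A (Suc m) m'"
proof (rule A_closed(1)[OF mult_left_linear subspace_A(1) _ assms(2)])
  fix r s :: "nat \<Rightarrow> nat" assume "sum r {1..n} = m" "sum s {1..n} = m'"
  then have "zm (r(j := Suc (r j))) * wm s \<in> A (Suc m) m'"
    using assms(1) by (intro monomial_in_A) (auto simp: sum_Suc_upd simp del: fun_upd_apply)
  moreover have "z j * (zm r * wm s) =
      scale (inverse q ^ sum r {1..<j}) (zm (r(j := Suc (r j))) * wm s)"
    using zm_simps(1)[OF assms(1), of r] by (simp add: scale_mult_left flip: mult.assoc)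
  ultimately show "z j * (zm r * wm s) \<in> A (Suc m) m'"
    by (simp add: subspace_scale subspace_A)
qed

text \<open>\<open>w j\<close> has to travel past the z part, whence the induction on its degree.
  After one \<open>z k\<close> is split off, every term of the exchange relation has the form z_l
  w_l' p with p of smaller z-degree, so the induction hypothesis applies to w_l' p.\<close>

lemma w_mult_A:
  assumes "j \<in> {1..n}" "p \<in> A m m'"
  shows "w j * p \<in> A m (Suc m')"
  using assms
proof (induction m arbitrary: p j)
  case 0
  show ?case
  proof (rule A_closed(1)[OF mult_left_linear subspace_A(1) _ 0(2)])
    fix r s :: "nat \<Rightarrow> nat" assume rs: "sum r {1..n} = 0" "sum s {1..n} = m'"
    then have r: "zm r = 1" by (intro zm_simps) auto
    have "zm r * wm (s(j := Suc (s j))) \<in> A 0 (Suc m')"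
      using 0(1) rs by (intro monomial_in_A) (auto simp: sum_Suc_upd simp del: fun_upd_apply)
    then show "w j * (zm r * wm s) \<in> A 0 (Suc m')"
      by (simp add: r wm_simps(1)[OF 0(1)] subspace_scale subspace_A)
  qed
next
  case (Suc m)
  show ?case
  proof (rule A_closed(1)[OF mult_left_linear subspace_A(1) _ Suc.prems(2)])
    fix r s :: "nat \<Rightarrow> nat" assume rs: "sum r {1..n} = Suc m" "sum s {1..n} = m'"
    obtain k r' d where k: "k \<in> {1..n}" "sum r' {1..n} = m" "zm r = scale d (z k * zm r')"
      using Z.mon_decompose[OF rs(1), unfolded Z_mon] by blast
    let ?p = "zm r' * wm s"
    have p: "?p \<in> A m m'" using k rs by (intro monomial_in_A) auto
    have zw: "z l * (w l' * ?p) \<in> A (Suc m) (Suc m')" if "l \<in> {1..n}" "l' \<in> {1..n}" for l l'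
      by (intro z_mult_A Suc.IH p that)
    have "w j * (z k * ?p) \<in> A (Suc m) (Suc m')"
    proof (cases "j = k")
      case True
      have "w j * (z k * ?p) = z k * (w k * ?p) +
          scale (1 - q\<^sup>2) (\<Sum>s\<in>{1..<k}. z s * (w s * ?p))"
        unfolding mult.assoc[symmetric] True w_z_same[OF k(1)]
        by (simp add: distrib_right scale_mult_left sum_distrib_right mult.assoc)
      moreover have "(\<Sum>s\<in>{1..<k}. z s * (w s * ?p)) \<in> A (Suc m) (Suc m')"
        using k(1) by (intro subspace_sum subspace_A zw) auto
      ultimately show ?thesis
        using zw[OF k(1) k(1)] by (simp add: subspace_add subspace_scale subspace_A)
    next
      case False
      then have "w j * (z k * ?p) = scale q (z k * (w j * ?p))"
        using w_z[OF k(1) Suc.prems(1)] by (simp add: scale_mult_left flip: mult.assoc)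
      then show ?thesis
        using zw[OF k(1) Suc.prems(1)] by (simp add: subspace_scale subspace_A)
    qed
    then show "w j * (zm r * wm s) \<in> A (Suc m) (Suc m')"
      unfolding k(3) scale_mult_left scale_mult_right mult.assoc
      by (simp add: subspace_scale subspace_A)
  qed
qed

lemma w_mult_A':
  assumes "j \<in> {1..n}" "p \<in> A' m m'"
  shows "w j * p \<in> A' m (Suc m')"
proof (rule A_closed(2)[OF mult_left_linear subspace_A(2) _ assms(2)])
  fix r s :: "nat \<Rightarrow> nat" assume "sum r {1..n} = m" "sum s {1..n} = m'"
  then have "wm (s(j := Suc (s j))) * zm r \<in> A' m (Suc m')"
    using assms(1) by (intro monomial_in_A) (auto simp: sum_Suc_upd simp del: fun_upd_apply)
  moreover have "w j * (wm s * zm r) =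
      scale (q ^ sum s {1..<j}) (wm (s(j := Suc (s j))) * zm r)"
    using wm_simps(1)[OF assms(1), of s] by (simp add: scale_mult_left flip: mult.assoc)
  ultimately show "w j * (wm s * zm r) \<in> A' m (Suc m')"
    by (simp add: subspace_scale subspace_A)
qed

lemma z_mult_A':
  assumes "j \<in> {1..n}" "p \<in> A' m m'"
  shows "z j * p \<in> A' (Suc m) m'"
  using assms
proof (induction m' arbitrary: p j)
  case 0
  show ?case
  proof (rule A_closed(2)[OF mult_left_linear subspace_A(2) _ 0(2)])
    fix r s :: "nat \<Rightarrow> nat" assume rs: "sum r {1..n} = m" "sum s {1..n} = 0"
    then have s: "wm s = 1" by (intro wm_simps) auto
    have "wm s * zm (r(j := Suc (r j))) \<in> A' (Suc m) 0"
      using 0(1) rs by (intro monomial_in_A) (auto simp: sum_Suc_upd simp del: fun_upd_apply)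
    then show "z j * (wm s * zm r) \<in> A' (Suc m) 0"
      by (simp add: s zm_simps(1)[OF 0(1)] subspace_scale subspace_A)
  qed
next
  case (Suc m')
  show ?case
  proof (rule A_closed(2)[OF mult_left_linear subspace_A(2) _ Suc.prems(2)])
    fix r s :: "nat \<Rightarrow> nat" assume rs: "sum r {1..n} = m" "sum s {1..n} = Suc m'"
    obtain k s' d where k: "k \<in> {1..n}" "sum s' {1..n} = m'" "wm s = scale d (w k * wm s')"
      using W.mon_decompose[OF rs(2), unfolded W_mon] by blast
    let ?p = "wm s' * zm r"
    have p: "?p \<in> A' m m'" using k rs by (intro monomial_in_A) auto
    have wz: "w l * (z l' * ?p) \<in> A' (Suc m) (Suc m')" if "l \<in> {1..n}" "l' \<in> {1..n}" for l l'
      by (intro w_mult_A' Suc.IH p that)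
    \<comment> \<open>Solving the relation for z_l w_l leaves products z_s w_s with s < l, which an
      inner induction on \<open>l\<close> removes.\<close>
    have same: "z l * (w l * ?p) \<in> A' (Suc m) (Suc m')" if "l \<in> {1..n}" for l
      using that
    proof (induction l rule: less_induct)
      case (less l)
      have "z l * (w l * ?p) = w l * (z l * ?p) -
          scale (1 - q\<^sup>2) (\<Sum>s\<in>{1..<l}. z s * (w s * ?p))"
        unfolding mult.assoc[symmetric] w_z_same[OF less.prems]
        by (simp add: distrib_right scale_mult_left sum_distrib_right mult.assoc)
      moreover have "(\<Sum>s\<in>{1..<l}. z s * (w s * ?p)) \<in> A' (Suc m) (Suc m')"
        using less by (intro subspace_sum subspace_A less.IH) auto
      ultimately show ?case
        using wz[OF less.prems less.prems] by (simp add: subspace_diff subspace_scale subspace_A)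
    qed
    have "z j * (w k * ?p) \<in> A' (Suc m) (Suc m')"
    proof (cases "j = k")
      case False
      then have "scale q (z j * (w k * ?p)) = w k * (z j * ?p)"
        using w_z[OF Suc.prems(1) k(1)] by (simp add: scale_mult_left flip: mult.assoc)
      then have "z j * (w k * ?p) = scale (inverse q) (w k * (z j * ?p))"
        using q_nonzero by (metis scale_one scale_scale left_inverse)
      then show ?thesis
        using wz[OF k(1) Suc.prems(1)] by (simp add: subspace_scale subspace_A)
    qed (use same k in auto)
    then show "z j * (wm s * zm r) \<in> A' (Suc m) (Suc m')"
      unfolding k(3) scale_mult_left scale_mult_right mult.assoc
      by (simp add: subspace_scale subspace_A)
  qed
qed

lemma one_in_A: "1 \<in> A 0 0" "1 \<in> A' 0 0"
  using monomial_in_A[of "\<lambda>_. 0" 0 "\<lambda>_. 0" 0] by (simp_all add: zm_simps wm_simps)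

text \<open>Each of the two families of spans contains 1 and is closed under left multiplication by
  all generators, hence contains the monomials written in the other order.\<close>

lemma A'_eq: "A' m m' = A m m'"
proof
  have "wm s * zm r \<in> A m m'" if "sum r {1..n} = m" "sum s {1..n} = m'" for r s
  proof -
    have "zm r * 1 \<in> A (0 + sum r {1..n}) 0"
      by (rule Z.mon_mult_closed[unfolded Z_mon, of "\<lambda>d. A d 0"])
         (use subspace_A z_mult_A one_in_A in auto)
    then have "wm s * (zm r * 1) \<in> A m (0 + sum s {1..n})"
      using that(1)
      by (intro W.mon_mult_closed[unfolded W_mon, of "\<lambda>d. A m d"])
         (use subspace_A w_mult_A in auto)
    then show ?thesis using that by simp
  qed
  then show "A' m m' \<subseteq> A m m'"
    unfolding A'_def by (intro span_minimal subspace_A) blast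
  have "zm r * wm s \<in> A' m m'" if "sum r {1..n} = m" "sum s {1..n} = m'" for r s
  proof -
    have "wm s * 1 \<in> A' 0 (0 + sum s {1..n})"
      by (rule W.mon_mult_closed[unfolded W_mon, of "\<lambda>d. A' 0 d"])
         (use subspace_A w_mult_A' one_in_A in auto)
    then have "zm r * (wm s * 1) \<in> A' (0 + sum r {1..n}) m'"
      using that(2)
      by (intro Z.mon_mult_closed[unfolded Z_mon, of "\<lambda>d. A' d m'"])
         (use subspace_A z_mult_A' in auto)
    then show ?thesis using that by simp
  qed
  then show "A m m' \<subseteq> A' m m'"
    unfolding bihomogeneous_def[of n scale gA m m']
    by (intro span_minimal subspace_A) blast
qed

text \<open>Moving z_j to the left through z_i w_i costs q^2 for i < j and nothing for i > j. The
  correction terms of the relation for w_j z_j supply exactly the missing 1 - q^2 for i < j.\<close>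

lemma Q_mult_z:
  assumes j: "j \<in> {1..n}"
  shows "Q * z j = z j * Q"
proof -
  let ?y = "\<lambda>i. z j * (z i * w i)"
  let ?g = "\<lambda>i. if i < j then q\<^sup>2 else if i = j then 0 else 1"
  have "z i * w i * z j = scale (?g i) (?y i) +
      (if i = j then ?y j + scale (1 - q\<^sup>2) (\<Sum>s\<in>{1..<j}. ?y s) else 0)" if i: "i \<in> {1..n}" for i
  proof -
    consider "i < j" | "i = j" | "j < i" by linarith
    then show ?thesis
    proof cases
      case 1
      have "z i * w i * z j = scale q (z i * z j * w i)"
        using w_z[OF j i] 1 by (simp add: mult.assoc scale_mult_right)
      also have "z i * z j * w i = scale q (?y i)"
        using z_z[of i j] 1 i j by (simp add: scale_mult_left mult.assoc)
      finally show ?thesis using 1 by (simp add: power2_eq_square)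
    next
      case 2
      show ?thesis unfolding 2
        using w_z_same[OF j]
        by (simp add: mult.assoc distrib_left scale_mult_right sum_distrib_left)
    next
      case 3
      have "z i * w i * z j = scale q (z i * z j * w i)"
        using w_z[OF j i] 3 by (simp add: mult.assoc scale_mult_right)
      also have "scale q (z i * z j * w i) = scale q (z i * z j) * w i"
        by (simp add: scale_mult_left)
      also have "scale q (z i * z j) = z j * z i"
        using z_z[of j i] 3 i j by simp
      finally show ?thesis using 3 by (simp add: mult.assoc)
    qed
  qed
  then have "Q * z j = (\<Sum>i\<in>{1..n}. scale (?g i) (?y i)) + ?y j +
      scale (1 - q\<^sup>2) (\<Sum>s\<in>{1..<j}. ?y s)"
    using j by (simp add: Q_element_def sum_distrib_right sum.distrib add.assoc)
  also have "scale (1 - q\<^sup>2) (\<Sum>s\<in>{1..<j}. ?y s) =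
      (\<Sum>s\<in>{1..n}. if s < j then scale (1 - q\<^sup>2) (?y s) else 0)"
    using j by (simp add: scale_sum_right) (rule sum.mono_neutral_cong_left; auto)
  also have "?y j = (\<Sum>s\<in>{1..n}. if s = j then ?y s else 0)"
    using j by simp
  also have "(\<Sum>i\<in>{1..n}. scale (?g i) (?y i)) + (\<Sum>s\<in>{1..n}. if s = j then ?y s else 0) +
      (\<Sum>s\<in>{1..n}. if s < j then scale (1 - q\<^sup>2) (?y s) else 0) = (\<Sum>i\<in>{1..n}. ?y i)"
    unfolding sum.distrib[symmetric]
    by (rule sum.cong) (auto simp flip: scale_left_distrib)
  finally show ?thesis by (simp add: Q_element_def sum_distrib_left)
qed

text \<open>\<open>Q\<close> is moved between the two halves of the monomial: z_i then joins z^r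
  from the right and w_i joins w^s from the left, and the two powers of \<open>q\<close> are the
  costs of sorting them in.\<close>

lemma Q_monomial:
  "Q * (zm r * wm s) = (\<Sum>i\<in>{1..n}. scale (inverse q ^ sum r {i<..n} * q ^ sum s {1..<i})
     (zm (r(i := Suc (r i))) * wm (s(i := Suc (s i)))))"
proof -
  have "Q * zm r = zm r * Q"
  proof (induction r rule: multi_index_induct[where n = n])
    case (zero r)
    then have "zm r = 1" by (rule zm_simps)
    then show ?case by simp
  next
    case (Suc r j)
    have "Q * (z j * zm r) = (z j * zm r) * Q"
      by (simp add: mult.assoc Q_mult_z[OF Suc(1)] flip: Suc(2)) (simp add: Q_mult_z[OF Suc(1)] flip: mult.assoc)
    then show ?case
      unfolding Z.mon_Suc[OF Suc(1), unfolded Z_mon] by (simp only: scale_mult_left scale_mult_right)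
  qed
  then have "Q * (zm r * wm s) = zm r * (Q * wm s)"
    by (simp flip: mult.assoc)
  also have "\<dots> = (\<Sum>i\<in>{1..n}. (zm r * z i) * (w i * wm s))"
    by (simp add: Q_element_def sum_distrib_left sum_distrib_right mult.assoc)
  also have "\<dots> = (\<Sum>i\<in>{1..n}. scale (inverse q ^ sum r {i<..n} * q ^ sum s {1..<i})
     (zm (r(i := Suc (r i))) * wm (s(i := Suc (s i)))))"
    by (intro sum.cong refl) (simp only: zm_simps wm_simps scale_mult_left scale_mult_right scale_scale mult.commute)
  finally show ?thesis .
qed

lemma Q_mult_A: "p \<in> A m m' \<Longrightarrow> Q * p \<in> A (Suc m) (Suc m')"
  unfolding Q_element_def sum_distrib_right
  by (intro subspace_sum subspace_A) (simp add: mult.assoc z_mult_A w_mult_A)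

end

section \<open>Derivatives and the contravariant form\<close>

locale zw_calculus = zw_relations +
  fixes D Dbar :: "nat \<Rightarrow> 'a \<Rightarrow> 'a"
  assumes z_derivs: "z_derivatives q n scale gA D" and w_derivs: "w_derivatives q n scale gA Dbar"
begin

abbreviation \<Delta> :: "'a \<Rightarrow> 'a" where "\<Delta> \<equiv> q_laplacian n D Dbar"

lemma D_linear: "i \<in> {1..n} \<Longrightarrow> Vector_Spaces.linear scale scale (D i)"
  and Dbar_linear: "i \<in> {1..n} \<Longrightarrow> Vector_Spaces.linear scale scale (Dbar i)"
  using z_derivs w_derivs unfolding z_derivatives_def w_derivatives_def by blast+

lemmas D_simps = linear_simps[OF D_linear]
lemmas Dbar_simps = linear_simps[OF Dbar_linear]

lemma D_monomial: "i \<in> {1..n} \<Longrightarrow> D i (zm r * wm s) =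
    scale (q ^ sum r {i<..n} * qint q (r i)) (zm (r(i := r i - 1)) * wm s)"
  and Dbar_monomial: "i \<in> {1..n} \<Longrightarrow> Dbar i (wm s * zm r) =
    scale (inverse q ^ sum s {i<..n} * qint q (s i)) (wm (s(i := s i - 1)) * zm r)"
  using z_derivs w_derivs unfolding z_derivatives_def w_derivatives_def by blast+

lemma D_mult:
  assumes "i \<in> {1..n}" "y \<in> span (range wm)"
  shows "D i (zm r * y) = scale (q ^ sum r {i<..n} * qint q (r i)) (zm (r(i := r i - 1)) * y)"
  by (rule linear_eq_span[OF composed_linear[OF D_linear mult_left_linear]
        scaled_linear[OF mult_left_linear] _ assms(2)])
     (use assms D_monomial in auto)

lemma Dbar_mult:
  assumes "i \<in> {1..n}" "y \<in> span (range zm)"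
  shows "Dbar i (wm s * y) =
    scale (inverse q ^ sum s {i<..n} * qint q (s i)) (wm (s(i := s i - 1)) * y)"
  by (rule linear_eq_span[OF composed_linear[OF Dbar_linear mult_left_linear]
        scaled_linear[OF mult_left_linear] _ assms(2)])
     (use assms Dbar_monomial in auto)

lemma D_A: "i \<in> {1..n} \<Longrightarrow> p \<in> A (Suc m) m' \<Longrightarrow> D i p \<in> A m m'"
proof (rule A_closed(1)[OF D_linear subspace_A(1)])
  fix r s :: "nat \<Rightarrow> nat"
  assume *: "i \<in> {1..n}" "sum r {1..n} = Suc m" "sum s {1..n} = m'"
  show "D i (zm r * wm s) \<in> A m m'"
  proof (cases "r i = 0")
    case True
    then show ?thesis using * by (simp add: D_monomial subspace_0 subspace_A)
  next
    case False
    then have "sum (r(i := r i - 1)) {1..n} = m" using * by (subst sum_pred_upd) auto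
    then show ?thesis using * monomial_in_A(1) subspace_A
      by (simp add: D_monomial subspace_scale del: fun_upd_apply)
  qed
qed

lemma Dbar_A: "i \<in> {1..n} \<Longrightarrow> p \<in> A m (Suc m') \<Longrightarrow> Dbar i p \<in> A m m'"
proof (rule A_closed(2)[OF Dbar_linear subspace_A(1), of i m "Suc m'"])
  fix r s :: "nat \<Rightarrow> nat"
  assume *: "i \<in> {1..n}" "sum r {1..n} = m" "sum s {1..n} = Suc m'"
  show "Dbar i (wm s * zm r) \<in> A m m'"
  proof (cases "s i = 0")
    case True
    then show ?thesis using * by (simp add: Dbar_monomial subspace_0 subspace_A)
  next
    case False
    then have "sum (s(i := s i - 1)) {1..n} = m'" using * by (subst sum_pred_upd) auto
    then show ?thesis using * monomial_in_A(2) subspace_A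
      by (simp add: Dbar_monomial subspace_scale del: fun_upd_apply flip: A'_eq)
  qed
qed (simp_all add: A'_eq)

lemma D_A_zero: "i \<in> {1..n} \<Longrightarrow> p \<in> A 0 m' \<Longrightarrow> D i p = 0"
  by (rule A_linear_eq(1)[OF D_linear zero_linear, of i 0 m']) (auto simp: D_monomial)

lemma Dbar_A_zero: "i \<in> {1..n} \<Longrightarrow> p \<in> A m 0 \<Longrightarrow> Dbar i p = 0"
  by (rule A_linear_eq(2)[OF Dbar_linear zero_linear, of i m 0]) (auto simp: Dbar_monomial A'_eq)

lemma \<Delta>_linear: "Vector_Spaces.linear scale scale \<Delta>"
  by unfold_locales
     (simp_all add: q_laplacian_def D_simps Dbar_simps sum.distrib scale_sum_right)

lemmas \<Delta>_simps = linear_simps[OF \<Delta>_linear]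

lemma \<Delta>_A: "p \<in> A (Suc m) (Suc m') \<Longrightarrow> \<Delta> p \<in> A m m'"
  unfolding q_laplacian_def by (intro subspace_sum subspace_A D_A Dbar_A)

lemma \<Delta>_A_zero: "p \<in> A m m' \<Longrightarrow> m = 0 \<or> m' = 0 \<Longrightarrow> \<Delta> p = 0"
proof -
  assume p: "p \<in> A m m'" "m = 0 \<or> m' = 0"
  have "D i (Dbar i p) = 0" if i: "i \<in> {1..n}" for i
  proof (cases m')
    case 0
    then show ?thesis using Dbar_A_zero[OF i] p i by (simp add: D_simps)
  next
    case (Suc d)
    then show ?thesis using p Dbar_A[OF i, of p m d] D_A_zero[OF i] by auto
  qed
  then show ?thesis by (simp add: q_laplacian_def)
qed

text \<open>Fixing the value 0 outside \<open>{1..n}\<close> makes the index set finite and gives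
  each monomial a single index.\<close>

definition idx :: "nat \<Rightarrow> (nat \<Rightarrow> nat) set" where
  "idx d = {r. (\<forall>k. k \<notin> {1..n} \<longrightarrow> r k = 0) \<and> sum r {1..n} = d}"

abbreviation bidx :: "nat \<Rightarrow> nat \<Rightarrow> ((nat \<Rightarrow> nat) \<times> (nat \<Rightarrow> nat)) set" where
  "bidx m m' \<equiv> idx m \<times> idx m'"

definition zw :: "(nat \<Rightarrow> nat) \<times> (nat \<Rightarrow> nat) \<Rightarrow> 'a" where
  "zw = (\<lambda>(r, s). zm r * wm s)"

lemma finite_idx: "finite (idx d)"
proof (rule finite_subset)
  show "idx d \<subseteq> {r. \<forall>k. (k \<in> {1..n} \<longrightarrow> r k \<in> {..d}) \<and> (k \<notin> {1..n} \<longrightarrow> r k = 0)}"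
    by (auto simp: idx_def intro: member_le_sum)
  show "finite {r::nat\<Rightarrow>nat. \<forall>k. (k \<in> {1..n} \<longrightarrow> r k \<in> {..d}) \<and> (k \<notin> {1..n} \<longrightarrow> r k = 0)}"
    by (rule finite_set_of_finite_funs) auto
qed

lemma idx_0: "idx 0 = {\<lambda>_. 0}"
  by (force simp: idx_def fun_eq_iff)

lemma idx_Suc_upd: "r \<in> idx d \<Longrightarrow> i \<in> {1..n} \<Longrightarrow> r(i := Suc (r i)) \<in> idx (Suc d)"
  unfolding idx_def mem_Collect_eq by (subst sum_Suc_upd) auto

lemma idx_pred_upd: "r \<in> idx (Suc d) \<Longrightarrow> r i > 0 \<Longrightarrow> r(i := r i - 1) \<in> idx d"
proof -
  assume r: "r \<in> idx (Suc d)" "r i > 0"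
  then have "i \<in> {1..n}" by (auto simp: idx_def)
  with r have "sum (r(i := r i - 1)) {1..n} = d"
    by (subst sum_pred_upd) (auto simp: idx_def)
  with r show ?thesis by (auto simp: idx_def)
qed

lemma idx_pos:
  assumes "r \<in> idx d" "d > 0"
  obtains i where "i \<in> {1..n}" "r i > 0"
proof -
  have "sum r {1..n} \<noteq> 0" using assms by (simp add: idx_def)
  then show ?thesis using that by (metis bot_nat_0.not_eq_extremum sum.neutral)
qed

lemma A_span: "A m m' = span (zw ` bidx m m')"
proof -
  have "zm r * wm s \<in> zw ` bidx m m'" if "sum r {1..n} = m" "sum s {1..n} = m'" for r s
  proof -
    let ?c = "\<lambda>r k. if k \<in> {1..n} then r k else (0::nat)"
    have "zm r = zm (?c r)" "wm s = wm (?c s)"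
      by (rule Z.mon_cong[unfolded Z_mon] W.mon_cong[unfolded W_mon]; simp)+
    moreover have "?c r \<in> idx m" "?c s \<in> idx m'" using that by (auto simp: idx_def)
    ultimately show ?thesis unfolding zw_def by (intro image_eqI[of _ _ "(?c r, ?c s)"]) auto
  qed
  moreover have "zw ` bidx m m' \<subseteq>
      {zm r * wm s | r s. sum r {1..n} = m \<and> sum s {1..n} = m'}"
    by (auto simp: zw_def idx_def)
  ultimately show ?thesis
    unfolding bihomogeneous_def by (intro arg_cong[where f = span]) blast
qed

lemma inj_Suc_upd: "inj (\<lambda>r :: nat \<Rightarrow> nat. r(i := Suc (r i)))"
  by (rule injI) (metis (no_types, lifting) fun_upd_idem_iff fun_upd_same fun_upd_upd nat.inject)

lemma idx_not_Suc_upd: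
  assumes "r \<in> idx (Suc d)" "r \<notin> (\<lambda>r. r(i := Suc (r i))) ` idx d"
  shows "r i = 0"
proof (rule ccontr)
  assume "r i \<noteq> 0"
  then have "r(i := r i - 1) \<in> idx d" "r = (\<lambda>r. r(i := Suc (r i))) (r(i := r i - 1))"
    using idx_pred_upd[OF assms(1)] by auto
  with assms(2) show False by blast
qed

text \<open>The existence of linear operators \<open>D\<close> and \<open>Dbar\<close> with the prescribed values on monomials
  already forces the monomials to be linearly independent: derivatives reduce any linear relation
  to a multiple of \<open>1\<close>.\<close>

lemma zw_independent:
  assumes "(\<Sum>x\<in>bidx m m'. scale (c x) (zw x)) = 0" "x \<in> bidx m m'"
  shows "c x = 0"
  using assms
proof (induction m arbitrary: c x)
  case 0
  then show ?case
  proof (induction m' arbitrary: c x)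
    case 0
    then show ?case by (simp add: idx_0 zw_def zm_simps wm_simps)
  next
    case (Suc m')
    obtain r s where x: "x = (r, s)" "r \<in> idx 0" "s \<in> idx (Suc m')" using Suc.prems(2) by auto
    obtain i where i: "i \<in> {1..n}" "s i > 0" using idx_pos[OF x(3)] by blast
    let ?up = "map_prod id (\<lambda>r :: nat \<Rightarrow> nat. r(i := Suc (r i)))"
    \<comment> \<open>In z-degree 0 the two orderings coincide, so \<open>Dbar\<close> can be
      evaluated on \<open>zw\<close> directly.\<close>
    have one: "zm r = 1" if "r \<in> idx 0" for r using that by (simp add: idx_0 zm_simps)
    have Db: "Dbar i (zw (r, s)) =
      scale (inverse q ^ sum s {i<..n} * qint q (s i)) (zw (r, s(i := s i - 1)))"
      if "r \<in> idx 0" for r s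
      using Dbar_monomial[OF i(1), of s r] one[OF that] by (simp add: zw_def)
    have "c (?up (r, s(i := s i - 1))) = 0"
    proof (rule independent_descent[OF Dbar_linear[OF i(1)], where J = "bidx 0 (Suc m')" and up = ?up
          and I = "bidx 0 m'" and b = zw and b' = zw
          and d = "\<lambda>(r, s). inverse q ^ sum s {i<..n} * qint q (Suc (s i))"])
      show "inj_on ?up (bidx 0 m')"
        using prod.inj_map[OF inj_on_id inj_Suc_upd] by (rule inj_on_subset) simp
      show "?up ` bidx 0 m' \<subseteq> bidx 0 (Suc m')" using i(1) idx_Suc_upd by auto
      show "Dbar i (zw (?up x)) = scale (case x of (r, s) \<Rightarrow>
          inverse q ^ sum s {i<..n} * qint q (Suc (s i))) (zw x)" if "x \<in> bidx 0 m'" for x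
        using that by (cases x) (auto simp: Db sum_Suc_upd simp del: fun_upd_apply, simp)
      show "(case x of (r, s) \<Rightarrow> inverse q ^ sum s {i<..n} * qint q (Suc (s i))) \<noteq> 0" for x
        using qint_nonzero[OF q_nonzero q_power] q_nonzero by (cases x) auto
      show "Dbar i (zw x) = 0" if "x \<in> bidx 0 (Suc m') - ?up ` bidx 0 m'" for x
      proof -
        obtain r s where x: "x = (r, s)" "r \<in> idx 0" "s \<in> idx (Suc m')" using \<open>x \<in> _\<close> by auto
        have "s \<notin> (\<lambda>r. r(i := Suc (r i))) ` idx m'"
          using \<open>x \<in> _\<close> x by (auto simp: image_iff)
        then have "s i = 0" using idx_not_Suc_upd[OF x(3)] by blast
        then show ?thesis using x by (simp add: Db)
      qed
      show "c x = 0" if "(\<Sum>x\<in>bidx 0 m'. scale (c x) (zw x)) = 0" "x \<in> bidx 0 m'" for c x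
        using Suc.IH that by blast
      show "(\<Sum>x\<in>bidx 0 (Suc m'). scale (c x) (zw x)) = 0" by fact
      show "(r, s(i := s i - 1)) \<in> bidx 0 m'" using x i idx_pred_upd by auto
    qed (simp add: finite_idx)
    then show ?case using i x by simp
  qed
next
  case (Suc m)
  obtain r s where x: "x = (r, s)" "r \<in> idx (Suc m)" "s \<in> idx m'" using Suc.prems(2) by auto
  obtain i where i: "i \<in> {1..n}" "r i > 0" using idx_pos[OF x(2)] by blast
  let ?up = "map_prod (\<lambda>r :: nat \<Rightarrow> nat. r(i := Suc (r i))) id"
  have Di: "D i (zw (r, s)) =
    scale (q ^ sum r {i<..n} * qint q (r i)) (zw (r(i := r i - 1), s))" for r s
    using D_monomial[OF i(1)] by (simp add: zw_def)
  have "c (?up (r(i := r i - 1), s)) = 0"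
  proof (rule independent_descent[OF D_linear[OF i(1)], where J = "bidx (Suc m) m'" and up = ?up
        and I = "bidx m m'" and b = zw and b' = zw
        and d = "\<lambda>(r, s). q ^ sum r {i<..n} * qint q (Suc (r i))"])
    show "inj_on ?up (bidx m m')"
      using prod.inj_map[OF inj_Suc_upd inj_on_id] by (rule inj_on_subset) simp
    show "?up ` bidx m m' \<subseteq> bidx (Suc m) m'" using i(1) idx_Suc_upd by auto
    show "D i (zw (?up x)) = scale (case x of (r, s) \<Rightarrow>
        q ^ sum r {i<..n} * qint q (Suc (r i))) (zw x)" if "x \<in> bidx m m'" for x
      using that by (cases x) (auto simp: Di sum_Suc_upd simp del: fun_upd_apply, simp)
    show "(case x of (r, s) \<Rightarrow> q ^ sum r {i<..n} * qint q (Suc (r i))) \<noteq> 0" for x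
      using qint_nonzero[OF q_nonzero q_power] q_nonzero by (cases x) auto
    show "D i (zw x) = 0" if "x \<in> bidx (Suc m) m' - ?up ` bidx m m'" for x
    proof -
      obtain r s where x: "x = (r, s)" "r \<in> idx (Suc m)" "s \<in> idx m'" using \<open>x \<in> _\<close> by auto
      have "r \<notin> (\<lambda>r. r(i := Suc (r i))) ` idx m"
        using \<open>x \<in> _\<close> x by (auto simp: image_iff)
      then have "r i = 0" using idx_not_Suc_upd[OF x(2)] by blast
      then show ?thesis using x by (simp add: Di)
    qed
    show "c x = 0" if "(\<Sum>x\<in>bidx m m'. scale (c x) (zw x)) = 0" "x \<in> bidx m m'" for c x
      using Suc.IH that by blast
    show "(\<Sum>x\<in>bidx (Suc m) m'. scale (c x) (zw x)) = 0" by fact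
    show "(r(i := r i - 1), s) \<in> bidx m m'" using x i idx_pred_upd by auto
  qed (simp add: finite_idx)
  then show ?case using i x by simp
qed

text \<open>This is the q-factorial of a times q^(-a(a-1)/2). The power of \<open>q\<close> solves
  the recurrence \<open>zw_norm_move_z\<close> that adjointness of \<open>E i\<close> and
  \<open>F i\<close> requires.\<close>

definition z_norm :: "nat \<Rightarrow> complex" where
  "z_norm a = (\<Prod>j<a. qint q (Suc j) * inverse q ^ j)"

text \<open>The factor depending on the position \<open>k\<close> makes up for the quotient q^2 of
  the constants \<open>- q\<close> and \<open>- inverse q\<close> with which \<open>F i\<close> and
  \<open>E i\<close> exchange neighbouring w's; see \<open>zw_norm_move_w\<close>.\<close>

definition w_norm :: "nat \<Rightarrow> nat \<Rightarrow> complex" where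
  "w_norm k a = (\<Prod>j<a. qint q (Suc j) * q ^ j * q ^ (2 * k))"

definition zw_norm :: "(nat \<Rightarrow> nat) \<times> (nat \<Rightarrow> nat) \<Rightarrow> complex" where
  "zw_norm = (\<lambda>(r, s). (\<Prod>k\<in>{1..n}. z_norm (r k)) * (\<Prod>k\<in>{1..n}. w_norm k (s k)))"

lemma zw_norm_nonzero: "zw_norm x \<noteq> 0"
  using qint_nonzero[OF q_nonzero q_power] q_nonzero
  by (cases x) (simp add: zw_norm_def z_norm_def w_norm_def)

sublocale orthogonal_family scale "bidx m m'" zw zw_norm for m m'
  by unfold_locales (use finite_idx zw_independent zw_norm_nonzero in auto)

end

section \<open>The action of the quantized enveloping algebra\<close>

text \<open>\<open>E i\<close> and \<open>F i\<close> stand for \<open>q\<^bsup>1/2\<^esup> e\<^sub>i K\<close> and \<open>q\<^bsup>-1/2\<^esup> f\<^sub>i K\<close> with \<open>K = k\<^sub>i\<^bsup>1/2\<^esup> k\<^sub>i\<^sub>+\<^sub>1\<^bsup>-1/2\<^esup>\<close>: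
  these are skew derivations with respect to \<open>K\<^sup>2\<close>, and all half-integral powers of \<open>q\<close> disappear.\<close>

locale zw_action = zw_calculus +
  fixes qh :: complex and KH KI E F :: "nat \<Rightarrow> 'a \<Rightarrow> 'a"
  assumes qh_square: "qh\<^sup>2 = q"
    and KH_linear: "\<And>i. i \<in> {1..n} \<Longrightarrow> Vector_Spaces.linear scale scale (KH i)"
    and KI_linear: "\<And>i. i \<in> {1..n} \<Longrightarrow> Vector_Spaces.linear scale scale (KI i)"
    and KH_one: "\<And>i. i \<in> {1..n} \<Longrightarrow> KH i 1 = 1"
    and KI_one: "\<And>i. i \<in> {1..n} \<Longrightarrow> KI i 1 = 1"
    and KH_mult: "\<And>i p p'. i \<in> {1..n} \<Longrightarrow> KH i (p * p') = KH i p * KH i p'"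
    and KI_mult: "\<And>i p p'. i \<in> {1..n} \<Longrightarrow> KI i (p * p') = KI i p * KI i p'"
    and KI_KH: "\<And>i p. i \<in> {1..n} \<Longrightarrow> KI i (KH i p) = p"
    and KH_z: "\<And>i j. i \<in> {1..n} \<Longrightarrow> j \<in> {1..n} \<Longrightarrow>
      KH i (gA (Zgen j)) = scale (if i = j then qh else 1) (gA (Zgen j))"
    and KH_w: "\<And>i j. i \<in> {1..n} \<Longrightarrow> j \<in> {1..n} \<Longrightarrow>
      KH i (gA (Wgen j)) = scale (if i = j then inverse qh else 1) (gA (Wgen j))"
    and E_linear: "\<And>i. i \<in> {1..<n} \<Longrightarrow> Vector_Spaces.linear scale scale (E i)"
    and F_linear: "\<And>i. i \<in> {1..<n} \<Longrightarrow> Vector_Spaces.linear scale scale (F i)"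
    and E_one: "\<And>i. i \<in> {1..<n} \<Longrightarrow> E i 1 = 0"
    and F_one: "\<And>i. i \<in> {1..<n} \<Longrightarrow> F i 1 = 0"
    and E_mult: "\<And>i p p'. i \<in> {1..<n} \<Longrightarrow> E i (p * p') = E i p * p' +
      KH i (KH i (KI (Suc i) (KI (Suc i) p))) * E i p'"
    and F_mult: "\<And>i p p'. i \<in> {1..<n} \<Longrightarrow> F i (p * p') = F i p * p' +
      KH i (KH i (KI (Suc i) (KI (Suc i) p))) * F i p'"
    and E_z: "\<And>i j. i \<in> {1..<n} \<Longrightarrow> j \<in> {1..n} \<Longrightarrow>
      E i (gA (Zgen j)) = (if j = Suc i then gA (Zgen i) else 0)"
    and E_w: "\<And>i j. i \<in> {1..<n} \<Longrightarrow> j \<in> {1..n} \<Longrightarrow>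
      E i (gA (Wgen j)) = (if j = i then scale (- inverse q) (gA (Wgen (Suc i))) else 0)"
    and F_z: "\<And>i j. i \<in> {1..<n} \<Longrightarrow> j \<in> {1..n} \<Longrightarrow>
      F i (gA (Zgen j)) = (if j = i then gA (Zgen (Suc i)) else 0)"
    and F_w: "\<And>i j. i \<in> {1..<n} \<Longrightarrow> j \<in> {1..n} \<Longrightarrow>
      F i (gA (Wgen j)) = (if j = Suc i then scale (- q) (gA (Wgen i)) else 0)"
begin

definition K2 :: "nat \<Rightarrow> 'a \<Rightarrow> 'a" where
  "K2 i p = KH i (KH i (KI (Suc i) (KI (Suc i) p)))"

lemma qh_nonzero: "qh \<noteq> 0"
  using qh_square q_nonzero by auto

lemmas KH_simps = linear_simps[OF KH_linear]
lemmas KI_simps = linear_simps[OF KI_linear]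
lemmas E_simps = linear_simps[OF E_linear]
lemmas F_simps = linear_simps[OF F_linear]

lemma KI_eigen:
  assumes "i \<in> {1..n}" "KH i p = scale d p" "d \<noteq> 0"
  shows "KI i p = scale (inverse d) p"
proof -
  have "p = scale d (KI i p)" using KI_KH[OF assms(1), of p] assms by (simp add: KI_simps)
  then have "scale (inverse d) p = scale (inverse d) (scale d (KI i p))" by simp
  then show ?thesis using assms(3) by simp
qed

lemma KI_z: "i \<in> {1..n} \<Longrightarrow> j \<in> {1..n} \<Longrightarrow> KI i (z j) = scale (if i = j then inverse qh else 1) (z j)"
  and KI_w: "i \<in> {1..n} \<Longrightarrow> j \<in> {1..n} \<Longrightarrow> KI i (w j) = scale (if i = j then qh else 1) (w j)"
  using KI_eigen[OF _ KH_z] KI_eigen[OF _ KH_w] qh_nonzero by auto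

lemma KH_monomial:
  assumes i: "i \<in> {1..n}"
  shows "KH i (zm r * wm s) = scale (qh powi (int (r i) - int (s i))) (zm r * wm s)"
proof -
  have "KH i (zm r) = scale (qh ^ r i) (zm r)"
  proof (induction r rule: multi_index_induct[where n = n])
    case (zero r)
    then have "zm r = 1" by (rule zm_simps)
    with zero i show ?case by (simp add: KH_one)
  next
    case (Suc r j)
    have "KH i (z j * zm r) = scale (qh ^ (r(j := Suc (r j))) i) (z j * zm r)"
      using i Suc by (simp add: KH_mult KH_z scale_mult_left scale_mult_right mult.commute)
    then show ?case
      unfolding Z.mon_Suc[OF Suc(1), unfolded Z_mon] using i
      by (simp add: KH_simps mult.commute)
  qed
  moreover have "KH i (wm s) = scale (inverse qh ^ s i) (wm s)"
  proof (induction s rule: multi_index_induct[where n = n])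
    case (zero s)
    then have "wm s = 1" by (rule wm_simps)
    with zero i show ?case by (simp add: KH_one)
  next
    case (Suc s j)
    have "KH i (w j * wm s) = scale (inverse qh ^ (s(j := Suc (s j))) i) (w j * wm s)"
      using i Suc by (simp add: KH_mult KH_w scale_mult_left scale_mult_right mult.commute)
    then show ?case
      unfolding W.mon_Suc[OF Suc(1), unfolded W_mon] using i
      by (simp add: KH_simps mult.commute)
  qed
  ultimately show ?thesis
    using i qh_nonzero by (simp add: KH_mult scale_mult_left scale_mult_right power_int_diff
        field_simps)
qed

lemma KI_monomial:
  assumes i: "i \<in> {1..n}"
  shows "KI i (zm r * wm s) = scale (inverse (qh powi (int (r i) - int (s i)))) (zm r * wm s)"
  by (rule KI_eigen[OF i KH_monomial[OF i]]) (use qh_nonzero in simp)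

lemma KH_A: "i \<in> {1..n} \<Longrightarrow> p \<in> A m m' \<Longrightarrow> KH i p \<in> A m m'"
  and KI_A: "i \<in> {1..n} \<Longrightarrow> p \<in> A m m' \<Longrightarrow> KI i p \<in> A m m'"
  by (erule A_closed(1)[OF KH_linear subspace_A(1), rotated 2] A_closed(1)[OF KI_linear subspace_A(1), rotated 2];
      simp add: KH_monomial KI_monomial subspace_scale subspace_A monomial_in_A)+

lemma Suc_range: "i \<in> {1..<n} \<Longrightarrow> i \<in> {1..n}" "i \<in> {1..<n} \<Longrightarrow> Suc i \<in> {1..n}"
  by auto

lemma K2_linear: "i \<in> {1..<n} \<Longrightarrow> Vector_Spaces.linear scale scale (K2 i)"
  unfolding K2_def
  by (rule composed_linear[OF KH_linear composed_linear[OF KH_linear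
        composed_linear[OF KI_linear KI_linear]]]) auto

lemma skew_z:
  assumes i: "i \<in> {1..<n}" and T: "T = E i \<or> T = F i"
  shows "skew_derivation scale (inverse q) n z i T (K2 i)"
proof -
  have "K2 i (z j) = scale (if j = i then inverse (inverse q) else if j = Suc i then inverse q else 1) (z j)" if "j \<in> {1..n}" for j
    using qh_nonzero that Suc_range[OF i]
    by (simp add: K2_def KH_z KI_z KH_simps KI_simps flip: qh_square) (auto simp: power2_eq_square)
  then show ?thesis
    using i T Suc_range[OF i] K2_linear[OF i] Z.q_symmetric_axioms
    unfolding skew_derivation_def skew_derivation_axioms_def
    by (auto simp: E_linear F_linear E_one F_one E_mult F_mult KH_one KI_one KH_mult KI_mult K2_def)
qed

lemma skew_w:
  assumes i: "i \<in> {1..<n}" and T: "T = E i \<or> T = F i"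
  shows "skew_derivation scale q n w i T (K2 i)"
proof -
  have "K2 i (w j) = scale (if j = i then inverse q else if j = Suc i then q else 1) (w j)" if "j \<in> {1..n}" for j
    using qh_nonzero that Suc_range[OF i]
    by (simp add: K2_def KH_w KI_w KH_simps KI_simps flip: qh_square) (auto simp: power2_eq_square)
  then show ?thesis
    using i T Suc_range[OF i] K2_linear[OF i] W.q_symmetric_axioms
    unfolding skew_derivation_def skew_derivation_axioms_def
    by (auto simp: E_linear F_linear E_one F_one E_mult F_mult KH_one KI_one KH_mult KI_mult K2_def)
qed

lemma E_z_raising: "i \<in> {1..<n} \<Longrightarrow> raising_derivation scale (inverse q) n z i (E i) (K2 i) 1"
  using skew_z[of i "E i"] by (auto simp: raising_derivation_def raising_derivation_axioms_def E_z)

lemma F_z_lowering: "i \<in> {1..<n} \<Longrightarrow> lowering_derivation scale (inverse q) n z i (F i) (K2 i) 1"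
  using skew_z[of i "F i"] by (auto simp: lowering_derivation_def lowering_derivation_axioms_def F_z)

text \<open>On the w's the roles are exchanged: they carry the dual action, so \<open>E i\<close>
  increases the index there and \<open>F i\<close> decreases it.\<close>

lemma E_w_lowering: "i \<in> {1..<n} \<Longrightarrow> lowering_derivation scale q n w i (E i) (K2 i) (- inverse q)"
  using skew_w[of i "E i"] by (auto simp: lowering_derivation_def lowering_derivation_axioms_def E_w)

lemma F_w_raising: "i \<in> {1..<n} \<Longrightarrow> raising_derivation scale q n w i (F i) (K2 i) (- q)"
  using skew_w[of i "F i"] by (auto simp: raising_derivation_def raising_derivation_axioms_def F_w)

lemmas K2_zm = skew_derivation.\<kappa>_mon[OF skew_z, unfolded Z_mon]

definition E_coeff_z :: "nat \<Rightarrow> (nat \<Rightarrow> nat) \<Rightarrow> complex" where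
  "E_coeff_z i r = q powi (int (r i) - int (r (Suc i)) + 1) * qint q (r (Suc i))"

text \<open>The dependence on \<open>r\<close> comes from \<open>K2 i\<close>, which acts on the z
  part before \<open>E i\<close> reaches the w part.\<close>

definition E_coeff_w :: "nat \<Rightarrow> (nat \<Rightarrow> nat) \<Rightarrow> (nat \<Rightarrow> nat) \<Rightarrow> complex" where
  "E_coeff_w i r s = - (q powi (int (r i) - int (r (Suc i)) - 1) * qint q (s i))"

definition F_coeff_w :: "nat \<Rightarrow> (nat \<Rightarrow> nat) \<Rightarrow> (nat \<Rightarrow> nat) \<Rightarrow> complex" where
  "F_coeff_w i r s =
    - (q powi (int (r i) - int (r (Suc i)) + int (s (Suc i)) - int (s i)) * qint q (s (Suc i)))"

lemma E_monomial:
  assumes i: "i \<in> {1..<n}"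
  shows "E i (zm r * wm s) = scale (E_coeff_z i r) (zm (move (Suc i) i r) * wm s) +
    scale (E_coeff_w i r s) (zm r * wm (move i (Suc i) s))"
  using raising_derivation.T_mon[OF E_z_raising[OF i], of r]
    lowering_derivation.T_mon[OF E_w_lowering[OF i], of s] K2_zm[OF i, of "E i" r]
    q_nonzero
  by (simp add: E_mult[OF i, folded K2_def] Z_mon W_mon scale_mult_left scale_mult_right
      E_coeff_z_def E_coeff_w_def qint_inverse qint_inverse[unfolded inverse_eq_divide] power_int_diff power_int_add power_int_inverse field_simps)

lemma F_monomial:
  assumes i: "i \<in> {1..<n}"
  shows "F i (zm r * wm s) = scale (qint q (r i)) (zm (move i (Suc i) r) * wm s) +
    scale (F_coeff_w i r s) (zm r * wm (move (Suc i) i s))"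
  using lowering_derivation.T_mon[OF F_z_lowering[OF i], of r]
    raising_derivation.T_mon[OF F_w_raising[OF i], of s] K2_zm[OF i, of "F i" r]
    q_nonzero
  by (simp add: F_mult[OF i, folded K2_def] Z_mon W_mon scale_mult_left scale_mult_right
      F_coeff_w_def qint_inverse qint_inverse[unfolded inverse_eq_divide] power_int_diff power_int_add power_int_inverse field_simps)

lemma move_sum:
  assumes "i \<in> {1..n}" "j \<in> {1..n}" "i \<noteq> j" "r i > 0"
  shows "sum (move i j r) {1..n} = sum r {1..n}"
  using assms by (subst sum_move) auto

lemma zw_in_A: "x \<in> bidx m m' \<Longrightarrow> zw x \<in> A m m'"
  unfolding A_span by (rule span_base) (rule imageI)

lemma idx_move:
  assumes "r \<in> idx d" "i \<in> {1..n}" "j \<in> {1..n}" "i \<noteq> j" "r i > 0"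
  shows "move i j r \<in> idx d"
  using assms move_sum[of i j r, OF assms(2-5)] by (auto simp: idx_def move_def)

text \<open>A move leaves the index set only when its source entry is 0, and then the q-integer in
  the coefficient vanishes.\<close>

lemma term_index:
  assumes "i \<in> {1..<n}" "r \<in> idx m" "s \<in> idx m'"
  shows "E_coeff_z i r = 0 \<or> (move (Suc i) i r, s) \<in> bidx m m'"
    and "E_coeff_w i r s = 0 \<or> (r, move i (Suc i) s) \<in> bidx m m'"
    and "qint q (r i) = 0 \<or> (move i (Suc i) r, s) \<in> bidx m m'"
    and "F_coeff_w i r s = 0 \<or> (r, move (Suc i) i s) \<in> bidx m m'"
proof -
  show "E_coeff_z i r = 0 \<or> (move (Suc i) i r, s) \<in> bidx m m'"
    using assms by (cases "r (Suc i) = 0") (auto simp: E_coeff_z_def intro!: idx_move)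
  show "E_coeff_w i r s = 0 \<or> (r, move i (Suc i) s) \<in> bidx m m'"
    using assms by (cases "s i = 0") (auto simp: E_coeff_w_def intro!: idx_move)
  show "qint q (r i) = 0 \<or> (move i (Suc i) r, s) \<in> bidx m m'"
    using assms by (cases "r i = 0") (auto intro!: idx_move)
  show "F_coeff_w i r s = 0 \<or> (r, move (Suc i) i s) \<in> bidx m m'"
    using assms by (cases "s (Suc i) = 0") (auto simp: F_coeff_w_def intro!: idx_move)
qed

lemma scale_zw_in_A: "c = 0 \<or> x \<in> bidx m m' \<Longrightarrow> scale c (zw x) \<in> A m m'"
  using zw_in_A by (auto simp: subspace_0 subspace_scale subspace_A)

lemmas term_in_A = term_index[THEN scale_zw_in_A]

lemma E_zw: "i \<in> {1..<n} \<Longrightarrow> E i (zw (r, s)) = scale (E_coeff_z i r) (zw (move (Suc i) i r, s)) +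
    scale (E_coeff_w i r s) (zw (r, move i (Suc i) s))"
  and F_zw: "i \<in> {1..<n} \<Longrightarrow> F i (zw (r, s)) = scale (qint q (r i)) (zw (move i (Suc i) r, s)) +
    scale (F_coeff_w i r s) (zw (r, move (Suc i) i s))"
  by (simp_all add: zw_def E_monomial F_monomial)

lemma E_A: "i \<in> {1..<n} \<Longrightarrow> p \<in> A m m' \<Longrightarrow> E i p \<in> A m m'"
  unfolding A_span[of m m']
  by (erule linear_span_subset[OF E_linear subspace_span, rotated 2])
     (auto simp: E_zw A_span[symmetric] intro!: subspace_add subspace_A term_in_A)

lemma F_A: "i \<in> {1..<n} \<Longrightarrow> p \<in> A m m' \<Longrightarrow> F i p \<in> A m m'"
  unfolding A_span[of m m']
  by (erule linear_span_subset[OF F_linear subspace_span, rotated 2])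
     (auto simp: F_zw A_span[symmetric] intro!: subspace_add subspace_A term_in_A)

section \<open>Commutation of the derivatives and the Laplacian with the action\<close>

lemma T_span_zm:
  "i \<in> {1..<n} \<Longrightarrow> y \<in> span (range zm) \<Longrightarrow> E i y \<in> span (range zm)"
  "i \<in> {1..<n} \<Longrightarrow> y \<in> span (range zm) \<Longrightarrow> F i y \<in> span (range zm)"
  by (erule linear_span_subset[OF E_linear subspace_span, rotated 2]
        linear_span_subset[OF F_linear subspace_span, rotated 2];
      auto simp: raising_derivation.T_mon[OF E_z_raising, unfolded Z_mon]
        lowering_derivation.T_mon[OF F_z_lowering, unfolded Z_mon] span_scale span_base span_neg)+

lemma T_span_wm:
  "i \<in> {1..<n} \<Longrightarrow> y \<in> span (range wm) \<Longrightarrow> E i y \<in> span (range wm)"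
  "i \<in> {1..<n} \<Longrightarrow> y \<in> span (range wm) \<Longrightarrow> F i y \<in> span (range wm)"
  by (erule linear_span_subset[OF E_linear subspace_span, rotated 2]
        linear_span_subset[OF F_linear subspace_span, rotated 2];
      auto simp: lowering_derivation.T_mon[OF E_w_lowering, unfolded W_mon]
        raising_derivation.T_mon[OF F_w_raising, unfolded W_mon] span_scale span_base span_neg)+

lemma D_E:
  assumes i: "i \<in> {1..<n}" and k: "k \<in> {1..n}" and p: "p \<in> A m m'"
  shows "D k (E i p) = scale (if k = i then q else if k = Suc i then inverse q else 1) (E i (D k p)) +
    (if k = i then D (Suc i) p else 0)"
proof (rule A_linear_eq(1)[OF composed_linear[OF D_linear E_linear]
      added_linear[OF scaled_linear[OF composed_linear[OF E_linear D_linear]] if_linear[OF D_linear]] _ p])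
  fix r s :: "nat \<Rightarrow> nat"
  show "D k (E i (zm r * wm s)) =
      scale (if k = i then q else if k = Suc i then inverse q else 1) (E i (D k (zm r * wm s))) +
      (if k = i then D (Suc i) (zm r * wm s) else 0)"
    using raising_derivation.partial_derivative_T[OF E_z_raising[OF i], of D k "span (range wm)" "wm s" r]
      D_linear Suc_range[OF i] k T_span_wm i D_mult
    by (simp add: Z_mon qint_inverse span_base)
qed (use i k Suc_range[OF i] in auto)

lemma D_F:
  assumes i: "i \<in> {1..<n}" and k: "k \<in> {1..n}" and p: "p \<in> A m m'"
  shows "D k (F i p) = scale (if k = i then q else if k = Suc i then inverse q else 1) (F i (D k p)) +
    (if k = Suc i then D i p else 0)"
proof (rule A_linear_eq(1)[OF composed_linear[OF D_linear F_linear]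
      added_linear[OF scaled_linear[OF composed_linear[OF F_linear D_linear]] if_linear[OF D_linear]] _ p])
  fix r s :: "nat \<Rightarrow> nat"
  show "D k (F i (zm r * wm s)) =
      scale (if k = i then q else if k = Suc i then inverse q else 1) (F i (D k (zm r * wm s))) +
      (if k = Suc i then D i (zm r * wm s) else 0)"
    using lowering_derivation.partial_derivative_T[OF F_z_lowering[OF i], of D k "span (range wm)" "wm s" r]
      D_linear Suc_range[OF i] k T_span_wm i D_mult
    by (simp add: Z_mon qint_inverse span_base)
qed (use i k Suc_range[OF i] in auto)

lemma Dbar_E:
  assumes i: "i \<in> {1..<n}" and k: "k \<in> {1..n}" and p: "p \<in> A m m'"
  shows "Dbar k (E i p) = scale (if k = i then inverse q else if k = Suc i then q else 1) (E i (Dbar k p)) +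
    (if k = Suc i then scale (- inverse q) (Dbar i p) else 0)"
proof (rule A_linear_eq(2)[OF composed_linear[OF Dbar_linear E_linear]
      added_linear[OF scaled_linear[OF composed_linear[OF E_linear Dbar_linear]] if_linear[OF scaled_linear[OF Dbar_linear]]] _ p[folded A'_eq]])
  fix r s :: "nat \<Rightarrow> nat"
  show "Dbar k (E i (wm s * zm r)) =
      scale (if k = i then inverse q else if k = Suc i then q else 1) (E i (Dbar k (wm s * zm r))) +
      (if k = Suc i then scale (- inverse q) (Dbar i (wm s * zm r)) else 0)"
    using lowering_derivation.partial_derivative_T[OF E_w_lowering[OF i], of Dbar k "span (range zm)" "zm r" s]
      Dbar_linear Suc_range[OF i] k T_span_zm i Dbar_mult
    by (simp add: W_mon span_base)
qed (use i k Suc_range[OF i] in auto)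

lemma Dbar_F:
  assumes i: "i \<in> {1..<n}" and k: "k \<in> {1..n}" and p: "p \<in> A m m'"
  shows "Dbar k (F i p) = scale (if k = i then inverse q else if k = Suc i then q else 1) (F i (Dbar k p)) +
    (if k = i then scale (- q) (Dbar (Suc i) p) else 0)"
proof (rule A_linear_eq(2)[OF composed_linear[OF Dbar_linear F_linear]
      added_linear[OF scaled_linear[OF composed_linear[OF F_linear Dbar_linear]] if_linear[OF scaled_linear[OF Dbar_linear]]] _ p[folded A'_eq]])
  fix r s :: "nat \<Rightarrow> nat"
  show "Dbar k (F i (wm s * zm r)) =
      scale (if k = i then inverse q else if k = Suc i then q else 1) (F i (Dbar k (wm s * zm r))) +
      (if k = i then scale (- q) (Dbar (Suc i) (wm s * zm r)) else 0)"
    using raising_derivation.partial_derivative_T[OF F_w_raising[OF i], of Dbar k "span (range zm)" "zm r" s]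
      Dbar_linear Suc_range[OF i] k T_span_zm i Dbar_mult
    by (simp add: W_mon span_base)
qed (use i k Suc_range[OF i] in auto)

text \<open>For \<open>m' = 0\<close> the truncated degree is harmless, because then
  \<open>Dbar k p = 0\<close>.\<close>

lemma Dbar_in_A: "k \<in> {1..n} \<Longrightarrow> p \<in> A m m' \<Longrightarrow> Dbar k p \<in> A m (m' - 1)"
  using Dbar_A[of k p m "m' - 1"] Dbar_A_zero[of k p m] by (cases m') (auto simp: subspace_0 subspace_A)

text \<open>The twists of \<open>D k\<close> and \<open>Dbar k\<close> are inverse to each other.
  The additional summands at \<open>k = i\<close> and \<open>k = Suc i\<close> are opposite
  multiples of one element and cancel.\<close>

lemma \<Delta>_E:
  assumes i: "i \<in> {1..<n}" and p: "p \<in> A m m'"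
  shows "\<Delta> (E i p) = E i (\<Delta> p)"
proof -
  let ?u = "D (Suc i) (Dbar i p)"
  have "D k (Dbar k (E i p)) = E i (D k (Dbar k p)) + (if k = i then scale (inverse q) ?u else 0) +
      (if k = Suc i then scale (- inverse q) ?u else 0)" if k: "k \<in> {1..n}" for k
    using D_E[OF i k Dbar_in_A[OF k p]] q_nonzero k i Suc_range[OF i]
    by (auto simp: Dbar_E[OF i k p] D_simps scale_right_distrib)
  then show ?thesis using i Suc_range[OF i]
    by (simp add: q_laplacian_def sum.distrib E_simps[OF i])
qed

lemma \<Delta>_F:
  assumes i: "i \<in> {1..<n}" and p: "p \<in> A m m'"
  shows "\<Delta> (F i p) = F i (\<Delta> p)"
proof -
  let ?u = "D i (Dbar (Suc i) p)"
  have "D k (Dbar k (F i p)) = F i (D k (Dbar k p)) + (if k = i then scale (- q) ?u else 0) +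
      (if k = Suc i then scale q ?u else 0)" if k: "k \<in> {1..n}" for k
    using D_F[OF i k Dbar_in_A[OF k p]] q_nonzero k i Suc_range[OF i]
    by (auto simp: Dbar_F[OF i k p] D_simps scale_right_distrib)
  then show ?thesis using i Suc_range[OF i]
    by (simp add: q_laplacian_def sum.distrib F_simps[OF i])
qed

section \<open>Invariance of the central element\<close>

lemma KH_Q: "i \<in> {1..n} \<Longrightarrow> KH i Q = Q" and KI_Q: "i \<in> {1..n} \<Longrightarrow> KI i Q = Q"
proof -
  have "KH i (z j * w j) = z j * w j" "KI i (z j * w j) = z j * w j"
    if "i \<in> {1..n}" "j \<in> {1..n}" for j
    using that qh_nonzero
    by (simp_all add: KH_mult KI_mult KH_z KH_w KI_z KI_w scale_mult_left scale_mult_right)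
  then show "i \<in> {1..n} \<Longrightarrow> KH i Q = Q" "i \<in> {1..n} \<Longrightarrow> KI i Q = Q"
    by (simp_all add: Q_element_def KH_simps KI_simps)
qed

lemma E_Q: assumes i: "i \<in> {1..<n}" shows "E i Q = 0"
proof -
  have "E i (z j * w j) = (if j = Suc i then z i * w (Suc i) else 0) -
      (if j = i then z i * w (Suc i) else 0)" if j: "j \<in> {1..n}" for j
    using q_nonzero
    by (auto simp: E_mult[OF i, folded K2_def] E_z[OF i j] E_w[OF i j] scale_mult_right scale_mult_left
        skew_derivation.\<kappa>_x[OF skew_z[OF i, of "E i"] j])
  then show ?thesis using i Suc_range[OF i]
    by (simp add: Q_element_def E_simps[OF i] sum_subtractf)
qed

lemma F_Q: assumes i: "i \<in> {1..<n}" shows "F i Q = 0"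
proof -
  have "F i (z j * w j) = (if j = i then z (Suc i) * w i else 0) -
      (if j = Suc i then z (Suc i) * w i else 0)" if j: "j \<in> {1..n}" for j
    using q_nonzero
    by (auto simp: F_mult[OF i, folded K2_def] F_z[OF i j] F_w[OF i j] scale_mult_right scale_mult_left
        skew_derivation.\<kappa>_x[OF skew_z[OF i, of "F i"] j])
  then show ?thesis using i Suc_range[OF i]
    by (simp add: Q_element_def F_simps[OF i] sum_subtractf)
qed

lemma Q_commute:
  "i \<in> {1..n} \<Longrightarrow> KH i (Q * p) = Q * KH i p"
  "i \<in> {1..n} \<Longrightarrow> KI i (Q * p) = Q * KI i p"
  "i \<in> {1..<n} \<Longrightarrow> E i (Q * p) = Q * E i p"
  "i \<in> {1..<n} \<Longrightarrow> F i (Q * p) = Q * F i p"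
  by (simp_all add: KH_mult KI_mult E_mult F_mult KH_Q KI_Q E_Q F_Q)


section \<open>Adjointness of the action with respect to the form\<close>

lemmas form_A_right = form_add_right[folded A_span] form_scale_right[folded A_span]
  form_diff_right[folded A_span] form_zero_right
lemmas form_A_sum_right = form_sum_right[folded A_span]
lemmas form_A_nondegenerate = form_nondegenerate[folded A_span]

lemma form_A_left:
  "p \<in> A m m' \<Longrightarrow> p' \<in> A m m' \<Longrightarrow> form m m' (p + p') t = form m m' p t + form m m' p' t"
  "p \<in> A m m' \<Longrightarrow> form m m' (scale c p) t = c * form m m' p t"
  "form m m' 0 t = 0"
  by (simp_all add: form_commute[of _ _ _ t] form_A_right)

lemma A_induct [consumes 1, case_names zero add]:
  assumes "p \<in> A m m'" and "P 0"
    and "\<And>c x u. x \<in> bidx m m' \<Longrightarrow> u \<in> A m m' \<Longrightarrow> P u \<Longrightarrow> P (scale c (zw x) + u)"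
  shows "P p"
proof -
  have "p \<in> A m m' \<and> P p"
    using assms(1) unfolding A_span[of m m']
  proof (induction rule: span_induct_alt)
    case base
    show ?case using assms(2) by (simp add: span_zero)
  next
    case (step c v u)
    then show ?case using assms(3)[unfolded A_span]
      by (auto intro!: span_add span_scale intro: span_base)
  qed
  then show ?thesis by blast
qed

lemma form_adjoint:
  assumes f: "Vector_Spaces.linear scale scale f" "\<And>p. p \<in> A m m' \<Longrightarrow> f p \<in> A l l'"
    and g: "Vector_Spaces.linear scale scale g" "\<And>t. t \<in> A l l' \<Longrightarrow> g t \<in> A m m'"
    and basis: "\<And>x y. x \<in> bidx m m' \<Longrightarrow> y \<in> bidx l l' \<Longrightarrow>
      form l l' (f (zw x)) (zw y) = \<kappa> * form m m' (zw x) (g (zw y))"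
    and p: "p \<in> A m m'" and t: "t \<in> A l l'"
  shows "form l l' (f p) t = \<kappa> * form m m' p (g t)"
proof -
  have *: "form l l' (f (zw x)) t = \<kappa> * form m m' (zw x) (g t)" if x: "x \<in> bidx m m'" for x
    using t
  proof (induction rule: A_induct)
    case zero
    show ?case by (simp add: form_A_right linear_simps[OF g(1)])
  next
    case (add c y u)
    then show ?case using basis[OF x] g(2) zw_in_A
      by (simp add: form_A_right linear_simps[OF g(1)] subspace_scale subspace_A algebra_simps)
  qed
  show ?thesis
    using p
  proof (induction rule: A_induct)
    case zero
    show ?case by (simp add: form_A_left linear_simps[OF f(1)])
  next
    case (add c x u)
    then show ?case using * f(2) zw_in_A
      by (simp add: form_A_left linear_simps[OF f(1)] subspace_scale subspace_A algebra_simps)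
  qed
qed

lemma prod_two:
  assumes "i \<in> {1..<n}"
  shows "prod g {1..n} = g i * g (Suc i) * prod g ({1..n} - {i, Suc i})"
proof -
  have "{1..n} = insert i (insert (Suc i) ({1..n} - {i, Suc i}))" using assms by auto
  then have "prod g {1..n} = prod g (insert i (insert (Suc i) ({1..n} - {i, Suc i})))" by simp
  also have "\<dots> = g i * g (Suc i) * prod g ({1..n} - {i, Suc i})" by (simp add: mult.assoc)
  finally show ?thesis .
qed

lemma norm_Suc:
  "z_norm (Suc a) = z_norm a * (qint q (Suc a) * inverse q ^ a)"
  "w_norm k (Suc a) = w_norm k a * (qint q (Suc a) * q ^ a * q ^ (2 * k))"
  by (simp_all add: z_norm_def w_norm_def)

lemma zw_norm_move_z:
  assumes i: "i \<in> {1..<n}" and r: "r (Suc i) > 0"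
  shows "E_coeff_z i r * zw_norm (move (Suc i) i r, s) = qint q (Suc (r i)) * zw_norm (r, s)"
proof -
  obtain b where b: "r (Suc i) = Suc b" using r by (cases "r (Suc i)") auto
  have m: "move (Suc i) i r i = Suc (r i)" "move (Suc i) i r (Suc i) = b"
    using b by (simp_all add: move_def)
  have "(\<Prod>k\<in>{1..n} - {i, Suc i}. z_norm (move (Suc i) i r k)) =
      (\<Prod>k\<in>{1..n} - {i, Suc i}. z_norm (r k))"
    by (rule prod.cong) (auto simp: move_def)
  then show ?thesis
    unfolding zw_norm_def prod.case prod_two[OF i, of "\<lambda>k. z_norm (move (Suc i) i r k)"]
      prod_two[OF i, of "\<lambda>k. z_norm (r k)"] m E_coeff_z_def b norm_Suc
    using q_nonzero by (simp add: power_int_diff power_int_add field_simps)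
qed

lemma zw_norm_move_w:
  assumes i: "i \<in> {1..<n}" and s: "s i > 0"
  shows "E_coeff_w i r s * zw_norm (r, move i (Suc i) s) =
    F_coeff_w i r (move i (Suc i) s) * zw_norm (r, s)"
proof -
  obtain a where a: "s i = Suc a" using s by (cases "s i") auto
  have m: "move i (Suc i) s i = a" "move i (Suc i) s (Suc i) = Suc (s (Suc i))"
    using a by (simp_all add: move_def)
  have "(\<Prod>k\<in>{1..n} - {i, Suc i}. w_norm k (move i (Suc i) s k)) =
      (\<Prod>k\<in>{1..n} - {i, Suc i}. w_norm k (s k))"
    by (rule prod.cong) (auto simp: move_def)
  then show ?thesis
    unfolding zw_norm_def prod.case prod_two[OF i, of "\<lambda>k. w_norm k (move i (Suc i) s k)"]
      prod_two[OF i, of "\<lambda>k. w_norm k (s k)"] m E_coeff_w_def F_coeff_w_def a norm_Suc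
    using q_nonzero by (simp add: power_int_diff power_int_add power_add power2_eq_square field_simps)
qed

lemma move_inverse: "i \<noteq> j \<Longrightarrow> r i > 0 \<Longrightarrow> move j i (move i j r) = r"
  by (auto simp: move_def fun_eq_iff)

lemma move_target: "move i j r j > 0"
  by (simp add: move_def)

lemma form_scale_zw:
  assumes "c = 0 \<or> x \<in> bidx m m'"
  shows "form m m' p (scale c (zw x)) = c * form m m' p (zw x)"
    and "form m m' (scale c (zw x)) p = c * form m m' (zw x) p"
  using assms zw_in_A by (auto simp: form_A_right form_A_left)

lemma form_F_zw:
  assumes "i \<in> {1..<n}" "r \<in> idx m" "s \<in> idx m'"
  shows "form m m' p (F i (zw (r, s))) =
    qint q (r i) * form m m' p (zw (move i (Suc i) r, s)) +
    F_coeff_w i r s * form m m' p (zw (r, move (Suc i) i s))"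
  by (simp only: F_zw[OF assms(1)] form_A_right(1)[OF term_in_A(3,4)[OF assms]]
      form_scale_zw[OF term_index(3)[OF assms]] form_scale_zw[OF term_index(4)[OF assms]])

lemma form_E_zw:
  assumes "i \<in> {1..<n}" "r \<in> idx m" "s \<in> idx m'"
  shows "form m m' (E i (zw (r, s))) p =
    E_coeff_z i r * form m m' (zw (move (Suc i) i r, s)) p +
    E_coeff_w i r s * form m m' (zw (r, move i (Suc i) s)) p"
  by (simp only: E_zw[OF assms(1)] form_A_left(1)[OF term_in_A(1,2)[OF assms]]
      form_scale_zw[OF term_index(1)[OF assms]] form_scale_zw[OF term_index(2)[OF assms]])

text \<open>The z and w moves are compared separately on basis vectors. By orthogonality both sides
  vanish unless one index arises from the other by the move in question, and then the two norm
  recurrences give equality.\<close>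

lemma form_E_F:
  assumes i: "i \<in> {1..<n}" and "p \<in> A m m'" "t \<in> A m m'"
  shows "form m m' (E i p) t = form m m' p (F i t)"
proof -
  have "form m m' (E i p) t = 1 * form m m' p (F i t)"
  proof (rule form_adjoint[OF E_linear[OF i] E_A[OF i] F_linear[OF i] F_A[OF i] _ assms(2,3)])
    fix x y assume xy: "x \<in> bidx m m'" "y \<in> bidx m m'"
    obtain r s r' s' where x: "x = (r, s)" and y: "y = (r', s')" by (cases x, cases y) auto
    have in_idx: "r \<in> idx m" "s \<in> idx m'" "r' \<in> idx m" "s' \<in> idx m'" using xy x y by auto
    note i' = Suc_range[OF i]
    have "E_coeff_z i r * form m m' (zw (move (Suc i) i r, s)) (zw (r', s')) =
        qint q (r' i) * form m m' (zw (r, s)) (zw (move i (Suc i) r', s'))"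
    proof -
      \<comment> \<open>A move can be undone only if its source is positive. When just one of the
        two sources is, the zero entry of the other index rules out a match, since the target of a
        move is positive.\<close>
      consider "r (Suc i) = 0" "r' i = 0" | "r (Suc i) = 0" "r' i > 0" |
        "r (Suc i) > 0" "r' i = 0" | "r (Suc i) > 0" "r' i > 0" by blast
      then show ?thesis
      proof cases
        case 1
        then show ?thesis by (simp add: E_coeff_z_def)
      next
        case 2
        then have "r \<noteq> move i (Suc i) r'" using move_target[of i "Suc i" r'] by auto
        moreover have "move i (Suc i) r' \<in> idx m" using 2 in_idx i' by (intro idx_move) auto
        ultimately show ?thesis using 2 in_idx by (simp add: E_coeff_z_def form_basis)
      next
        case 3
        then have "r' \<noteq> move (Suc i) i r" using move_target[of "Suc i" i r] by auto
        moreover have "move (Suc i) i r \<in> idx m" using 3 in_idx i' by (intro idx_move) auto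
        ultimately show ?thesis using 3 in_idx by (auto simp: form_basis)
      next
        case 4
        have "move i (Suc i) r' \<in> idx m" "move (Suc i) i r \<in> idx m"
          using 4 in_idx i' by (auto intro!: idx_move)
        moreover have "move (Suc i) i r = r' \<longleftrightarrow> r = move i (Suc i) r'"
          using move_inverse[of "Suc i" i r] move_inverse[of i "Suc i" r'] 4 by auto
        moreover have "r' i = Suc (r i)" if "move (Suc i) i r = r'"
          using that by (auto simp: move_def)
        ultimately show ?thesis using in_idx zw_norm_move_z[of i r s] 4 i
          by (auto simp: form_basis)
      qed
    qed
    moreover have "E_coeff_w i r s * form m m' (zw (r, move i (Suc i) s)) (zw (r', s')) =
        F_coeff_w i r' s' * form m m' (zw (r, s)) (zw (r', move (Suc i) i s'))"
    proof -
      consider "s i = 0" "s' (Suc i) = 0" | "s i = 0" "s' (Suc i) > 0" |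
        "s i > 0" "s' (Suc i) = 0" | "s i > 0" "s' (Suc i) > 0" by blast
      then show ?thesis
      proof cases
        case 1
        then show ?thesis by (simp add: E_coeff_w_def F_coeff_w_def)
      next
        case 2
        then have "s \<noteq> move (Suc i) i s'" using move_target[of "Suc i" i s'] by auto
        moreover have "move (Suc i) i s' \<in> idx m'" using 2 in_idx i' by (intro idx_move) auto
        ultimately show ?thesis using 2 in_idx by (simp add: E_coeff_w_def form_basis)
      next
        case 3
        then have "s' \<noteq> move i (Suc i) s" using move_target[of i "Suc i" s] by auto
        moreover have "move i (Suc i) s \<in> idx m'" using 3 in_idx i' by (intro idx_move) auto
        ultimately show ?thesis using 3 in_idx by (auto simp: form_basis F_coeff_w_def)
      next
        case 4
        have "move (Suc i) i s' \<in> idx m'" "move i (Suc i) s \<in> idx m'"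
          using 4 in_idx i' by (auto intro!: idx_move)
        moreover have "move i (Suc i) s = s' \<longleftrightarrow> s = move (Suc i) i s'"
          using move_inverse[of i "Suc i" s] move_inverse[of "Suc i" i s'] 4 by auto
        ultimately show ?thesis using in_idx zw_norm_move_w[of i s r] 4 i
          by (auto simp: form_basis)
      qed
    qed
    ultimately show "form m m' (E i (zw x)) (zw y) = 1 * form m m' (zw x) (F i (zw y))"
      unfolding x y form_E_zw[OF i in_idx(1,2)] form_F_zw[OF i in_idx(3,4)] by simp
  qed
  then show ?thesis by simp
qed

lemma form_F_E:
  assumes "i \<in> {1..<n}" "p \<in> A m m'" "t \<in> A m m'"
  shows "form m m' (F i p) t = form m m' p (E i t)"
  using form_E_F[OF assms(1,3,2)] by (simp add: form_commute)

lemma form_KH: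
  assumes i: "i \<in> {1..n}" and "p \<in> A m m'" "t \<in> A m m'"
  shows "form m m' (KH i p) t = form m m' p (KH i t)"
    and "form m m' (KI i p) t = form m m' p (KI i t)"
proof -
  have *: "KH i (zw x) = scale (qh powi (int (fst x i) - int (snd x i))) (zw x)"
    "KI i (zw x) = scale (inverse (qh powi (int (fst x i) - int (snd x i)))) (zw x)" for x
    using KH_monomial[OF i] KI_monomial[OF i] by (cases x; simp add: zw_def)+
  have "form m m' (KH i p) t = 1 * form m m' p (KH i t)"
    by (rule form_adjoint[OF KH_linear[OF i] KH_A[OF i] KH_linear[OF i] KH_A[OF i] _ assms(2,3)])
       (simp_all add: * form_A_left form_A_right zw_in_A form_basis)
  moreover have "form m m' (KI i p) t = 1 * form m m' p (KI i t)"
    by (rule form_adjoint[OF KI_linear[OF i] KI_A[OF i] KI_linear[OF i] KI_A[OF i] _ assms(2,3)])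
       (simp_all add: * form_A_left form_A_right zw_in_A form_basis)
  ultimately show "form m m' (KH i p) t = form m m' p (KH i t)"
    "form m m' (KI i p) t = form m m' p (KI i t)" by simp_all
qed

section \<open>Cyclic vectors and the adjoint of multiplication by the central element\<close>

definition conc :: "nat \<Rightarrow> nat \<Rightarrow> nat \<Rightarrow> nat" where
  "conc k d = (\<lambda>j. if j = k then d else 0)"

lemma conc_idx: "k \<in> {1..n} \<Longrightarrow> conc k d \<in> idx d"
  by (auto simp: conc_def idx_def)

text \<open>The weights on opposite sides avoid truncated subtraction. Weight k orders multi-indices
  for induction; weight n - k will measure the w part in the search for singular vectors.\<close>

lemma weighted_sum_move:
  fixes g :: "nat \<Rightarrow> nat"
  assumes "i \<in> {1..n}" "j \<in> {1..n}" "i \<noteq> j" "r i > 0"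
  shows "(\<Sum>k\<in>{1..n}. g k * move i j r k) + g i = (\<Sum>k\<in>{1..n}. g k * r k) + g j"
proof -
  have *: "sum f {1..n} = f i + f j + sum f ({1..n} - {i, j})" for f :: "nat \<Rightarrow> nat"
  proof -
    have "{1..n} = insert i (insert j ({1..n} - {i, j}))" using assms by auto
    then have "sum f {1..n} = sum f (insert i (insert j ({1..n} - {i, j})))" by simp
    then show ?thesis using assms(3) by simp
  qed
  have "(\<Sum>k\<in>{1..n} - {i, j}. g k * move i j r k) = (\<Sum>k\<in>{1..n} - {i, j}. g k * r k)"
    by (rule sum.cong) (auto simp: move_def)
  moreover obtain a where "r i = Suc a" using assms(4) by (cases "r i") auto
  ultimately show ?thesis
    unfolding *[of "\<lambda>k. g k * move i j r k"] *[of "\<lambda>k. g k * r k"]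
    using assms(3) by (simp add: move_def)
qed

abbreviation height :: "(nat \<Rightarrow> nat) \<Rightarrow> nat" where
  "height r \<equiv> \<Sum>k\<in>{1..n}. k * r k"

lemma height_move:
  assumes "i \<in> {1..<n}" "r (Suc i) > 0"
  shows "height (move (Suc i) i r) < height r"
  using weighted_sum_move[of "Suc i" i r "\<lambda>k. k"] assms by auto

text \<open>Moving units from \<open>Suc i\<close> to \<open>i\<close> strictly lowers
  \<open>height\<close> and can only stop when everything sits at position 1.\<close>

lemma idx_induct:
  assumes "r \<in> idx d" and "P (conc 1 d)"
    and "\<And>r i. r \<in> idx d \<Longrightarrow> i \<in> {1..<n} \<Longrightarrow> r (Suc i) > 0 \<Longrightarrow> P (move (Suc i) i r) \<Longrightarrow> P r"
  shows "P r"
  using assms(1)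
proof (induction "height r" arbitrary: r rule: less_induct)
  case less
  show ?case
  proof (cases "\<exists>i\<in>{1..<n}. r (Suc i) > 0")
    case True
    then obtain i where i: "i \<in> {1..<n}" "r (Suc i) > 0" by blast
    have "P (move (Suc i) i r)"
      using i less(2) by (intro less(1) height_move idx_move) auto
    then show ?thesis by (rule assms(3)[OF less(2) i])
  next
    case False
    have z: "r k = 0" if "k \<noteq> 1" for k
    proof (cases "k \<in> {1..n}")
      case True
      then have "k - 1 \<in> {1..<n}" "Suc (k - 1) = k" using that by auto
      then show ?thesis using False by (metis bot_nat_0.not_eq_extremum)
    qed (use less(2) in \<open>simp add: idx_def\<close>)
    have "{1..n} = insert 1 {2..n}" using n_ge by auto
    then have "sum r {1..n} = r 1" using z by simp
    then have "r = conc 1 d" using z less(2) by (auto simp: conc_def idx_def fun_eq_iff)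
    then show ?thesis using assms(2) by simp
  qed
qed

text \<open>\<open>z\<^sub>1\<^sup>d w\<^sub>1\<^sup>d'\<close> is the product of a highest and a lowest weight vector, hence cyclic.\<close>

lemma cyclic_generation:
  assumes S: "subspace S" and start: "zw (conc 1 d, conc 1 d') \<in> S"
    and E: "\<And>i p. i \<in> {1..<n} \<Longrightarrow> p \<in> S \<Longrightarrow> E i p \<in> S"
    and F: "\<And>i p. i \<in> {1..<n} \<Longrightarrow> p \<in> S \<Longrightarrow> F i p \<in> S"
  shows "A d d' \<subseteq> S"
proof -
  have cancel: "v \<in> S" if "scale a v + u \<in> S" "u \<in> S" "a \<noteq> 0" for a v u
  proof -
    have "scale a v + u - u \<in> S" using S that subspace_diff by blast
    then have "scale a v \<in> S" by simp
    then have "scale (inverse a) (scale a v) \<in> S" using subspace_scale[OF S] by blast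
    then show ?thesis using that(3) by simp
  qed
  \<comment> \<open>With all z's at position 1, \<open>E i\<close> kills the z part and simply
    shifts w's upwards from w_1.\<close>
  have low: "zw (conc 1 d, s) \<in> S" if "s \<in> idx d'" for s
    using that
  proof (rule idx_induct[where P = "\<lambda>s. zw (conc 1 d, s) \<in> S", OF _ start])
    fix s i assume i: "i \<in> {1..<n}" and s: "s (Suc i) > 0" and IH: "zw (conc 1 d, move (Suc i) i s) \<in> S"
    let ?s = "move (Suc i) i s"
    have "E_coeff_z i (conc 1 d) = 0" using i by (simp add: E_coeff_z_def conc_def)
    then have "scale (E_coeff_w i (conc 1 d) ?s) (zw (conc 1 d, s)) + 0 \<in> S"
      using E[OF i IH] move_inverse[of "Suc i" i s] s by (simp add: E_zw[OF i])
    moreover have "E_coeff_w i (conc 1 d) ?s \<noteq> 0"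
      using q_nonzero qint_nonzero[OF q_nonzero q_power move_target[of "Suc i" i s]]
      by (simp add: E_coeff_w_def)
    ultimately show "zw (conc 1 d, s) \<in> S" using cancel subspace_0[OF S] by blast
  qed
  \<comment> \<open>\<open>F i\<close> produces the wanted monomial plus one with the old z part and
    a changed w part. The quantifier over \<open>s\<close> puts the latter into \<open>S\<close>, so
    it can be subtracted.\<close>
  have "\<forall>s\<in>idx d'. zw (r, s) \<in> S" if "r \<in> idx d" for r
    using that
  proof (rule idx_induct)
    show "\<forall>s\<in>idx d'. zw (conc 1 d, s) \<in> S" using low by blast
    fix r i assume i: "i \<in> {1..<n}" and r: "r (Suc i) > 0"
      and IH: "\<forall>s\<in>idx d'. zw (move (Suc i) i r, s) \<in> S"
    show "\<forall>s\<in>idx d'. zw (r, s) \<in> S"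
    proof
      fix s assume s: "s \<in> idx d'"
      let ?r = "move (Suc i) i r"
      have "scale (qint q (?r i)) (zw (r, s)) + scale (F_coeff_w i ?r s) (zw (?r, move (Suc i) i s)) \<in> S"
        using F[OF i IH[rule_format, OF s]] move_inverse[of "Suc i" i r] r by (simp add: F_zw[OF i])
      moreover have "scale (F_coeff_w i ?r s) (zw (?r, move (Suc i) i s)) \<in> S"
      proof (cases "s (Suc i) = 0")
        case True
        then show ?thesis by (simp add: F_coeff_w_def subspace_0[OF S])
      next
        case False
        then show ?thesis using i s by (intro subspace_scale[OF S] IH[rule_format] idx_move) auto
      qed
      ultimately show "zw (r, s) \<in> S"
        using cancel qint_nonzero[OF q_nonzero q_power move_target[of "Suc i" i r]] by blast
    qed
  qed
  then show ?thesis unfolding A_span by (intro span_minimal S) auto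
qed

lemma zm_conc: "zm (conc 1 d) = z 1 ^ d" and wm_conc: "wm (conc 1 d) = w 1 ^ d"
proof -
  have c: "conc 1 (Suc d) = (conc 1 d)(1 := Suc (conc 1 d 1))" for d
    by (auto simp: conc_def fun_eq_iff)
  have 1: "(1::nat) \<in> {1..n}" using n_ge by simp
  have 0: "zm (conc 1 0) = 1" "wm (conc 1 0) = 1"
    by (simp_all add: zm_simps(3) wm_simps(3) conc_def)
  show "zm (conc 1 d) = z 1 ^ d"
  proof (induction d)
    case (Suc d)
    show ?case unfolding c Z.mon_Suc[OF 1, unfolded Z_mon] Suc by simp
  qed (simp add: 0 del: One_nat_def)
  show "wm (conc 1 d) = w 1 ^ d"
  proof (induction d)
    case (Suc d)
    show ?case unfolding c W.mon_Suc[OF 1, unfolded W_mon] Suc by simp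
  qed (simp add: 0 del: One_nat_def)
qed

text \<open>The correction sum in the relation for \<open>k = 1\<close> is empty, so z_1 and w_1
  commute. On this vector both orderings agree, and \<open>D\<close> and \<open>Dbar\<close> can be
  computed in turn.\<close>

lemma zw_conc: "zw (conc 1 d, conc 1 d') = wm (conc 1 d') * zm (conc 1 d)"
proof -
  have "w 1 * z 1 = z 1 * w 1" using w_z_same[of 1] n_ge by simp
  then have "w 1 ^ d' * z 1 ^ d = z 1 ^ d * w 1 ^ d'"
    by (metis power_commuting_commutes)
  then show ?thesis by (simp add: zw_def zm_conc wm_conc del: One_nat_def)
qed

lemma \<Delta>_conc: "\<Delta> (zw (conc 1 (Suc m), conc 1 (Suc m'))) =
    scale (qint q (Suc m) * qint q (Suc m')) (zw (conc 1 m, conc 1 m'))"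
proof -
  have upd: "(conc 1 (Suc d))(1 := conc 1 (Suc d) 1 - 1) = conc 1 d" for d
    by (auto simp: conc_def fun_eq_iff)
  have "D i (Dbar i (zw (conc 1 (Suc m), conc 1 (Suc m')))) =
      (if i = 1 then scale (qint q (Suc m) * qint q (Suc m')) (zw (conc 1 m, conc 1 m')) else 0)"
    if i: "i \<in> {1..n}" for i
  proof (cases "i = 1")
    case True
    have 1: "(1::nat) \<in> {1..n}" using n_ge by simp
    have "sum (conc 1 d) {1<..n} = 0" for d by (simp add: conc_def)
    then have "Dbar 1 (zw (conc 1 (Suc m), conc 1 (Suc m'))) =
        scale (qint q (Suc m')) (zw (conc 1 (Suc m), conc 1 m'))"
      unfolding zw_conc Dbar_monomial[OF 1] upd by (simp add: conc_def)
    moreover have "D 1 (zw (conc 1 (Suc m), conc 1 m')) =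
        scale (qint q (Suc m)) (zw (conc 1 m, conc 1 m'))"
      unfolding zw_def prod.case D_monomial[OF 1] upd
      using \<open>\<And>d. sum (conc 1 d) {1<..n} = 0\<close> by (simp add: conc_def)
    ultimately show ?thesis using True 1 by (simp add: D_simps mult.commute del: One_nat_def)
  next
    case False
    then have "conc 1 (Suc m') i = 0" by (simp add: conc_def)
    then show ?thesis using i False by (simp add: zw_conc Dbar_monomial D_simps del: One_nat_def)
  qed
  then show ?thesis using n_ge by (simp add: q_laplacian_def)
qed

lemma form_Q_right:
  assumes "r \<in> idx m" "s \<in> idx m'"
  shows "form (Suc m) (Suc m') p (Q * zw (r, s)) =
    (\<Sum>i\<in>{1..n}. inverse q ^ sum r {i<..n} * q ^ sum s {1..<i} *
      form (Suc m) (Suc m') p (zw (r(i := Suc (r i)), s(i := Suc (s i)))))"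
proof -
  have in_A: "zw (r(i := Suc (r i)), s(i := Suc (s i))) \<in> A (Suc m) (Suc m')" if "i \<in> {1..n}" for i
    using assms that by (intro zw_in_A SigmaI idx_Suc_upd)
  have Q: "Q * zw (r, s) = (\<Sum>i\<in>{1..n}. scale (inverse q ^ sum r {i<..n} * q ^ sum s {1..<i})
      (zw (r(i := Suc (r i)), s(i := Suc (s i)))))"
    by (simp add: zw_def Q_monomial del: fun_upd_apply)
  have "form (Suc m) (Suc m') p (Q * zw (r, s)) = (\<Sum>i\<in>{1..n}. form (Suc m) (Suc m') p
      (scale (inverse q ^ sum r {i<..n} * q ^ sum s {1..<i})
      (zw (r(i := Suc (r i)), s(i := Suc (s i))))))"
    unfolding Q by (rule form_A_sum_right) (intro subspace_scale subspace_A in_A)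
  then show ?thesis
    by (simp only: form_A_right(2)[OF in_A] cong: sum.cong)
qed

lemma form_Q_zw:
  assumes "r \<in> idx m" "s \<in> idx m'" "x \<in> bidx (Suc m) (Suc m')"
  shows "form (Suc m) (Suc m') (Q * zw (r, s)) (zw x) =
    (\<Sum>i\<in>{1..n}. inverse q ^ sum r {i<..n} * q ^ sum s {1..<i} *
      (if (r(i := Suc (r i)), s(i := Suc (s i))) = x then zw_norm x else 0))"
proof -
  have "(r(i := Suc (r i)), s(i := Suc (s i))) \<in> bidx (Suc m) (Suc m')" if "i \<in> {1..n}" for i
    using assms that idx_Suc_upd by auto
  then show ?thesis
    unfolding form_commute[of _ _ _ "zw x"] form_Q_right[OF assms(1,2)]
    using assms(3) by (simp add: form_basis del: fun_upd_apply) (rule sum.cong; auto)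
qed

lemma form_Q_\<Delta>:
  assumes p: "p \<in> A m m'" and t: "t \<in> A (Suc m) (Suc m')"
  shows "form (Suc m) (Suc m') (Q * p) t = inverse q ^ m * q ^ m' * q\<^sup>2 * form m m' p (\<Delta> t)"
proof -
  \<comment> \<open>Raising the z_1 exponent from m to m+1 multiplies the norm by q^(-m) and a
    q-integer; raising the w_1 exponent from m' to m'+1 multiplies it by q^(m'+2) and a q-integer.
    The q-integers are those in \<open>\<Delta>_conc\<close>; the powers remain.\<close>
  let ?\<kappa> = "inverse q ^ m * q ^ m' * q\<^sup>2"
  define S where "S = {t \<in> A (Suc m) (Suc m').
    \<forall>p\<in>A m m'. form (Suc m) (Suc m') (Q * p) t = ?\<kappa> * form m m' p (\<Delta> t)}"
  have "A (Suc m) (Suc m') \<subseteq> S"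
  proof (rule cyclic_generation)
    show "subspace S"
      unfolding S_def using \<Delta>_A
      by (auto simp: subspace_def[of "Collect _"] subspace_0 subspace_add subspace_scale subspace_A
          form_A_right \<Delta>_simps algebra_simps)
    show "E i t \<in> S" if "i \<in> {1..<n}" "t \<in> S" for i t
      using that unfolding S_def
      by (auto simp: E_A F_A \<Delta>_A \<Delta>_E Q_mult_A Q_commute(4) form_F_E[symmetric])
    show "F i t \<in> S" if "i \<in> {1..<n}" "t \<in> S" for i t
      using that unfolding S_def
      by (auto simp: E_A F_A \<Delta>_A \<Delta>_F Q_mult_A Q_commute(3) form_E_F[symmetric])
    let ?x = "(conc 1 (Suc m), conc 1 (Suc m'))"
    have 1: "(1::nat) \<in> {1..n}" using n_ge by simp
    have x: "?x \<in> bidx (Suc m) (Suc m')" using conc_idx[OF 1] by auto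
    have "form (Suc m) (Suc m') (Q * p) (zw ?x) = ?\<kappa> * form m m' p (\<Delta> (zw ?x))" if "p \<in> A m m'" for p
      using that
    proof (induction rule: A_induct)
      case zero
      show ?case by (simp add: form_A_left)
    next
      case (add c y u)
      define v where "v = zw y"
      from add obtain r s where v: "v = zw (r, s)" and rs: "r \<in> idx m" "s \<in> idx m'" by (auto simp: v_def)
      have "form (Suc m) (Suc m') (Q * v) (zw ?x) = ?\<kappa> * form m m' v (\<Delta> (zw ?x))"
      proof -
        \<comment> \<open>\<open>Q\<close> raises the same position in both indices, so only its
          term z_1 w_1 can reach a monomial in z_1 and w_1 alone.\<close>
        have eq: "(r(i := Suc (r i)), s(i := Suc (s i))) = ?x \<longleftrightarrow> i = 1 \<and> r = conc 1 m \<and> s = conc 1 m'" for i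
          by (auto simp: conc_def fun_eq_iff split: if_splits)
        have "form (Suc m) (Suc m') (Q * v) (zw ?x) =
            (if r = conc 1 m \<and> s = conc 1 m' then zw_norm ?x else 0)"
          unfolding v form_Q_zw[OF rs x] eq using 1
          by (simp add: sum.remove[of _ 1] conc_def if_distrib cong: if_cong)
        moreover have "form m m' v (\<Delta> (zw ?x)) = qint q (Suc m) * qint q (Suc m') *
            (if r = conc 1 m \<and> s = conc 1 m' then zw_norm (conc 1 m, conc 1 m') else 0)"
          unfolding v \<Delta>_conc using rs conc_idx[OF 1]
          by (simp add: form_A_right zw_in_A form_basis)
        moreover have "zw_norm ?x = ?\<kappa> * (qint q (Suc m) * qint q (Suc m') * zw_norm (conc 1 m, conc 1 m'))"
        proof -
          have "{1..n} = insert 1 {2..n}" using n_ge by auto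
          then show ?thesis
            by (simp add: zw_norm_def conc_def norm_Suc power2_eq_square mult_ac)
        qed
        ultimately show ?thesis by simp
      qed
      moreover have "v \<in> A m m'" using v rs zw_in_A by auto
      ultimately show ?case using add
        by (simp add: v_def[symmetric] distrib_left scale_mult_right form_A_left Q_mult_A
            subspace_scale subspace_A algebra_simps)
    qed
    then show "zw ?x \<in> S" unfolding S_def using zw_in_A[OF x] by blast
  qed
  then show ?thesis using p t unfolding S_def by blast
qed

end

section \<open>Irreducibility and decomposition\<close>

context zw_action
begin

abbreviation H :: "nat \<Rightarrow> nat \<Rightarrow> 'a set" where "H \<equiv> q_harmonic n scale gA D Dbar"

text \<open>Stability under the concrete operators, which is equivalent to being a subrepresentation
  because the generators can be recovered from them. It keeps the module arguments free of the
  presented algebra.\<close>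

definition stable :: "'a set \<Rightarrow> bool" where
  "stable W \<longleftrightarrow> subspace W \<and>
     (\<forall>i\<in>{1..n}. \<forall>p\<in>W. KH i p \<in> W \<and> KI i p \<in> W) \<and>
     (\<forall>i\<in>{1..<n}. \<forall>p\<in>W. E i p \<in> W \<and> F i p \<in> W)"

definition orth :: "nat \<Rightarrow> nat \<Rightarrow> 'a set \<Rightarrow> 'a set" where
  "orth m m' W = {p \<in> A m m'. \<forall>t\<in>W. form m m' p t = 0}"

lemma H_iff: "p \<in> H m m' \<longleftrightarrow> p \<in> A m m' \<and> \<Delta> p = 0"
  by (simp add: q_harmonic_def)

lemma H_trivial: "m = 0 \<or> m' = 0 \<Longrightarrow> H m m' = A m m'"
  using \<Delta>_A_zero by (auto simp: H_iff)

lemma H_orth: "H (Suc m) (Suc m') = orth (Suc m) (Suc m') ((\<lambda>p. Q * p) ` A m m')"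
proof (intro set_eqI iffI)
  fix p assume "p \<in> H (Suc m) (Suc m')"
  then show "p \<in> orth (Suc m) (Suc m') ((\<lambda>p. Q * p) ` A m m')"
    by (auto simp: orth_def H_iff form_commute[of _ _ p] form_Q_\<Delta> form_A_right)
next
  fix p assume "p \<in> orth (Suc m) (Suc m') ((\<lambda>p. Q * p) ` A m m')"
  then have p: "p \<in> A (Suc m) (Suc m')"
    and "\<forall>t\<in>A m m'. form (Suc m) (Suc m') (Q * t) p = 0"
    by (auto simp: orth_def form_commute[of _ _ p])
  then have "\<forall>t\<in>A m m'. form m m' t (\<Delta> p) = 0"
    using q_nonzero by (simp add: form_Q_\<Delta>)
  then have "\<Delta> p = 0"
    using form_A_nondegenerate[OF \<Delta>_A[OF p]] zw_in_A by (simp add: form_commute)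
  then show "p \<in> H (Suc m) (Suc m')" using p by (simp add: H_iff)
qed

lemma stable_A: "stable (A m m')"
  by (simp add: stable_def subspace_A KH_A KI_A E_A F_A)

lemma stable_Q:
  assumes W: "stable W"
  shows "stable ((\<lambda>p. Q * p) ` W)"
proof -
  have "subspace ((\<lambda>p. Q * p) ` W)"
  proof (rule subspaceI)
    show "0 \<in> (\<lambda>p. Q * p) ` W"
      using W subspace_0[of W] by (intro image_eqI[of _ _ 0]) (auto simp: stable_def)
    show "a + b \<in> (\<lambda>p. Q * p) ` W" if "a \<in> (\<lambda>p. Q * p) ` W" "b \<in> (\<lambda>p. Q * p) ` W" for a b
      using W that subspace_add[of W] by (auto simp: stable_def simp flip: distrib_left)
    show "scale c a \<in> (\<lambda>p. Q * p) ` W" if "a \<in> (\<lambda>p. Q * p) ` W" for c a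
      using W that subspace_scale[of W] by (auto simp: stable_def simp flip: scale_mult_right)
  qed
  then show ?thesis
    using W by (auto simp: stable_def Q_commute)
qed

lemma stable_inter: "stable V \<Longrightarrow> stable W \<Longrightarrow> stable (V \<inter> W)"
  by (auto simp: stable_def subspace_inter)

lemma stable_orth:
  assumes "stable W" "W \<subseteq> A m m'"
  shows "stable (orth m m' W)"
proof -
  have "subspace (orth m m' W)"
    by (auto simp: orth_def subspace_def[of "Collect _"] subspace_0 subspace_add subspace_scale
        subspace_A form_A_left)
  then show ?thesis
    using assms unfolding stable_def orth_def
    by (auto simp: KH_A KI_A E_A F_A form_KH form_E_F form_F_E subset_iff)
qed

lemma stable_H: "stable (H m m')"
proof (cases "m = 0 \<or> m' = 0")
  case True
  then show ?thesis by (simp add: H_trivial stable_A)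
next
  case False
  then obtain a b where "m = Suc a" "m' = Suc b" by (metis not0_implies_Suc)
  then show ?thesis
    by (auto simp: H_orth intro!: stable_orth stable_Q stable_A Q_mult_A)
qed

lemma H_A: "H m m' \<subseteq> A m m'"
  by (auto simp: H_iff)

lemma orthogonal_complement:
  assumes "stable W" "W \<subseteq> A m m'" "W \<inter> orth m m' W = {0}" "p \<in> A m m'"
  obtains u v where "p = u + v" "u \<in> W" "v \<in> orth m m' W"
proof -
  have W: "subspace W" using assms(1) by (simp add: stable_def)
  have "\<exists>u\<in>W. \<forall>t\<in>W. form m m' p t = form m m' u t"
  proof (rule orthogonal_projection[folded A_span, OF W assms(2)])
    fix u assume "u \<in> W" "\<And>t. t \<in> W \<Longrightarrow> form m m' u t = 0"
    then show "u = 0" using assms(2,3) by (auto simp: orth_def)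
  qed
  then obtain u where u: "u \<in> W" "\<forall>t\<in>W. form m m' p t = form m m' u t" by blast
  have "p - u \<in> orth m m' W"
  proof -
    have uA: "u \<in> A m m'" using u(1) assms(2) by blast
    have "form m m' (p - u) t = form m m' p t - form m m' u t" for t
      using form_A_right(3)[OF assms(4) uA, of t] form_commute[of m m'] by metis
    then show ?thesis using u(2) subspace_diff[OF subspace_A(1) assms(4) uA] by (simp add: orth_def)
  qed
  with u(1) show ?thesis using that[of u "p - u"] by simp
qed

text \<open>Every \<open>E i\<close> strictly lowers \<open>ht\<close>: it moves z indices down and
  w indices up. So the filtration by \<open>ht\<close> is strictly decreased, and applying some
  \<open>E i\<close> with nonzero result as long as possible must stop, at a nonzero vector of
  \<open>W\<close> killed by all of them.\<close>

lemma singular_vector_exists: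
  assumes W: "stable W" "W \<subseteq> A m m'" and p: "p \<in> W" "p \<noteq> 0"
  shows "\<exists>v\<in>W. v \<noteq> 0 \<and> (\<forall>i\<in>{1..<n}. E i v = 0)"
proof -
  define ht where "ht = (\<lambda>(r :: nat \<Rightarrow> nat, s :: nat \<Rightarrow> nat).
    (\<Sum>k\<in>{1..n}. k * r k) + (\<Sum>k\<in>{1..n}. (n - k) * s k))"
  define Fil where "Fil h = span (zw ` {x \<in> bidx m m'. ht x < h})" for h
  have E_Fil: "E i p \<in> Fil h" if i: "i \<in> {1..<n}" and p: "p \<in> Fil (Suc h)" for i p h
  proof (rule linear_span_subset[OF E_linear[OF i] _ _ p[unfolded Fil_def]])
    show "subspace (Fil h)" by (simp add: Fil_def)
    fix y assume "y \<in> zw ` {x \<in> bidx m m'. ht x < Suc h}"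
    then obtain r s where y: "y = zw (r, s)" and rs: "r \<in> idx m" "s \<in> idx m'" "ht (r, s) < Suc h"
      by auto
    have "scale (E_coeff_z i r) (zw (move (Suc i) i r, s)) \<in> Fil h"
    proof (cases "r (Suc i) = 0")
      case False
      then have "ht (move (Suc i) i r, s) < h"
        using weighted_sum_move[of "Suc i" i r "\<lambda>k. k"] i rs(3) by (simp add: ht_def)
      moreover have "move (Suc i) i r \<in> idx m" using False i rs by (intro idx_move) auto
      ultimately show ?thesis using rs unfolding Fil_def by (intro span_scale) (auto intro: span_base)
    qed (simp add: E_coeff_z_def Fil_def span_zero)
    moreover have "scale (E_coeff_w i r s) (zw (r, move i (Suc i) s)) \<in> Fil h"
    proof (cases "s i = 0")
      case False
      then have "ht (r, move i (Suc i) s) < h"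
      proof -
        have "n - i = Suc (n - Suc i)" using i by (simp add: Suc_diff_Suc)
        with weighted_sum_move[of i "Suc i" s "\<lambda>k. n - k"] i False
        have "(\<Sum>k\<in>{1..n}. (n - k) * move i (Suc i) s k) < (\<Sum>k\<in>{1..n}. (n - k) * s k)" by simp
        with rs(3) show ?thesis by (simp add: ht_def)
      qed
      moreover have "move i (Suc i) s \<in> idx m'" using False i rs by (intro idx_move) auto
      ultimately show ?thesis using rs unfolding Fil_def by (intro span_scale) (auto intro: span_base)
    qed (simp add: E_coeff_w_def Fil_def span_zero)
    ultimately show "E i y \<in> Fil h"
      unfolding y E_zw[OF i] by (simp add: Fil_def span_add)
  qed
  have "\<exists>v\<in>W. v \<noteq> 0 \<and> (\<forall>i\<in>{1..<n}. E i v = 0)" if "p \<in> Fil h" "p \<in> W" "p \<noteq> 0" for h p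
    using that
  proof (induction h arbitrary: p)
    case 0
    then show ?case by (simp add: Fil_def)
  next
    case (Suc h)
    show ?case
    proof (cases "\<forall>i\<in>{1..<n}. E i p = 0")
      case True
      then show ?thesis using Suc.prems by blast
    next
      case False
      then obtain i where i: "i \<in> {1..<n}" "E i p \<noteq> 0" by blast
      have "E i p \<in> W" using W(1) i Suc.prems by (simp add: stable_def)
      then show ?thesis using Suc.IH[OF E_Fil[OF i(1) Suc.prems(1)]] i by blast
    qed
  qed
  moreover obtain h where "\<forall>x\<in>ht ` bidx m m'. x < h"
    using finite_nat_set_iff_bounded[of "ht ` bidx m m'"] finite_idx by blast
  then have "{x \<in> bidx m m'. ht x < h} = bidx m m'" by blast
  then have "p \<in> Fil h" using p W(2) A_span by (auto simp: Fil_def)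
  ultimately show ?thesis using p by blast
qed

section \<open>The distinguished singular vector and its uniqueness\<close>

abbreviation hw :: "nat \<Rightarrow> nat \<Rightarrow> 'a" where
  "hw m m' \<equiv> zw (conc 1 m, conc n m')"

lemma hw_idx: "(conc 1 m, conc n m') \<in> bidx m m'"
  using n_ge conc_idx by auto

lemma hw_A: "hw m m' \<in> A m m'"
  by (rule zw_in_A) (rule hw_idx)

lemma form_hw: "form m m' (hw m m') (hw m m') \<noteq> 0"
  using hw_idx zw_norm_nonzero by (simp add: form_basis)

lemma E_hw: "i \<in> {1..<n} \<Longrightarrow> E i (hw m m') = 0"
  by (simp add: E_zw E_coeff_z_def E_coeff_w_def conc_def)

text \<open>Each term of \<open>Q\<close> times a monomial raises one common position of both
  indices, whereas the z and w parts of \<open>hw\<close> sit at the different positions 1 and n. So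
  \<open>hw\<close> is orthogonal to all multiples of \<open>Q\<close>.\<close>

lemma hw_H: "hw m m' \<in> H m m'"
proof (cases "m = 0 \<or> m' = 0")
  case True
  then show ?thesis by (simp add: H_trivial hw_A del: One_nat_def)
next
  case False
  then obtain a b where m: "m = Suc a" "m' = Suc b" by (metis not0_implies_Suc)
  have "form m m' (Q * t) (hw m m') = 0" if "t \<in> A a b" for t
    using that
  proof (induction rule: A_induct)
    case zero
    show ?case by (simp add: form_A_left)
  next
    case (add c x u)
    obtain r s where x: "x = (r, s)" by (cases x)
    have "(r(i := Suc (r i)), s(i := Suc (s i))) \<noteq> (conc 1 m, conc n m')" for i
    proof
      assume "(r(i := Suc (r i)), s(i := Suc (s i))) = (conc 1 m, conc n m')"
      then have "conc 1 m i > 0" "conc n m' i > 0" by (metis Pair_inject fun_upd_same zero_less_Suc)+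
      then show False using n_ge by (simp add: conc_def split: if_splits)
    qed
    then have "form m m' (Q * zw x) (hw m m') = 0"
      using add(1) hw_idx form_Q_zw[of r a s b "(conc 1 m, conc n m')"] unfolding m x
      by (simp only: mem_Sigma_iff if_False mult_zero_right sum.neutral_const simp_thms)
    then show ?case using add zw_in_A unfolding m
      by (simp add: distrib_left scale_mult_right form_A_left Q_mult_A subspace_scale subspace_A)
  qed
  then show ?thesis
    unfolding m H_orth using hw_A[of m m'] by (auto simp: orth_def form_commute[of _ _ "zw _"] m)
qed

lemma geometric_q: "(q\<^sup>2 - 1) * (\<Sum>u<N. q ^ (2 * u)) = q ^ (2 * N) - 1"
  by (induction N) (simp_all add: algebra_simps power2_eq_square)

lemma qint_times: "(q - inverse q) * qint q a = q powi int a - q powi (- int a)"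
  using q_square q_nonzero
  by (simp add: qint_def field_simps power2_eq_square power_int_minus power_inverse)

text \<open>The functional \<open>form m m' p\<close> vanishes on the images of all \<open>F i\<close> and on \<open>Q \<A>\<close>. Modulo these,
  every monomial is a multiple of \<open>z\<^sub>1\<^sup>m w\<^sub>n\<^sup>m'\<close>: one first moves all factors \<open>z\<^sub>k\<close> to \<open>z\<^sub>1\<close>, then all
  factors \<open>w\<^sub>k\<close> to \<open>w\<^sub>1\<close> or \<open>w\<^sub>n\<close>, and finally \<open>Q\<close> removes \<open>w\<^sub>1\<close>.\<close>

lemma singular_zero:
  assumes p: "p \<in> H m m'" and sing: "\<And>i. i \<in> {1..<n} \<Longrightarrow> E i p = 0"
    and top: "form m m' p (hw m m') = 0"
  shows "p = 0"
proof -
  define \<phi> where "\<phi> r s = form m m' p (zw (r, s))" for r s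
  have pA: "p \<in> A m m'" using p H_A by blast
  \<comment> \<open>This is \<open>form m m' p (F i (zw (r, s))) = 0\<close>, which holds because
    \<open>F i\<close> is adjoint to \<open>E i\<close> and \<open>E i p = 0\<close>.\<close>
  have rel: "qint q (r i) * \<phi> (move i (Suc i) r) s + F_coeff_w i r s * \<phi> r (move (Suc i) i s) = 0"
    if "i \<in> {1..<n}" "r \<in> idx m" "s \<in> idx m'" for i r s
    using form_E_F[OF that(1) pA zw_in_A[of "(r, s)"]] form_F_zw[OF that, of p] that sing
    by (simp add: \<phi>_def form_A_left)
  have F_nonzero: "F_coeff_w i r s \<noteq> 0" if "s (Suc i) > 0" for i r s
    using q_nonzero qint_nonzero[OF q_nonzero q_power that] by (simp add: F_coeff_w_def)
  have one: "(1::nat) \<in> {1..n}" using n_ge by simp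
  \<comment> \<open>If no z_i is present, the z term of the relation vanishes and a single multiple
    of \<open>\<phi> (conc 1 m) s\<close> remains. Thus a w at any position strictly between 1 and
    n, or also at 1 when there are no z's, forces the value 0.\<close>
  have w_to_front: "\<phi> (conc 1 m) s = 0"
    if i: "i \<in> {1..<n}" and s: "s \<in> idx m'" "s i > 0" and "i > 1 \<or> m = 0" for i s
  proof -
    have "move i (Suc i) s \<in> idx m'" using i s by (intro idx_move) auto
    from rel[OF i conc_idx[OF one] this] have
      "F_coeff_w i (conc 1 m) (move i (Suc i) s) * \<phi> (conc 1 m) s = 0"
      using move_inverse[of i "Suc i" s] s(2) that(4) by (auto simp: conc_def)
    then show ?thesis using F_nonzero[of "move i (Suc i) s" i "conc 1 m", OF move_target] by simp
  qed
  have main: "\<phi> (conc 1 m) s = 0" if s: "s = (\<lambda>_. 0)(1 := Suc a, n := b)"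
    and ab: "m' = Suc a + b" and m: "m = Suc m1" for s a b m1
  proof -
    define r0 where "r0 = conc 1 m1"
    define s0 where "s0 = (\<lambda>_. 0::nat)(1 := a, n := b)"
    \<comment> \<open>One z_1 and one w_1 are stripped from the monomial, and \<open>t i\<close>
      puts z_i w_i in their place. These are the values of \<open>\<phi>\<close> at the terms of
      \<open>Q * zw (r0, s0)\<close>, and \<open>t 1\<close> is the value sought.\<close>
    define t where "t i = \<phi> (r0(i := Suc (r0 i))) (s0(i := Suc (s0 i)))" for i
    have n1: "n \<noteq> 1" "n \<noteq> Suc 0" using n_ge by auto
    have r0: "r0 \<in> idx m1" unfolding r0_def by (rule conc_idx[OF one])
    have s0: "s0 \<in> idx (a + b)"
    proof -
      have "sum s0 {1..n} = s0 1 + s0 n + sum s0 ({1..n} - {1, n})"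
      proof -
        have "{1..n} = insert 1 (insert n ({1..n} - {1, n}))" using n_ge by auto
        then have "sum s0 {1..n} = sum s0 (insert 1 (insert n ({1..n} - {1, n})))" by simp
        then show ?thesis using n1 by simp
      qed
      also have "sum s0 ({1..n} - {1, n}) = 0" by (simp add: s0_def)
      finally show ?thesis using n_ge n1 by (auto simp: idx_def s0_def)
    qed
    have "r0(1 := Suc (r0 1)) = conc 1 m" "s0(1 := Suc (s0 1)) = s"
      using n1 by (auto simp: r0_def s0_def s m conc_def fun_eq_iff)
    then have t1: "\<phi> (conc 1 m) s = t 1" by (simp add: t_def)
    have upd_idx: "r0(i := Suc (r0 i)) \<in> idx m" "s0(i := Suc (s0 i)) \<in> idx m'" if "i \<in> {1..n}" for i
      using idx_Suc_upd[OF r0 that] idx_Suc_upd[OF s0 that] by (simp_all add: m ab)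
    \<comment> \<open>The relation for \<open>F j\<close> is used at the index where z_j and w_(j+1)
      have been added: its two moves lead to \<open>t (Suc j)\<close> and
      \<open>t j\<close>.\<close>
    have recurrence: "qint q (Suc (r0 j)) * t (Suc j) =
        q powi (int (Suc (r0 j)) + int (Suc (s0 (Suc j))) - int (s0 j)) * qint q (Suc (s0 (Suc j))) * t j"
      if j: "j \<in> {1..<n}" for j
    proof -
      let ?r = "r0(j := Suc (r0 j))" and ?s = "s0(Suc j := Suc (s0 (Suc j)))"
      have "move j (Suc j) ?r = r0(Suc j := Suc (r0 (Suc j)))"
        "move (Suc j) j ?s = s0(j := Suc (s0 j))"
        by (auto simp: move_def fun_eq_iff)
      then have "qint q (Suc (r0 j)) * t (Suc j) + F_coeff_w j ?r ?s * t j = 0"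
        using rel[OF j upd_idx(1) upd_idx(2), of j "Suc j"] j by (simp add: t_def)
      moreover have "F_coeff_w j ?r ?s = - (q powi (int (Suc (r0 j)) + int (Suc (s0 (Suc j))) - int (s0 j)) *
          qint q (Suc (s0 (Suc j))))"
        using j by (simp add: F_coeff_w_def r0_def conc_def)
      ultimately show ?thesis by (simp add: algebra_simps)
    qed
    let ?M = "qint q m"
    have q1: "qint q 1 = 1" using q_square q_nonzero by (simp add: qint_def power2_eq_square field_simps)
    \<comment> \<open>The factor \<open>?M\<close> comes from the first step, where the exponent of
      z_1 is \<open>m\<close>; keeping it on the left avoids division. Each further step before
      position \<open>n\<close> multiplies by q^2.\<close>
    have middle: "?M * t (Suc k) = q powi (int m + 1 - int a + 2 * int (k - 1)) * t 1"
      if "k \<ge> 1" "Suc k < n" for k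
      using that
    proof (induction k rule: dec_induct)
      case base
      have "s0 (Suc 1) = 0" "s0 1 = a" "r0 1 = m1" using base n1 by (auto simp: s0_def r0_def conc_def)
      then show ?case using recurrence[of 1] base q1 by (simp add: m algebra_simps)
    next
      case (step k)
      have "s0 (Suc (Suc k)) = 0" "s0 (Suc k) = 0" "r0 (Suc k) = 0"
        using step.prems step.hyps by (auto simp: s0_def r0_def conc_def)
      then have "t (Suc (Suc k)) = q powi 2 * t (Suc k)"
        using recurrence[of "Suc k"] step.prems q1 by simp
      then have "?M * t (Suc (Suc k)) = q powi 2 * (?M * t (Suc k))" by simp
      also have "\<dots> = (q powi 2 * q powi (int m + 1 - int a + 2 * int (k - 1))) * t 1"
        using step by simp
      also have "q powi 2 * q powi (int m + 1 - int a + 2 * int (k - 1)) =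
          q powi (2 + (int m + 1 - int a + 2 * int (k - 1)))"
        by (rule power_int_add[symmetric]) (use q_nonzero in simp)
      also have "2 + (int m + 1 - int a + 2 * int (k - 1)) = int m + 1 - int a + 2 * int (Suc k - 1)"
        using step.hyps by (cases k) auto
      finally show ?case .
    qed
    \<comment> \<open>The last step meets the b factors w_n, which bring in q^b and
      \<open>qint q (Suc b)\<close>. For \<open>n = 2\<close> it coincides with the first step and
      is treated on its own.\<close>
    have last: "?M * t n = q powi (int m + 1 - int a + 2 * (int n - 2) + int b) * qint q (Suc b) * t 1"
    proof (cases "n = 2")
      case True
      have "s0 (Suc 1) = b" "s0 1 = a" "r0 1 = m1" using True by (auto simp: s0_def r0_def conc_def)
      then show ?thesis using recurrence[of 1] True by (simp add: m algebra_simps numeral_2_eq_2)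
    next
      case False
      then obtain k where k: "n = Suc (Suc k)" "k \<ge> 1" using n_ge
        by (metis Suc_1 Suc_leD le_Suc_ex add_Suc le_antisym not_less_eq_eq plus_1_eq_Suc)
      have "s0 (Suc (Suc k)) = b" "s0 (Suc k) = 0" "r0 (Suc k) = 0"
        using k by (auto simp: s0_def r0_def conc_def)
      then have "t n = q powi (int b + 2) * qint q (Suc b) * t (Suc k)"
        using recurrence[of "Suc k"] k q1 by (simp add: algebra_simps)
      then have "?M * t n = q powi (int b + 2) * qint q (Suc b) * (?M * t (Suc k))" by simp
      also have "?M * t (Suc k) = q powi (int m + 1 - int a + 2 * int (k - 1)) * t 1"
        using k by (intro middle) auto
      also have "q powi (int b + 2) * qint q (Suc b) * \<dots> =
          (q powi (int b + 2) * q powi (int m + 1 - int a + 2 * int (k - 1))) * qint q (Suc b) * t 1"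
        by simp
      also have "q powi (int b + 2) * q powi (int m + 1 - int a + 2 * int (k - 1)) =
          q powi (int m + 1 - int a + 2 * (int n - 2) + int b)"
        using q_nonzero k by (simp add: power_int_add[symmetric]) (cases k; simp add: algebra_simps)
      finally show ?thesis .
    qed
    have Q_rel: "(\<Sum>i\<in>{1..n}. inverse q ^ sum r0 {i<..n} * q ^ sum s0 {1..<i} * t i) = 0"
    proof -
      have m': "m' = Suc (a + b)" using ab by simp
      have "form m m' p (Q * zw (r0, s0)) = 0"
        using p zw_in_A[of "(r0, s0)"] r0 s0 unfolding m m' H_orth by (simp add: orth_def)
      then show ?thesis
        unfolding t_def \<phi>_def m m' form_Q_right[OF r0 s0] .
    qed
    \<comment> \<open>The two ends are separated from the interior positions, since the three kinds
      of \<open>t i\<close> have different formulas; the interior is empty for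
      \<open>n = 2\<close>.\<close>
    have "{1..n} = insert 1 (insert n (Suc ` {1..<n - 1}))"
      using n_ge by (auto simp: image_iff)
    then have "(\<Sum>i\<in>{1..n}. inverse q ^ sum r0 {i<..n} * q ^ sum s0 {1..<i} * t i) =
        t 1 + q ^ a * t n + (\<Sum>k\<in>{1..<n - 1}. q ^ a * t (Suc k))"
    proof -
      have r_sum: "sum r0 {i<..n} = 0" if "i \<ge> 1" for i using that by (simp add: r0_def conc_def)
      have s_sum: "sum s0 {1..<i} = a" if "i > 1" "i \<le> n" for i
      proof -
        have "{1..<i} = insert 1 {2..<i}" using that by auto
        then have "sum s0 {1..<i} = s0 1 + sum s0 {2..<i}" by simp
        also have "sum s0 {2..<i} = 0" using that by (simp add: s0_def)
        finally show ?thesis using n1 by (simp add: s0_def)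
      qed
      have "(\<Sum>i\<in>{1..n}. inverse q ^ sum r0 {i<..n} * q ^ sum s0 {1..<i} * t i) =
          (\<Sum>i\<in>{1..n}. if i = 1 then t 1 else q ^ a * t i)"
        by (rule sum.cong) (auto simp: r_sum s_sum s_sum[unfolded One_nat_def])
      also have "\<dots> = t 1 + q ^ a * t n + (\<Sum>i\<in>Suc ` {1..<n - 1}. q ^ a * t i)"
        using n_ge n1 by (subst \<open>{1..n} = _\<close>) (auto intro!: sum.cong)
      also have "(\<Sum>i\<in>Suc ` {1..<n - 1}. q ^ a * t i) = (\<Sum>k\<in>{1..<n - 1}. q ^ a * t (Suc k))"
        by (subst sum.reindex) (simp_all del: image_Suc_atLeastLessThan)
      finally show ?thesis .
    qed
    then have "0 = ?M * (t 1 + q ^ a * t n + (\<Sum>k\<in>{1..<n - 1}. q ^ a * t (Suc k)))"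
      using Q_rel by simp
    also have "\<dots> = ?M * t 1 + q ^ a * (?M * t n) + (\<Sum>k\<in>{1..<n - 1}. q ^ a * (?M * t (Suc k)))"
      by (simp add: algebra_simps sum_distrib_left)
    also have "(\<Sum>k\<in>{1..<n - 1}. q ^ a * (?M * t (Suc k))) =
        (\<Sum>u<n - 2. q powi (int m + 1) * q ^ (2 * u) * t 1)"
    proof (rule sum.reindex_bij_witness[of _ Suc "\<lambda>k. k - 1"])
      fix k assume k: "k \<in> {1..<n - 1}"
      have "q ^ a * (?M * t (Suc k)) = q powi int a * (q powi (int m + 1 - int a + 2 * int (k - 1)) * t 1)"
        using k by (subst middle) auto
      then show "q powi (int m + 1) * q ^ (2 * (k - 1)) * t 1 = q ^ a * (?M * t (Suc k))"
        using q_nonzero by (simp add: power_int_add power_int_diff power_mult)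
          (simp add: power_int_def nat_mult_distrib power_mult)
    qed auto
    also have "q ^ a * (?M * t n) =
        q powi (int m + 1) * q ^ (2 * (n - 2)) * (q ^ b * qint q (Suc b)) * t 1"
    proof -
      have "q ^ a * q powi (int m + 1 - int a + 2 * (int n - 2) + int b) =
          q powi (int m + 1) * q powi (int (2 * (n - 2))) * q powi int b"
        using n_ge q_nonzero
        by (simp add: power_int_add[symmetric] of_nat_diff algebra_simps flip: power_int_of_nat)
      then have "q ^ a * q powi (int m + 1 - int a + 2 * (int n - 2) + int b) =
          q powi (int m + 1) * q ^ (2 * (n - 2)) * q ^ b"
        by (simp only: power_int_of_nat)
      then show ?thesis by (simp only: last mult.assoc[symmetric])
    qed
    finally have "(?M + q powi (int m + 1) * (q ^ (2 * (n - 2)) * (q ^ b * qint q (Suc b)) +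
        (\<Sum>u<n - 2. q ^ (2 * u)))) * t 1 = 0"
      by (simp add: algebra_simps sum_distrib_left sum_distrib_right)
    \<comment> \<open>Multiplication by \<open>q - inverse q\<close> clears the denominators of the
      q-integers and sums the geometric series of the interior, so that the total telescopes to a
      single difference. Its exponent is positive because \<open>n \<ge> 2\<close>, hence it is
      nonzero.\<close>
    moreover have "(q - inverse q) * (?M + q powi (int m + 1) * (q ^ (2 * (n - 2)) * (q ^ b * qint q (Suc b)) +
        (\<Sum>u<n - 2. q ^ (2 * u)))) = q powi (- int m) * (q ^ (2 * (m + (n - 1) + b)) - 1)"
    proof -
      have "q * (q - inverse q) = q\<^sup>2 - 1" using q_nonzero by (simp add: power2_eq_square algebra_simps)
      then have G: "q * ((q - inverse q) * (\<Sum>u<n - 2. q ^ (2 * u))) = q ^ (2 * (n - 2)) - 1"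
        using geometric_q[of "n - 2"] by (simp add: mult.assoc[symmetric])
      have B: "q * ((q - inverse q) * (q ^ b * qint q (Suc b))) = q ^ (2 * Suc b) - 1"
      proof -
        have "q * ((q - inverse q) * (q ^ b * qint q (Suc b))) =
            q ^ Suc b * ((q - inverse q) * qint q (Suc b))"
          by (simp only: power_Suc mult_ac)
        also have "\<dots> = q ^ Suc b * (q ^ Suc b - inverse (q ^ Suc b))"
          by (simp only: qint_times power_int_minus power_int_of_nat)
        also have "\<dots> = q ^ Suc b * q ^ Suc b - 1"
          using right_inverse[of "q ^ Suc b"] q_nonzero
          by (simp only: right_diff_distrib power_not_zero not_False_eq_True)
        finally show ?thesis by (simp only: mult_2 power_add)
      qed
      have "(q - inverse q) * (?M + q powi (int m + 1) * (q ^ (2 * (n - 2)) * (q ^ b * qint q (Suc b)) +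
          (\<Sum>u<n - 2. q ^ (2 * u)))) = (q - inverse q) * ?M + q powi int m *
          (q ^ (2 * (n - 2)) * (q * ((q - inverse q) * (q ^ b * qint q (Suc b)))) +
            q * ((q - inverse q) * (\<Sum>u<n - 2. q ^ (2 * u))))"
        using q_nonzero by (simp add: power_int_add algebra_simps)
      also have "\<dots> = q powi int m - q powi (- int m) + q powi int m *
          (q ^ (2 * (n - 2)) * (q ^ (2 * Suc b) - 1) + (q ^ (2 * (n - 2)) - 1))"
        unfolding G B qint_times ..
      also have "\<dots> = q powi int m * q ^ (2 * (n - 2) + 2 * Suc b) - q powi (- int m)"
        by (simp add: algebra_simps power_add)
      also have "2 * (n - 2) + 2 * Suc b = 2 * ((n - 1) + b)" using n_ge by simp
      also have "q powi int m * q ^ (2 * ((n - 1) + b)) - q powi (- int m) =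
          q powi (- int m) * (q ^ (2 * (m + (n - 1) + b)) - 1)"
        using q_nonzero by (simp add: power_int_minus power_add power_mult field_simps power2_eq_square)
      finally show ?thesis .
    qed
    moreover have "q ^ (2 * (m + (n - 1) + b)) \<noteq> 1" using q_power n_ge by auto
    ultimately have "t 1 = 0" using q_nonzero by auto
    then show ?thesis by (simp only: t1)
  qed
  \<comment> \<open>If \<open>w_to_front\<close> does not apply, \<open>s\<close> is supported on
    the positions 1 and n. Without w_1 the monomial is \<open>hw\<close>, covered by
    \<open>top\<close>; with w_1 there is also a z_1, and \<open>main\<close> applies.\<close>
  have first: "\<phi> (conc 1 m) s = 0" if s: "s \<in> idx m'" for s
  proof (cases "\<exists>i\<in>{1..<n}. s i > 0 \<and> (i > 1 \<or> m = 0)")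
    case True
    then show ?thesis using w_to_front s by blast
  next
    case False
    have z: "s i = 0" if "i \<noteq> 1" "i \<noteq> n" for i
      using False s that by (cases "i \<in> {1..n}") (force simp: idx_def)+
    have se: "s = (\<lambda>_. 0)(1 := s 1, n := s n)" using z by (auto simp: fun_eq_iff)
    have "{1..n} = insert 1 (insert n ({1..n} - {1, n}))" using n_ge by auto
    then have "sum s {1..n} = sum s (insert 1 (insert n ({1..n} - {1, n})))" by simp
    then have m': "m' = s 1 + s n" using z s n_ge by (simp add: idx_def)
    show ?thesis
    proof (cases "s 1")
      case 0
      have "s k = conc n m' k" for k
        using 0 z[of k] m' by (cases "k = 1") (auto simp: conc_def)
      then have "s = conc n m'" by blast
      then show ?thesis using top by (simp only: \<phi>_def)
    next
      case (Suc a)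
      moreover have "(1::nat) \<in> {1..<n}" using n_ge by simp
      ultimately have "m \<noteq> 0" using False by (metis zero_less_Suc)
      then obtain m1 where "m = Suc m1" by (cases m) auto
      then show ?thesis using main[of s a "s n" m1] se m' Suc by simp
    qed
  qed
  \<comment> \<open>The relation at the lower index \<open>?r\<close> ties \<open>\<phi> r s\<close>
    to a value at \<open>?r\<close> with a different w part, which is why the induction carries all
    \<open>s\<close> along.\<close>
  have "\<forall>s\<in>idx m'. \<phi> r s = 0" if "r \<in> idx m" for r
    using that
  proof (rule idx_induct)
    show "\<forall>s\<in>idx m'. \<phi> (conc 1 m) s = 0" using first by blast
    fix r i assume r: "r \<in> idx m" and i: "i \<in> {1..<n}" "r (Suc i) > 0"
      and IH: "\<forall>s\<in>idx m'. \<phi> (move (Suc i) i r) s = 0"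
    show "\<forall>s\<in>idx m'. \<phi> r s = 0"
    proof
      fix s assume s: "s \<in> idx m'"
      let ?r = "move (Suc i) i r"
      have "F_coeff_w i ?r s * \<phi> ?r (move (Suc i) i s) = 0"
      proof (cases "s (Suc i) = 0")
        case False
        then have "move (Suc i) i s \<in> idx m'" using i s by (intro idx_move) auto
        then show ?thesis using IH by simp
      qed (simp add: F_coeff_w_def)
      moreover have "?r \<in> idx m" using i r by (intro idx_move) auto
      ultimately have "qint q (?r i) * \<phi> r s = 0"
        using rel[OF i(1) _ s, of ?r] move_inverse[of "Suc i" i r] i(2) by auto
      then show "\<phi> r s = 0" using qint_nonzero[OF q_nonzero q_power move_target[of "Suc i" i r]] by simp
    qed
  qed
  then show ?thesis
    using form_A_nondegenerate[OF pA] by (auto simp: \<phi>_def)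
qed

lemma hw_in_stable:
  assumes W: "stable W" "W \<subseteq> H m m'" and p: "p \<in> W" "p \<noteq> 0"
  shows "hw m m' \<in> W"
proof -
  obtain v where v: "v \<in> W" "v \<noteq> 0" "\<And>i. i \<in> {1..<n} \<Longrightarrow> E i v = 0"
    using singular_vector_exists[OF W(1) _ p] W(2) H_A by blast
  \<comment> \<open>This multiple of \<open>hw\<close> makes the difference orthogonal to
    \<open>hw\<close>, so that \<open>singular_zero\<close> identifies \<open>v\<close> with
    it.\<close>
  define c where "c = form m m' v (hw m m') / form m m' (hw m m') (hw m m')"
  have vA: "v \<in> A m m'" using v W H_A by blast
  have sub: "subspace (H m m')" "subspace W" using stable_H W(1) by (auto simp: stable_def)
  have "v - scale c (hw m m') = 0"
  proof (rule singular_zero)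
    show "v - scale c (hw m m') \<in> H m m'"
      using sub v W(2) hw_H by (intro subspace_diff subspace_scale) auto
    show "E i (v - scale c (hw m m')) = 0" if "i \<in> {1..<n}" for i
      using v(3)[OF that] E_hw[OF that] by (simp only: E_simps[OF that] scale_zero_right diff_zero)
    have "form m m' (hw m m') (v - scale c (hw m m')) = 0"
      using form_hw form_A_right(3)[OF vA, of "scale c (hw m m')"] hw_A
      by (simp only: form_A_right(2)[OF hw_A] subspace_scale[OF subspace_A(1) hw_A])
         (simp add: c_def form_commute[of m m' v])
    then show "form m m' (v - scale c (hw m m')) (hw m m') = 0" by (simp only: form_commute)
  qed
  then have c: "v = scale c (hw m m')" by simp
  with v(2) have "c \<noteq> 0" by auto
  then have "scale (inverse c) v = hw m m'" using c by simp
  moreover have "scale (inverse c) v \<in> W" using sub(2) v(1) by (rule subspace_scale)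
  ultimately show ?thesis by simp
qed

section \<open>Irreducibility of the harmonic spaces\<close>

lemma hw_not_orth: "hw m m' \<in> W \<Longrightarrow> hw m m' \<notin> orth m m' W"
  using form_hw[of m m'] by (auto simp: orth_def)

lemma stable_zero: "stable W \<Longrightarrow> 0 \<in> W"
  by (simp add: stable_def subspace_0)

lemma H_irreducible:
  assumes W: "stable W" "W \<subseteq> H m m'"
  shows "W = {0} \<or> W = H m m'"
proof (cases "W = {0}")
  case False
  then obtain p where "p \<in> W" "p \<noteq> 0" using stable_zero[OF W(1)] by blast
  then have hwW: "hw m m' \<in> W" using hw_in_stable[OF W] by blast
  have WA: "W \<subseteq> A m m'" using W(2) H_A by blast
  \<comment> \<open>Used twice: with \<open>V = W\<close> it permits the orthogonal projection to
    \<open>W\<close>, and with \<open>V\<close> the whole harmonic space it makes the complementary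
    component vanish.\<close>
  have disj: "V \<inter> orth m m' W = {0}" if V: "stable V" "V \<subseteq> H m m'" for V
  proof (rule ccontr)
    assume *: "V \<inter> orth m m' W \<noteq> {0}"
    have st: "stable (V \<inter> orth m m' W)"
      by (intro stable_inter V stable_orth W WA)
    then obtain p where "p \<in> V \<inter> orth m m' W" "p \<noteq> 0"
      using * stable_zero by blast
    then have "hw m m' \<in> V \<inter> orth m m' W"
      using V(2) by (intro hw_in_stable[OF st]) auto
    then show False using hw_not_orth[OF hwW] by blast
  qed
  have "p \<in> W" if p: "p \<in> H m m'" for p
  proof -
    obtain u v where uv: "p = u + v" "u \<in> W" "v \<in> orth m m' W"
      using orthogonal_complement[OF W(1) WA disj[OF W]] p H_A by blast
    have "v = p - u" using uv by simp
    moreover have "p - u \<in> H m m'"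
      using p uv(2) W(2) stable_H[of m m'] by (intro subspace_diff) (auto simp: stable_def)
    ultimately have "v \<in> H m m'" by simp
    then have "v = 0" using disj[OF stable_H order_refl] uv(3) by blast
    then show ?thesis using uv by simp
  qed
  then show ?thesis using W(2) by blast
qed simp

text \<open>A nonzero intersection is a submodule of the harmonic space and contains
  \<open>hw\<close>. Then \<open>hw\<close> is both a multiple of \<open>Q\<close> and orthogonal to
  all such multiples, hence isotropic, a contradiction.\<close>

lemma H_Q_disjoint:
  assumes "Q * t \<in> H (Suc m) (Suc m')" "t \<in> A m m'"
  shows "Q * t = 0"
proof (rule ccontr)
  assume *: "Q * t \<noteq> 0"
  let ?V = "H (Suc m) (Suc m') \<inter> (\<lambda>p. Q * p) ` A m m'"
  have "hw (Suc m) (Suc m') \<in> ?V"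
    by (rule hw_in_stable[OF _ _ _ *])
       (use assms in \<open>auto intro!: stable_inter stable_H stable_Q stable_A\<close>)
  moreover have "hw (Suc m) (Suc m') \<in> orth (Suc m) (Suc m') ((\<lambda>p. Q * p) ` A m m')"
    using hw_H[of "Suc m" "Suc m'"] by (simp only: H_orth)
  ultimately show False using hw_not_orth by blast
qed

lemma harmonic_decomposition:
  assumes "p \<in> A (Suc m) (Suc m')"
  obtains h t where "p = h + Q * t" "h \<in> H (Suc m) (Suc m')" "t \<in> A m m'"
proof -
  let ?W = "(\<lambda>p. Q * p) ` A m m'"
  have st: "stable ?W" and sub: "?W \<subseteq> A (Suc m) (Suc m')"
    by (auto intro: stable_Q stable_A Q_mult_A)
  have disj: "?W \<inter> orth (Suc m) (Suc m') ?W = {0}"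
    using H_Q_disjoint stable_zero[OF st] stable_zero[OF stable_H[of "Suc m" "Suc m'"]]
    by (auto simp flip: H_orth)
  obtain u v where "p = u + v" "u \<in> ?W" "v \<in> orth (Suc m) (Suc m') ?W"
    by (rule orthogonal_complement[OF st sub disj assms])
  then obtain t where "p = v + Q * t" "t \<in> A m m'" "v \<in> H (Suc m) (Suc m')"
    by (auto simp: H_orth add.commute)
  then show ?thesis using that by blast
qed

text \<open>A leading term argument in the exponent of z_1. The coefficient of z_1 z^r w_1 w^s in
  \<open>Q * p\<close> receives a nonzero multiple of the coordinate at (r, s) through z_1 w_1. Any
  other contribution comes from an index whose z_1 exponent is already larger by one, and its
  coordinate vanishes by induction. The form extracts the coefficients.\<close>

lemma Q_injective:
  assumes p: "p \<in> A m m'" and Qp: "Q * p = 0"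
  shows "p = 0"
proof -
  let ?c = "coord m m' p"
  have p_sum: "p = (\<Sum>x\<in>bidx m m'. scale (?c x) (zw x))"
    by (rule span_coord) (use p A_span in simp)
  have one: "(1::nat) \<in> {1..n}" using n_ge by simp
  have "?c (r, s) = 0" if "r \<in> idx m" "s \<in> idx m'" for r s
    using that
  proof (induction "m - r 1" arbitrary: r s rule: less_induct)
    case less
    let ?y = "(r(1 := Suc (r 1)), s(1 := Suc (s 1)))"
    have y: "?y \<in> bidx (Suc m) (Suc m')" using less.prems one idx_Suc_upd by blast
    let ?f = "\<lambda>x. form (Suc m) (Suc m') (Q * zw x) (zw ?y)"
    have zero: "?c x * ?f x = 0" if x: "x \<in> bidx m m'" "x \<noteq> (r, s)" for x
    proof -
      obtain r' s' where x': "x = (r', s')" by (cases x)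
      show ?thesis
      proof (cases "r' 1 = Suc (r 1)")
        case True
        have "r' 1 \<le> sum r' {1..n}" using one by (intro member_le_sum) auto
        then have "m - r' 1 < m - r 1" using True x(1) x' by (simp add: idx_def)
        then have "?c x = 0" using less.hyps[of r' s'] x(1) x' by blast
        then show ?thesis by simp
      next
        case False
        have "(r'(i := Suc (r' i)), s'(i := Suc (s' i))) \<noteq> ?y" for i
        proof
          assume eq: "(r'(i := Suc (r' i)), s'(i := Suc (s' i))) = ?y"
          then have "(r'(i := Suc (r' i))) 1 = Suc (r 1)" by simp
          then have "i = 1" using False by (cases "i = 1") auto
          then have "r' = r" "s' = s"
            using eq inj_Suc_upd[of 1] by (auto simp: inj_def)
          then show False using x(2) x' by simp
        qed
        then have "?f x = 0"
          using x(1) form_Q_zw[OF _ _ y, of r' s'] unfolding x'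
          by (simp only: mem_Sigma_iff if_False mult_zero_right sum.neutral_const simp_thms)
        then show ?thesis by simp
      qed
    qed
    have self: "?f (r, s) \<noteq> 0"
    proof -
      have "(r(i := Suc (r i)), s(i := Suc (s i))) = ?y \<longleftrightarrow> i = 1" for i
        by (auto simp: fun_eq_iff split: if_splits)
      then have "?f (r, s) = inverse q ^ sum r {1<..n} * q ^ sum s {1..<1} * zw_norm ?y"
        using form_Q_zw[OF less.prems y] one by (simp only: sum.delta finite_atLeastAtMost
            if_distrib[where f = "\<lambda>t. _ * t"] mult_zero_right if_True cong: if_cong)
      then show ?thesis using q_nonzero zw_norm_nonzero by simp
    qed
    have "0 = form (Suc m) (Suc m') (zw ?y) (Q * p)"
      by (simp only: Qp form_A_right)
    also have "Q * p = (\<Sum>x\<in>bidx m m'. scale (?c x) (Q * zw x))"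
      by (subst p_sum) (simp only: sum_distrib_left scale_mult_right)
    also have "form (Suc m) (Suc m') (zw ?y) \<dots> =
        (\<Sum>x\<in>bidx m m'. form (Suc m) (Suc m') (zw ?y) (scale (?c x) (Q * zw x)))"
      by (rule form_A_sum_right) (intro subspace_scale subspace_A Q_mult_A zw_in_A)
    also have "\<dots> = (\<Sum>x\<in>bidx m m'. ?c x * ?f x)"
      by (intro sum.cong refl)
         (subst form_A_right(2)[OF Q_mult_A[OF zw_in_A]], assumption, subst form_commute, rule refl)
    also have "\<dots> = ?c (r, s) * ?f (r, s) + (\<Sum>x\<in>bidx m m' - {(r, s)}. ?c x * ?f x)"
      using less.prems finite_idx by (intro sum.remove) auto
    also have "(\<Sum>x\<in>bidx m m' - {(r, s)}. ?c x * ?f x) = 0"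
      using zero by (intro sum.neutral) blast
    finally show ?case using self by (simp only: add_0_right) simp
  qed
  then have "\<forall>x\<in>bidx m m'. scale (?c x) (zw x) = 0" by auto
  then show ?thesis using p_sum by (metis (no_types, lifting) sum.neutral)
qed

section \<open>Powers of the central element and the direct sum\<close>

lemma Q_power_A: "p \<in> A m m' \<Longrightarrow> Q ^ j * p \<in> A (m + j) (m' + j)"
  by (induction j) (simp_all add: mult.assoc Q_mult_A)

lemma Q_power_injective: "p \<in> A m m' \<Longrightarrow> Q ^ j * p = 0 \<Longrightarrow> p = 0"
  by (induction j) (auto simp: mult.assoc dest: Q_injective[OF Q_power_A])

lemma stable_Q_power: "stable W \<Longrightarrow> stable ((\<lambda>p. Q ^ j * p) ` W)"
proof (induction j)
  case (Suc j)
  have "(\<lambda>p. Q ^ Suc j * p) ` W = (\<lambda>p. Q * p) ` (\<lambda>p. Q ^ j * p) ` W"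
    by (simp add: image_image mult.assoc)
  then show ?case using Suc stable_Q by simp
qed simp

lemma decomposition_exists:
  "p \<in> A m m' \<Longrightarrow> \<exists>v. (\<forall>j\<in>{0..min m m'}. v j \<in> H (m - j) (m' - j)) \<and>
    p = (\<Sum>j\<in>{0..min m m'}. Q ^ j * v j)"
proof (induction m arbitrary: m' p)
  case 0
  then show ?case by (intro exI[of _ "\<lambda>_. p"]) (simp add: H_trivial)
next
  case (Suc m)
  show ?case
  proof (cases m')
    case 0
    then show ?thesis using Suc.prems by (intro exI[of _ "\<lambda>_. p"]) (simp add: H_trivial)
  next
    case (Suc k)
    then obtain h t where h: "p = h + Q * t" "h \<in> H (Suc m) (Suc k)" "t \<in> A m k"
      using harmonic_decomposition Suc.prems by blast
    obtain v where v: "\<forall>j\<in>{0..min m k}. v j \<in> H (m - j) (k - j)"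
      "t = (\<Sum>j\<in>{0..min m k}. Q ^ j * v j)"
      using Suc.IH[OF h(3)] by blast
    let ?v = "\<lambda>j. case j of 0 \<Rightarrow> h | Suc i \<Rightarrow> v i"
    have "p = (\<Sum>j\<in>{0..min (Suc m) m'}. Q ^ j * ?v j)"
      unfolding Suc min_Suc_Suc sum.atLeast0_atMost_Suc_shift h(1) v(2)
      by (simp add: sum_distrib_left mult.assoc)
    moreover have "?v j \<in> H (Suc m - j) (m' - j)" if "j \<in> {0..min (Suc m) m'}" for j
      using that v(1) h(2) Suc by (cases j) auto
    ultimately show ?thesis by blast
  qed
qed

text \<open>The summand for \<open>j = 0\<close> is harmonic and equals minus \<open>Q\<close> times
  the rest, so it vanishes by \<open>H_Q_disjoint\<close>. Cancelling one \<open>Q\<close> leaves a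
  relation in lower bidegree.\<close>

lemma decomposition_unique:
  "(\<And>j. j \<in> {0..min m m'} \<Longrightarrow> v j \<in> H (m - j) (m' - j)) \<Longrightarrow>
    (\<Sum>j\<in>{0..min m m'}. Q ^ j * v j) = 0 \<Longrightarrow> j \<in> {0..min m m'} \<Longrightarrow> v j = 0"
proof (induction m arbitrary: m' v j)
  case 0
  then show ?case by simp
next
  case (Suc m)
  show ?case
  proof (cases m')
    case 0
    then show ?thesis using Suc.prems by simp
  next
    case (Suc k)
    let ?t = "\<Sum>j\<in>{0..min m k}. Q ^ j * v (Suc j)"
    have v0: "v 0 \<in> H (Suc m) (Suc k)" using Suc.prems(1)[of 0] Suc by simp
    have vS: "v (Suc j) \<in> H (m - j) (k - j)" if "j \<in> {0..min m k}" for j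
      using Suc.prems(1)[of "Suc j"] that Suc by simp
    have "?t \<in> A m k"
    proof (intro subspace_sum subspace_A)
      fix j assume j: "j \<in> {0..min m k}"
      show "Q ^ j * v (Suc j) \<in> A m k"
        using Q_power_A[of "v (Suc j)" "m - j" "k - j" j] vS[OF j] H_A j by auto
    qed
    moreover have sum0: "v 0 + Q * ?t = 0"
      using Suc.prems(2) unfolding Suc min_Suc_Suc sum.atLeast0_atMost_Suc_shift
      by (simp add: sum_distrib_left mult.assoc)
    then have "Q * ?t = - v 0" by (simp add: eq_neg_iff_add_eq_0 add.commute)
    then have "Q * ?t \<in> H (Suc m) (Suc k)"
      using v0 stable_H[of "Suc m" "Suc k"] by (simp add: stable_def subspace_neg)
    ultimately have "Q * ?t = 0" using H_Q_disjoint by blast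
    then have t0: "?t = 0" and "v 0 = 0"
      using Q_injective[OF \<open>?t \<in> A m k\<close>] sum0 by auto
    then show ?thesis
      using Suc.IH[of k "\<lambda>j. v (Suc j)", OF vS t0] Suc.prems(3) Suc by (cases j) auto
  qed
qed

end

section \<open>Linking the presentations with the operators\<close>

text \<open>The algebra is spanned by the images of words, and words are built by left
  multiplication with generators.\<close>

lemma presented_induct:
  assumes pres: "presented_by sc g X R" and "P 0"
    and add: "\<And>c a b. P a \<Longrightarrow> P b \<Longrightarrow> P (sc c a + b)"
    and one: "P 1" and gen: "\<And>x a. x \<in> X \<Longrightarrow> P a \<Longrightarrow> P (g x * a)"
  shows "P y"
proof -
  obtain p where p: "p \<in> free_algebra_on X" "y = eval_free sc g p"
    using pres unfolding presented_by_def by blast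
  have word: "P (prod_list (map g xs))" if "set xs \<subseteq> X" for xs
    using that by (induction xs) (auto intro: one gen)
  have "P (\<Sum>u\<in>S. sc (Poly_Mapping.lookup p u) (prod_list (map g (letters u))))"
    if "finite S" "S \<subseteq> Poly_Mapping.keys p" for S
    using that
  proof (induction rule: finite_induct)
    case (insert u S)
    have "set (letters u) \<subseteq> X" using insert p(1) by (auto simp: free_algebra_on_def)
    then show ?case using insert word add by simp
  qed (simp add: assms(2))
  then show ?thesis unfolding p(2) eval_free_def by simp
qed

lemma zw_relations_of_algebra:
  assumes q: "q \<noteq> 0" "\<forall>k::nat. k > 0 \<longrightarrow> q ^ k \<noteq> 1" "n \<ge> 2"
    and alg: "zw_algebra q n sA gA"
  shows "zw_relations sA q n gA"
proof -
  have pres: "presented_by sA gA (zw_gens n) (zw_rels q n)"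
    using alg by (simp add: zw_algebra_def)
  then have ca: "complex_algebra sA" by (simp add: presented_by_def)
  interpret complex_algebra sA by fact
  note rel = presented_by_relation[OF pres]
  note ev = eval_free_diff[OF ca] eval_free_add[OF ca] eval_free_sum[OF ca] eval_free_single[OF ca]
    gen_mult_gen fscale_single
  have fscale_sum: "fscale c (\<Sum>s\<in>S. Poly_Mapping.single (u s) d) =
      (\<Sum>s\<in>S. Poly_Mapping.single (u s) (c * d))" for c d and u :: "nat \<Rightarrow> zw_gen fword" and S
    by (simp add: fscale_def sum_distrib_left mult_single)
  show ?thesis
  proof (unfold_locales, goal_cases)
    case (4 i j)
    have "gen (Zgen i) * gen (Zgen j) - fscale q (gen (Zgen j) * gen (Zgen i)) \<in> zw_rels q n"
      unfolding zw_rels_def using 4 by blast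
    from rel[OF this] show ?case by (simp add: ev)
  next
    case (5 i j)
    have "gen (Wgen i) * gen (Wgen j) - fscale (inverse q) (gen (Wgen j) * gen (Wgen i)) \<in> zw_rels q n"
      unfolding zw_rels_def using 5 by blast
    from rel[OF this] show ?case by (simp add: ev)
  next
    case (6 i j)
    have "gen (Wgen j) * gen (Zgen i) - fscale q (gen (Zgen i) * gen (Wgen j)) \<in> zw_rels q n"
      unfolding zw_rels_def using 6 by blast
    from rel[OF this] show ?case by (simp add: ev)
  next
    case (7 k)
    have "gen (Wgen k) * gen (Zgen k) - (gen (Zgen k) * gen (Wgen k) +
        fscale (1 - q\<^sup>2) (\<Sum>s\<in>{1..<k}. gen (Zgen s) * gen (Wgen s))) \<in> zw_rels q n"
      unfolding zw_rels_def using 7 by blast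
    from rel[OF this] show ?case by (simp add: ev fscale_sum scale_sum_right)
  qed (use q in auto)
qed

lemma zw_action_of_uq_action:
  assumes q: "q \<noteq> 0" "\<forall>k::nat. k > 0 \<longrightarrow> q ^ k \<noteq> 1" "qh\<^sup>2 = q" "n \<ge> 2"
    and alg: "zw_algebra q n sA gA"
    and D: "z_derivatives q n sA gA D" "w_derivatives q n sA gA Dbar"
    and uq: "uq_gl q qh n sU gU" and action: "uq_action q qh n sU gU sA gA act"
  defines "KH \<equiv> \<lambda>i. act (gU (Khalf i))" and "KI \<equiv> \<lambda>i. act (gU (Khalf_inv i))"
  shows "zw_action sA q n gA D Dbar qh KH KI
      (\<lambda>i p. sA qh (act (gU (Egen i)) (KH i (KI (Suc i) p))))
      (\<lambda>i p. sA (inverse qh) (act (gU (Fgen i)) (KH i (KI (Suc i) p))))"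
    and "\<And>i p. i \<in> {1..n} \<Longrightarrow> KH i (KI i p) = p"
proof -
  interpret zw_relations sA q n gA
    by (rule zw_relations_of_algebra) (use assms in auto)
  interpret zw_calculus sA q n gA D Dbar
    by unfold_locales (use D in auto)
  have pres: "presented_by sU gU (uq_gens n) (uq_rels q qh n)"
    using uq by (simp add: uq_gl_def)
  then have ca: "complex_algebra sU" by (simp add: presented_by_def)
  interpret U: complex_algebra sU by fact
  note rel = presented_by_relation[OF pres]
  have one: "(1 :: uq_gen free_algebra) = Poly_Mapping.single (FWord []) 1"
    by (simp flip: zero_fword_def)
  note ev = eval_free_diff[OF ca] eval_free_single[OF ca] gen_mult_gen fscale_single one
  have KK: "gU (Khalf i) * gU (Khalf_inv i) = 1" "gU (Khalf_inv i) * gU (Khalf i) = 1"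
    if "i \<in> {1..n}" for i
  proof -
    have "gen (Khalf i) * gen (Khalf_inv i) - 1 \<in> uq_rels q qh n"
      "gen (Khalf_inv i) * gen (Khalf i) - 1 \<in> uq_rels q qh n"
      unfolding uq_rels_def using that by blast+
    from rel[OF this(1)] rel[OF this(2)] show
      "gU (Khalf i) * gU (Khalf_inv i) = 1" "gU (Khalf_inv i) * gU (Khalf i) = 1"
      by (simp_all add: ev)
  qed
  have comm: "gU (Khalf i) * gU (Khalf j) = gU (Khalf j) * gU (Khalf i)"
    if "i \<in> {1..n}" "j \<in> {1..n}" for i j
  proof -
    have "gen (Khalf i) * gen (Khalf j) - gen (Khalf j) * gen (Khalf i) \<in> uq_rels q qh n"
      unfolding uq_rels_def using that by blast
    from rel[OF this] show ?thesis by (simp add: ev)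
  qed
  have rep: "Defs.representation sU sA act" using action by (simp add: uq_action_def)
  have lin: "Vector_Spaces.linear sA sA (act X)" for X
    using rep by (simp add: Defs.representation_def)
  note act_simps = linear_simps[OF lin]
  have act_mult: "act (X * Y) p = act X (act Y p)" and act_one: "act 1 p = p" for X Y p
    using rep by (simp_all add: Defs.representation_def)
  have KHI: "KH i (KI i p) = p" "KI i (KH i p) = p" if "i \<in> {1..n}" for i p
    using KK[OF that] by (simp_all add: KH_def KI_def act_one flip: act_mult)
  then show "\<And>i p. i \<in> {1..n} \<Longrightarrow> KH i (KI i p) = p" by blast
  have KHH: "KH i (KH j p) = KH j (KH i p)" if "i \<in> {1..n}" "j \<in> {1..n}" for i j p
    using comm[OF that] by (simp add: KH_def flip: act_mult)
  have KIH: "KI j (KH i p) = KH i (KI j p)" if "i \<in> {1..n}" "j \<in> {1..n}" for i j p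
    using KHI that KHH by metis
  have qh: "qh \<noteq> 0" using q by auto
  have K_data: "KH i 1 = 1" "KI i 1 = 1" "KH i (p1 * p2) = KH i p1 * KH i p2"
    "KI i (p1 * p2) = KI i p1 * KI i p2"
    if "i \<in> {1..n}" for i p1 p2
    using action that unfolding uq_action_def KH_def KI_def by blast+
  have KH_gen: "KH i (z j) = sA (if i = j then qh else 1) (z j)"
    "KH i (w j) = sA (if i = j then inverse qh else 1) (w j)"
    if "i \<in> {1..n}" "j \<in> {1..n}" for i j
    using action that unfolding uq_action_def KH_def by blast+
  have KI_gen: "KI i (z j) = sA (if i = j then inverse qh else 1) (z j)"
    "KI i (w j) = sA (if i = j then qh else 1) (w j)"
    if "i \<in> {1..n}" "j \<in> {1..n}" for i j
  proof -
    have eigen: "KI i p = sA (inverse d) p" if "KH i p = sA d p" "d \<noteq> 0" for p d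
    proof -
      have "p = sA d (KI i p)" using KHI(2)[OF \<open>i \<in> _\<close>, of p] that(1) by (simp add: KI_def act_simps)
      then have "sA (inverse d) p = sA (inverse d) (sA d (KI i p))" by simp
      then show ?thesis using that(2) by simp
    qed
    show "KI i (z j) = sA (if i = j then inverse qh else 1) (z j)"
      "KI i (w j) = sA (if i = j then qh else 1) (w j)"
      using eigen[OF KH_gen(1)[OF that]] eigen[OF KH_gen(2)[OF that]] qh by auto
  qed
  have EF_one: "act (gU (Egen i)) 1 = 0" "act (gU (Fgen i)) 1 = 0" if "i \<in> {1..<n}" for i
    using action that unfolding uq_action_def by blast+
  have EF_mult:
    "act (gU (Egen i)) (p1 * p2) = act (gU (Egen i)) p1 * KI i (KH (Suc i) p2) +
       KH i (KI (Suc i) p1) * act (gU (Egen i)) p2"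
    "act (gU (Fgen i)) (p1 * p2) = act (gU (Fgen i)) p1 * KI i (KH (Suc i) p2) +
       KH i (KI (Suc i) p1) * act (gU (Fgen i)) p2"
    if "i \<in> {1..<n}" for i p1 p2
    using action that unfolding uq_action_def KH_def KI_def by (simp_all add: act_mult)
  have EF_gen: "act (gU (Egen i)) (z j) = (if j = i + 1 then z (j - 1) else 0)"
    "act (gU (Fgen i)) (z j) = (if j = i then z (j + 1) else 0)"
    "act (gU (Egen i)) (w j) = (if j = i then sA (- inverse q) (w (j + 1)) else 0)"
    "act (gU (Fgen i)) (w j) = (if j = i + 1 then sA (- q) (w (j - 1)) else 0)"
    if "i \<in> {1..<n}" "j \<in> {1..n}" for i j
    using action that unfolding uq_action_def by blast+
  have KK_lin: "KH i (sA c p) = sA c (KH i p)" "KI i (sA c p) = sA c (KI i p)" for i c p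
    by (simp_all add: KH_def KI_def act_simps)
  \<comment> \<open>Precomposing with K turns the coproduct term e tensor K^(-1) into e K tensor 1
    and the term K tensor e into K^2 tensor e K. These two identities are therefore what yields the
    skew Leibniz rule.\<close>
  have cancel: "KI i (KH (Suc i) (KH i (KI (Suc i) p))) = p"
    and twist: "KH i (KI (Suc i) (KH i (KI (Suc i) p))) = KH i (KH i (KI (Suc i) (KI (Suc i) p)))"
    if "i \<in> {1..<n}" for i p
    using that by (simp_all add: KHH[of "Suc i" i] KHI KIH[of i "Suc i"])
  show "zw_action sA q n gA D Dbar qh KH KI
      (\<lambda>i p. sA qh (act (gU (Egen i)) (KH i (KI (Suc i) p))))
      (\<lambda>i p. sA (inverse qh) (act (gU (Fgen i)) (KH i (KI (Suc i) p))))"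
  proof (intro zw_action.intro zw_action_axioms.intro, goal_cases)
    case 1
    show ?case by (rule zw_calculus_axioms)
  next
    case 2
    show ?case by fact
  next
    case (3 i)
    show ?case unfolding KH_def by (rule lin)
  next
    case (4 i)
    show ?case unfolding KI_def by (rule lin)
  next
    case (12 i)
    show ?case unfolding KH_def KI_def
      by (rule scaled_linear[OF composed_linear[OF lin composed_linear[OF lin lin]]])
  next
    case (13 i)
    show ?case unfolding KH_def KI_def
      by (rule scaled_linear[OF composed_linear[OF lin composed_linear[OF lin lin]]])
  next
    case (16 i p p')
    then show ?case
      by (simp add: K_data EF_mult cancel twist scale_right_distrib scale_mult_left scale_mult_right)
  next
    case (17 i p p')
    then show ?case
      by (simp add: K_data EF_mult cancel twist scale_right_distrib scale_mult_left scale_mult_right)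
  next
    case (18 i j)
    then show ?case using qh by (simp add: KH_gen KI_gen KK_lin EF_gen act_simps)
  next
    case (19 i j)
    then show ?case using qh by (simp add: KH_gen KI_gen KK_lin EF_gen act_simps)
  next
    case (20 i j)
    then show ?case using qh by (simp add: KH_gen KI_gen KK_lin EF_gen act_simps)
  next
    case (21 i j)
    then show ?case using qh by (simp add: KH_gen KI_gen KK_lin EF_gen act_simps)
  qed (use K_data KHI KH_gen EF_one in \<open>auto simp: KK_lin\<close>)
qed

theorem proposition4:
  fixes q qh :: complex and n m m' :: nat
    and sA :: "complex \<Rightarrow> 'a::ring_1 \<Rightarrow> 'a" and gA :: "zw_gen \<Rightarrow> 'a"
    and D Dbar :: "nat \<Rightarrow> 'a \<Rightarrow> 'a"
    and sU :: "complex \<Rightarrow> 'u::ring_1 \<Rightarrow> 'u" and gU :: "uq_gen \<Rightarrow> 'u"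
    and act :: "'u \<Rightarrow> 'a \<Rightarrow> 'a"
  assumes "q \<noteq> 0" and "\<forall>k::nat. k > 0 \<longrightarrow> q ^ k \<noteq> 1" and "qh\<^sup>2 = q"
    and "n \<ge> 2"
    and "zw_algebra q n sA gA"
    and "z_derivatives q n sA gA D" and "w_derivatives q n sA gA Dbar"
    and "uq_gl q qh n sU gU"
    and "uq_action q qh n sU gU sA gA act"
  shows "subrepresentation sA act (bihomogeneous n sA gA m m') \<and>
    internal_direct_sum sA {0..min m m'}
      (\<lambda>j. (\<lambda>p. Q_element n gA ^ j * p) ` q_harmonic n sA gA D Dbar (m - j) (m' - j))
      (bihomogeneous n sA gA m m') \<and>
    (\<forall>j\<in>{0..min m m'}.
      rep_isomorphism sA act (\<lambda>p. Q_element n gA ^ j * p)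
        (q_harmonic n sA gA D Dbar (m - j) (m' - j))
        ((\<lambda>p. Q_element n gA ^ j * p) ` q_harmonic n sA gA D Dbar (m - j) (m' - j)) \<and>
      irreducible_rep sA act (q_harmonic n sA gA D Dbar (m - j) (m' - j)) \<and>
      has_highest_weight q n sA gU act (q_harmonic n sA gA D Dbar (m - j) (m' - j))
        (\<lambda>i. if i = 1 then int m - int j else if i = n then - int m' + int j else 0))"
proof -
  let ?KH = "\<lambda>i. act (gU (Khalf i))" and ?KI = "\<lambda>i. act (gU (Khalf_inv i))"
  let ?E = "\<lambda>i p. sA qh (act (gU (Egen i)) (?KH i (?KI (Suc i) p)))"
  let ?F = "\<lambda>i p. sA (inverse qh) (act (gU (Fgen i)) (?KH i (?KI (Suc i) p)))"
  interpret zw_action sA q n gA D Dbar qh ?KH ?KI ?E ?F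
    by (rule zw_action_of_uq_action(1)[OF assms])
  note KH_KI = zw_action_of_uq_action(2)[OF assms]
  have pres: "presented_by sU gU (uq_gens n) (uq_rels q qh n)"
    using assms(8) by (simp add: uq_gl_def)
  have rep: "Defs.representation sU sA act" using assms(9) by (simp add: uq_action_def)
  have act_lin: "Vector_Spaces.linear sA sA (act X)" for X
    using rep by (simp add: Defs.representation_def)
  have act_simps: "act (X + Y) p = act X p + act Y p" "act (sU c X) p = sA c (act X p)"
    "act (X * Y) p = act X (act Y p)" "act 1 p = p" "act 0 p = 0" for X Y c p
  proof -
    show *: "act (X + Y) p = act X p + act Y p" "act (sU c X) p = sA c (act X p)"
      "act (X * Y) p = act X (act Y p)" "act 1 p = p" for X Y c p
      using rep by (simp_all add: Defs.representation_def)
    show "act 0 p = 0" using *(1)[of 0 0 p] by simp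
  qed
  \<comment> \<open>Since K is invertible, the original generators are recovered from
    \<open>E i\<close> and \<open>F i\<close>, so invariance statements can be transferred between
    the two.\<close>
  have EF_act: "act (gU (Egen i)) p = sA (inverse qh) (?E i (?KH (Suc i) (?KI i p)))"
    "act (gU (Fgen i)) p = sA qh (?F i (?KH (Suc i) (?KI i p)))" if "i \<in> {1..<n}" for i p
    using that qh_nonzero KH_KI KI_KH by simp_all
  have subrep_iff: "subrepresentation sA act W \<longleftrightarrow> stable W" for W
  proof
    assume "subrepresentation sA act W"
    then show "stable W"
      by (auto simp: subrepresentation_def stable_def intro!: subspace_scale)
  next
    assume W: "stable W"
    then have sub: "subspace W" by (simp add: stable_def)
    have gens: "act (gU x) p \<in> W" if "x \<in> uq_gens n" "p \<in> W" for x p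
    proof -
      have KW: "?KH (Suc i) (?KI i p) \<in> W" if "i \<in> {1..<n}" for i
        using W \<open>p \<in> W\<close> that by (simp add: stable_def)
      have "?E i (?KH (Suc i) (?KI i p)) \<in> W" "?F i (?KH (Suc i) (?KI i p)) \<in> W"
        if "i \<in> {1..<n}" for i
        using W KW[OF that] that unfolding stable_def by blast+
      then have "act (gU (Egen i)) p \<in> W" "act (gU (Fgen i)) p \<in> W" if "i \<in> {1..<n}" for i
        using EF_act[OF that, of p] subspace_scale[OF sub] that by metis+
      then show ?thesis using that W by (auto simp: uq_gens_def stable_def)
    qed
    have "\<forall>p\<in>W. act X p \<in> W" for X
      by (rule presented_induct[OF pres])
         (use sub gens in \<open>auto simp: act_simps subspace_0 subspace_add subspace_scale\<close>)
    then show "subrepresentation sA act W" using sub by (simp add: subrepresentation_def)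
  qed
  have Q_act: "\<forall>p. act X (Q * p) = Q * act X p" for X
  proof (rule presented_induct[OF pres])
    fix x a assume x: "x \<in> uq_gens n" and a: "\<forall>p. act a (Q * p) = Q * act a p"
    have "act (gU (Egen i)) (Q * p) = Q * act (gU (Egen i)) p"
      "act (gU (Fgen i)) (Q * p) = Q * act (gU (Fgen i)) p" if i: "i \<in> {1..<n}" for i p
    proof -
      let ?p = "?KH (Suc i) (?KI i p)"
      have K: "?KH (Suc i) (?KI i (Q * p)) = Q * ?p"
        using Suc_range[OF i] by (simp only: Q_commute)
      have "act (gU (Egen i)) (Q * p) = sA (inverse qh) (Q * ?E i ?p)"
        by (rule trans[OF EF_act(1)[OF i]]) (simp only: K Q_commute(3)[OF i, of ?p])
      also have "\<dots> = Q * sA (inverse qh) (?E i ?p)" by (simp only: scale_mult_right)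
      also have "sA (inverse qh) (?E i ?p) = act (gU (Egen i)) p"
        by (rule EF_act(1)[OF i, symmetric])
      finally show "act (gU (Egen i)) (Q * p) = Q * act (gU (Egen i)) p" .
      have "act (gU (Fgen i)) (Q * p) = sA qh (Q * ?F i ?p)"
        by (rule trans[OF EF_act(2)[OF i]]) (simp only: K Q_commute(4)[OF i, of ?p])
      also have "\<dots> = Q * sA qh (?F i ?p)" by (simp only: scale_mult_right)
      also have "sA qh (?F i ?p) = act (gU (Fgen i)) p"
        by (rule EF_act(2)[OF i, symmetric])
      finally show "act (gU (Fgen i)) (Q * p) = Q * act (gU (Fgen i)) p" .
    qed
    then have "act (gU x) (Q * p) = Q * act (gU x) p" for p
      using x Q_commute(1,2) by (auto simp: uq_gens_def)
    then show "\<forall>p. act (gU x * a) (Q * p) = Q * act (gU x * a) p"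
      using a by (simp add: act_simps)
  qed (auto simp: act_simps distrib_left scale_mult_right)
  have Q_power_act: "act X (Q ^ j * p) = Q ^ j * act X p" for X j p
    by (induction j) (simp_all add: Q_act mult.assoc)
  have irred: "irreducible_rep sA act (H k k')" for k k'
    unfolding irreducible_rep_def subrep_iff
    using stable_H H_irreducible hw_H[of k k'] form_hw[of k k'] by (force simp: form_A_left)
  have iso: "rep_isomorphism sA act (\<lambda>p. Q ^ j * p) (H k k') ((\<lambda>p. Q ^ j * p) ` H k k')" for j k k'
  proof -
    have "inj_on (\<lambda>p. Q ^ j * p) (H k k')"
    proof (rule inj_onI)
      fix p p' assume p: "p \<in> H k k'" "p' \<in> H k k'" and eq: "Q ^ j * p = Q ^ j * p'"
      then have "Q ^ j * (p - p') = 0" by (simp add: right_diff_distrib)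
      moreover have "p - p' \<in> A k k'" using p H_A by (intro subspace_diff subspace_A) auto
      ultimately show "p = p'" using Q_power_injective[of "p - p'" k k' j] by simp
    qed
    then show ?thesis
      unfolding rep_isomorphism_def subrep_iff
      by (auto simp: stable_H stable_Q_power distrib_left scale_mult_right Q_power_act
          intro: inj_on_imp_bij_betw)
  qed
  have weight: "has_highest_weight q n sA gU act (H (m - j) (m' - j))
      (\<lambda>i. if i = 1 then int m - int j else if i = n then - int m' + int j else 0)"
    if j: "j \<in> {0..min m m'}" for j
  proof -
    let ?v = "hw (m - j) (m' - j)"
    have v_nonzero: "?v \<noteq> 0"
      using form_hw[of "m - j" "m' - j"] by (auto simp: form_A_left)
    have K_eigen: "?KH i ?v = sA (qh powi (int (conc 1 (m - j) i) - int (conc n (m' - j) i))) ?v"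
      "?KI i ?v = sA (inverse (qh powi (int (conc 1 (m - j) i) - int (conc n (m' - j) i)))) ?v"
      if "i \<in> {1..n}" for i
      using KH_monomial[OF that] KI_monomial[OF that] by (simp_all only: zw_def prod.case)
    have "act (gU (Egen i)) ?v = 0" if i: "i \<in> {1..<n}" for i
    proof -
      obtain c where "?KH (Suc i) (?KI i ?v) = sA c ?v"
        using Suc_range[OF i] by (simp only: K_eigen KH_simps scale_scale)
      then have "act (gU (Egen i)) ?v = sA (inverse qh) (?E i (sA c ?v))"
        using EF_act(1)[OF i, of ?v] by (simp only:)
      also have "?E i (sA c ?v) = 0"
        using E_simps(2)[OF i, of c ?v] E_hw[OF i] by (simp only: scale_zero_right)
      finally show ?thesis by (simp only: scale_zero_right)
    qed
    moreover have "act ((gU (Khalf i))\<^sup>2) ?v =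
        sA (q powi (if i = 1 then int m - int j else if i = n then - int m' + int j else 0)) ?v"
      if i: "i \<in> {1..n}" for i
    proof -
      let ?e = "int (conc 1 (m - j) i) - int (conc n (m' - j) i)"
      have "act ((gU (Khalf i))\<^sup>2) ?v = sA (qh powi ?e * qh powi ?e) ?v"
        using i by (simp only: power2_eq_square act_simps K_eigen KH_simps scale_scale)
      also have "qh powi ?e * qh powi ?e = q powi ?e"
        by (simp add: power_int_mult_distrib power2_eq_square flip: qh_square)
      also have "?e = (if i = 1 then int m - int j else if i = n then - int m' + int j else 0)"
        using j n_ge by (auto simp: conc_def of_nat_diff)
      finally show ?thesis .
    qed
    \<comment> \<open>The cyclic submodule generated by \<open>hw\<close> is nonzero and harmonic,
      so irreducibility makes it the whole space.\<close>
    moreover have "H (m - j) (m' - j) = range (\<lambda>X. act X ?v)"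
    proof -
      have "subspace (range (\<lambda>X. act X ?v))"
      proof (rule subspaceI)
        show "0 \<in> range (\<lambda>X. act X ?v)" by (rule range_eqI[of _ _ 0]) (simp add: act_simps)
        show "a + b \<in> range (\<lambda>X. act X ?v)" if "a \<in> range (\<lambda>X. act X ?v)" "b \<in> range (\<lambda>X. act X ?v)" for a b
          using that by (auto simp flip: act_simps(1))
        show "sA c a \<in> range (\<lambda>X. act X ?v)" if "a \<in> range (\<lambda>X. act X ?v)" for a c
          using that by (auto simp flip: act_simps(2))
      qed
      then have "subrepresentation sA act (range (\<lambda>X. act X ?v))"
        by (auto simp: subrepresentation_def simp flip: act_simps(3))
      moreover have "range (\<lambda>X. act X ?v) \<subseteq> H (m - j) (m' - j)"
        using irred[of "m - j" "m' - j"] hw_H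
        by (auto simp: irreducible_rep_def subrepresentation_def)
      moreover have "?v \<in> range (\<lambda>X. act X ?v)"
        by (rule range_eqI[of _ _ 1]) (simp only: act_simps)
      ultimately show ?thesis
        using irred[of "m - j" "m' - j"] v_nonzero unfolding irreducible_rep_def by blast
    qed
    ultimately show ?thesis
      unfolding has_highest_weight_def using hw_H v_nonzero by blast
  qed
  have direct: "internal_direct_sum sA {0..min m m'}
      (\<lambda>j. (\<lambda>p. Q ^ j * p) ` H (m - j) (m' - j)) (A m m')"
    unfolding internal_direct_sum_def
  proof (intro conjI ballI allI impI)
    let ?V = "\<lambda>j. (\<lambda>p. Q ^ j * p) ` H (m - j) (m' - j)"
    show "subspace (?V j)" for j
      using stable_Q_power[OF stable_H] by (simp add: stable_def)
    have V_A: "?V j \<subseteq> A m m'" if "j \<in> {0..min m m'}" for j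
      using Q_power_A[of _ "m - j" "m' - j" j] H_A that by (auto simp: subset_iff)
    show "A m m' = {\<Sum>j\<in>{0..min m m'}. v j | v. \<forall>j\<in>{0..min m m'}. v j \<in> ?V j}"
    proof (intro equalityI subsetI)
      fix p assume "p \<in> A m m'"
      then obtain v where "\<forall>j\<in>{0..min m m'}. v j \<in> H (m - j) (m' - j)"
        "p = (\<Sum>j\<in>{0..min m m'}. Q ^ j * v j)"
        using decomposition_exists by blast
      then show "p \<in> {\<Sum>j\<in>{0..min m m'}. v j | v. \<forall>j\<in>{0..min m m'}. v j \<in> ?V j}"
        by (intro CollectI exI[of _ "\<lambda>j. Q ^ j * v j"]) blast
    next
      fix p assume "p \<in> {\<Sum>j\<in>{0..min m m'}. v j | v. \<forall>j\<in>{0..min m m'}. v j \<in> ?V j}"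
      then obtain v where v: "\<forall>j\<in>{0..min m m'}. v j \<in> ?V j" "p = (\<Sum>j\<in>{0..min m m'}. v j)"
        by blast
      then show "p \<in> A m m'"
        using V_A unfolding v(2) by (intro subspace_sum subspace_A) blast
    qed
    fix v j
    assume v: "(\<forall>j\<in>{0..min m m'}. v j \<in> ?V j) \<and> (\<Sum>j\<in>{0..min m m'}. v j) = 0"
      and j: "j \<in> {0..min m m'}"
    from v have "\<forall>j\<in>{0..min m m'}. \<exists>u. u \<in> H (m - j) (m' - j) \<and> v j = Q ^ j * u" by blast
    then obtain u where u: "\<forall>j\<in>{0..min m m'}. u j \<in> H (m - j) (m' - j) \<and> v j = Q ^ j * u j"
      by metis
    then have "(\<Sum>j\<in>{0..min m m'}. Q ^ j * u j) = 0" using v by simp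
    then have "u j = 0" using decomposition_unique[of m m' u j] u j by blast
    then show "v j = 0" using u j by simp
  qed simp
  show ?thesis
    using stable_A direct iso irred weight unfolding subrep_iff by blast
qed

end
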